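(* Let $(R,\mathfrak m)$ be a Noetherian local ring of dimension $d>0$, let $r\ge 2$ be an integer, and let $I_1,\dots,I_r$ be arbitrary $\mathfrak m$-primary ideals of $R$. Then $$e^{r-2}(R/I_1\oplus\dots\oplus R/I_r)=E_{r-1}(I_1,\dots,I_r)-(d+1)(r-1)\,e(R/[I_1+\dots+I_r]),$$ where $$E_{r-1}(I_1,\dots,I_r):=\sum_{j=1}^r e\big(R/[I_1+\dots+\widehat{I_j}+\dots+I_r]\oplus R/[I_1+\dots+I_r]\big)$$ and $\widehat{I_j}$ means that the summand $I_j$ is omitted.
   Context: $\ell_R$ denotes length of an $R$-module. Let $C$ be an $R$-module of finite length with minimal free presentation $R^n\xrightarrow{\varphi}F=R^r\to C\to 0$. Let $S=\mathrm{Sym}_R(F)$ with degree-$p$ component $S_p$, and let $R[M]=\mathrm{Im}(\mathrm{Sym}_R(\varphi))\subset S$ with degree-$p$ component $M^p$. For $C=R/I_1\oplus\dots\oplus R/I_r$ with $I_i$ $\mathfrak m$-primary, this means $S=R[t_1,\dots,t_r]$ (standard grading) and $R[M]=R[I_1t_1,\dots,I_rt_r]$. The Buchsbaum-Rim function of two variables of $C$ is $\Lambda(p,q)=\ell_R(S_{p+q}/M^pS_q)$. For $p,q\gg0$ it agrees with a polynomial of total degree $d+r-1$ (known fact). The associated Buchsbaum-Rim multiplicities are, for $j=0,1,\dots,d+r-1$, $$e^j(C):=(\text{coefficient of }p^{d+r-1-j}q^j\text{ in this polynomial})\cdot(d+r-1-j)!\,j!.$$ The ordinary Buchsbaum-Rim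 function of $C$ is $\lambda_C(p)=\ell_R(S_p/M^p)$; for $p\gg0$ it agrees with a polynomial of degree $d+r-1$, and the ordinary Buchsbaum-Rim multiplicity $e(C)$ is $(d+r-1)!$ times its leading coefficient. (Here $r$ is the rank of the free module $F$ in the minimal presentation of the module in question; thus for a sum of $m$ cyclic modules $R/K_1\oplus\dots\oplus R/K_m$ one uses $S=R[t_1,\dots,t_m]$ and degree $d+m-1$. For one cyclic module, $e(R/K)$ is the Hilbert-Samuel multiplicity of $K$.) *)

theory Defs
  imports
    Complex_Main
    "HOL-Library.Set_Algebras"
    "HOL-Library.Extended_Nat"
    "HOL-Library.Poly_Mapping"
    "HOL-Computational_Algebra.Polynomial"
begin

text \<open>
  The ground ring \<open>R\<close> is a type \<open>'a :: comm_ring_1\<close>. Ideals are the submodules of \<open>R\<close>.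
\<close>

global_interpretation ring_mod: module "(*) :: 'a::comm_ring_1 \<Rightarrow> 'a \<Rightarrow> 'a"
  defines is_ideal = ring_mod.subspace and ideal_span = ring_mod.span
  by unfold_locales (simp_all add: algebra_simps)

definition prime_ideal :: "'a::comm_ring_1 set \<Rightarrow> bool" where
  "prime_ideal P \<longleftrightarrow> is_ideal P \<and> P \<noteq> UNIV \<and> (\<forall>a b. a * b \<in> P \<longrightarrow> a \<in> P \<or> b \<in> P)"

definition maximal_ideal :: "'a::comm_ring_1 set \<Rightarrow> bool" where
  "maximal_ideal J \<longleftrightarrow> is_ideal J \<and> J \<noteq> UNIV \<and> (\<forall>K. is_ideal K \<and> J \<subseteq> K \<longrightarrow> K = J \<or> K = UNIV)"

definition radical :: "'a::comm_ring_1 set \<Rightarrow> 'a set" where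
  "radical Q = {x. \<exists>n. x ^ n \<in> Q}"

definition primary_ideal :: "'a::comm_ring_1 set \<Rightarrow> bool" where
  "primary_ideal Q \<longleftrightarrow> is_ideal Q \<and> Q \<noteq> UNIV \<and>
     (\<forall>a b. a * b \<in> Q \<longrightarrow> a \<in> Q \<or> b \<in> radical Q)"

definition primary_to :: "'a::comm_ring_1 set \<Rightarrow> 'a set \<Rightarrow> bool" where
  "primary_to m Q \<longleftrightarrow> primary_ideal Q \<and> radical Q = m"

definition noetherian :: "'a::comm_ring_1 itself \<Rightarrow> bool" where
  "noetherian _ \<longleftrightarrow> (\<forall>J :: 'a set. is_ideal J \<longrightarrow> (\<exists>B. finite B \<and> J = ideal_span B))"

definition local_ring :: "'a::comm_ring_1 set \<Rightarrow> bool" where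
  "local_ring m \<longleftrightarrow> maximal_ideal m \<and> (\<forall>n. maximal_ideal n \<longrightarrow> n = m)"

definition krull_dim :: "'a::comm_ring_1 itself \<Rightarrow> enat" where
  "krull_dim _ = Sup {enat n | n. \<exists>P :: nat \<Rightarrow> 'a set.
     (\<forall>i\<le>n. prime_ideal (P i)) \<and> (\<forall>i<n. P i \<subset> P (Suc i))}"

text \<open>
  Polynomials over \<open>R\<close> in the variables \<open>t\<^sub>0, t\<^sub>1, \<dots>\<close> (numbered from \<open>0\<close>): finitely supported maps
  from exponent vectors to coefficients. \<open>R\<close> acts through the constant polynomials.
\<close>

type_synonym 'a mpoly = "(nat \<Rightarrow>\<^sub>0 nat) \<Rightarrow>\<^sub>0 'a"

definition const_poly :: "'a::comm_ring_1 \<Rightarrow> 'a mpoly" where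
  "const_poly c = Poly_Mapping.single 0 c"

global_interpretation poly_mod: module "\<lambda>c (f :: 'a::comm_ring_1 mpoly). const_poly c * f"
  defines is_submodule = poly_mod.subspace and submodule_span = poly_mod.span
  by unfold_locales
    (simp_all add: const_poly_def distrib_left distrib_right single_add mult_single flip: mult.assoc)

text \<open>
  The component \<open>S\<^sub>p\<close> of \<open>S = R[t\<^sub>0, \<dots>, t\<^sub>r\<^sub>-\<^sub>1] = Sym(F)\<close>, where \<open>F = R\<^sup>r\<close> is identified with \<open>S\<^sub>1\<close>.
\<close>

definition sym_comp :: "nat \<Rightarrow> nat \<Rightarrow> 'a::comm_ring_1 mpoly set" where
  "sym_comp r p = {f. \<forall>e \<in> Poly_Mapping.keys f.
     Poly_Mapping.keys e \<subseteq> {..<r} \<and> (\<Sum>i<r. Poly_Mapping.lookup e i) = p}"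

text \<open>
  Let \<open>M \<subseteq> F = S\<^sub>1\<close> be the image of a minimal free presentation \<open>\<phi>\<close> of \<open>C = F/M\<close>. The image of
  \<open>Sym(\<phi>)\<close> is the \<open>R\<close>-subalgebra \<open>R[M]\<close> of \<open>S\<close> generated by \<open>M\<close>; its degree-\<open>p\<close> component is \<open>M\<^sup>p\<close>.
\<close>

inductive_set rees_alg :: "'a::comm_ring_1 mpoly set \<Rightarrow> 'a mpoly set" for M where
  const: "const_poly c \<in> rees_alg M"
| gen: "f \<in> M \<Longrightarrow> f \<in> rees_alg M"
| add: "f \<in> rees_alg M \<Longrightarrow> g \<in> rees_alg M \<Longrightarrow> f + g \<in> rees_alg M"
| mult: "f \<in> rees_alg M \<Longrightarrow> g \<in> rees_alg M \<Longrightarrow> f * g \<in> rees_alg M"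

definition rees_comp :: "nat \<Rightarrow> 'a::comm_ring_1 mpoly set \<Rightarrow> nat \<Rightarrow> 'a mpoly set" where
  "rees_comp r M p = rees_alg M \<inter> sym_comp r p"

definition module_prod :: "'a::comm_ring_1 mpoly set \<Rightarrow> 'a mpoly set \<Rightarrow> 'a mpoly set" where
  "module_prod A B = submodule_span {f * g | f g. f \<in> A \<and> g \<in> B}"

text \<open>
  The length of \<open>N/L\<close> for submodules \<open>L \<subseteq> N\<close>, i.e. the supremum of the lengths of chains of
  submodules of \<open>N/L\<close>; these submodules are the \<open>K/L\<close> with \<open>L \<subseteq> K \<subseteq> N\<close>.
\<close>

definition quot_length :: "'a::comm_ring_1 mpoly set \<Rightarrow> 'a mpoly set \<Rightarrow> enat" where
  "quot_length N L = Sup {enat n | n. \<exists>K :: nat \<Rightarrow> 'a mpoly set.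
     (\<forall>i\<le>n. is_submodule (K i) \<and> L \<subseteq> K i \<and> K i \<subseteq> N) \<and> (\<forall>i<n. K i \<subset> K (Suc i))}"

text \<open>The Buchsbaum-Rim functions \<open>\<lambda>(p)\<close> and \<open>\<Lambda>(p,q)\<close>.\<close>

definition br_fun :: "nat \<Rightarrow> 'a::comm_ring_1 mpoly set \<Rightarrow> nat \<Rightarrow> enat" where
  "br_fun r M p = quot_length (sym_comp r p) (rees_comp r M p)"

definition br_fun2 :: "nat \<Rightarrow> 'a::comm_ring_1 mpoly set \<Rightarrow> nat \<Rightarrow> nat \<Rightarrow> enat" where
  "br_fun2 r M p q =
     quot_length (sym_comp r (p + q)) (module_prod (rees_comp r M p) (sym_comp r q))"

text \<open>
  The polynomials with which these functions agree for large arguments. In the bivariate case the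
  outer variable stands for \<open>p\<close> and the inner one for \<open>q\<close>, so that \<open>coeff (coeff P a) b\<close> is the
  coefficient of \<open>p\<^sup>a q\<^sup>b\<close>.
\<close>

definition br_poly :: "nat \<Rightarrow> 'a::comm_ring_1 mpoly set \<Rightarrow> rat poly" where
  "br_poly r M = (THE P. \<exists>N. \<forall>p\<ge>N. \<exists>k.
     br_fun r M p = enat k \<and> of_nat k = poly P (of_nat p))"

definition br_poly2 :: "nat \<Rightarrow> 'a::comm_ring_1 mpoly set \<Rightarrow> rat poly poly" where
  "br_poly2 r M = (THE P. \<exists>N. \<forall>p\<ge>N. \<forall>q\<ge>N. \<exists>k.
     br_fun2 r M p q = enat k \<and> of_nat k = poly (poly P [:of_nat p:]) (of_nat q))"

text \<open>
  The kernel \<open>J\<^sub>0t\<^sub>0 + \<dots> + J\<^sub>m\<^sub>-\<^sub>1t\<^sub>m\<^sub>-\<^sub>1\<close> of the canonical map from \<open>F = R\<^sup>m\<close> onto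
  \<open>R/J\<^sub>0 \<oplus> \<dots> \<oplus> R/J\<^sub>m\<^sub>-\<^sub>1\<close>, for a list of ideals. The presentation is minimal if all these ideals
  are proper. The sum is the elementwise sum of sets.
\<close>

definition cyclic_sum_ker :: "'a::comm_ring_1 set list \<Rightarrow> 'a mpoly set" where
  "cyclic_sum_ker Js =
     (\<Sum>i<length Js. (\<lambda>a. Poly_Mapping.single (Poly_Mapping.single i 1) a) ` (Js ! i))"

text \<open>
  The multiplicities \<open>e(C)\<close> and \<open>e\<^sup>j(C)\<close> of \<open>C = R/J\<^sub>0 \<oplus> \<dots> \<oplus> R/J\<^sub>m\<^sub>-\<^sub>1\<close> over a ring of dimension \<open>d\<close>.
  The Buchsbaum-Rim polynomials of \<open>C\<close> have (total) degree \<open>d + m - 1\<close>.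
\<close>

definition br_mult :: "nat \<Rightarrow> 'a::comm_ring_1 set list \<Rightarrow> rat" where
  "br_mult d Js = (let m = length Js; D = d + m - 1
     in coeff (br_poly m (cyclic_sum_ker Js)) D * fact D)"

definition assoc_br_mult :: "nat \<Rightarrow> nat \<Rightarrow> 'a::comm_ring_1 set list \<Rightarrow> rat" where
  "assoc_br_mult d j Js = (let m = length Js; D = d + m - 1
     in coeff (coeff (br_poly2 m (cyclic_sum_ker Js)) (D - j)) j * fact (D - j) * fact j)"

text \<open>The invariant \<open>E\<^sub>r\<^sub>-\<^sub>1(I\<^sub>0, \<dots>, I\<^sub>r\<^sub>-\<^sub>1)\<close>; the inner sums are sums of ideals.\<close>

definition E_pred :: "nat \<Rightarrow> nat \<Rightarrow> (nat \<Rightarrow> 'a::comm_ring_1 set) \<Rightarrow> rat" where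
  "E_pred d r I = (\<Sum>j<r. br_mult d [\<Sum>i\<in>{..<r} - {j}. I i, \<Sum>i<r. I i])"

end

theory Submission
  imports Defs "HOL-Library.List_Lexorder"
begin

text \<open>
  Write \<open>J(p, e)\<close> for the ideal with \<open>M\<^sup>pS\<^sub>q \<inter> R t\<^sup>e = J(p, e) t\<^sup>e\<close>, so that
  \<open>\<Lambda>(p, q) = \<Sum>\<^bsub>|e| = p + q\<^esub> \<ell>(R/J(p, e))\<close>, and let \<open>I = I\<^sub>1 + \<dots> + I\<^sub>r\<close> and \<open>K\<^sub>j = \<Sum>\<^bsub>i \<noteq> j\<^esub> I\<^sub>i\<close>.
  If all entries of \<open>e\<close> are at least \<open>p\<close>, then \<open>J(p, e) = I\<^sup>p\<close>; if only \<open>e\<^sub>j = c\<close> is smaller, then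
  \<open>J(p, e) = K\<^sub>j\<^bsup>p - c\<^esup> I\<^sup>c\<close>. For fixed \<open>p\<close> and growing \<open>q\<close> the remaining vectors contribute only \<open>O(q\<^bsup>r - 3\<^esup>)\<close>,
  so that counting the others gives the coefficient of \<open>q\<^bsup>r - 2\<^esup>\<close>. It involves \<open>\<ell>(R/I\<^sup>p)\<close> and
  \<open>\<Sum>\<^bsub>c \<le> p\<^esub> \<ell>(R/K\<^sub>j\<^bsup>p - c\<^esup> I\<^sup>c)\<close>, the ordinary Buchsbaum-Rim functions of \<open>R/I\<close> and \<open>R/K\<^sub>j \<oplus> R/I\<close>, and
  the coefficients of \<open>p\<^bsup>d + 1\<^esup>\<close> are compared. Of dimension theory this uses only that \<open>\<ell>(R/I\<^sup>p) = O(p\<^sup>d)\<close>.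

  The functions are eventually polynomial by a monomial-order argument: ordering the monomials in
  generators of \<open>M\<close> and \<open>F\<close> lexicographically, \<open>\<ell>(M\<^sup>iS\<^bsub>j + 1\<^esub>/M\<^bsup>i + 1\<^esup>S\<^sub>j)\<close> becomes a sum over exponent vectors of
  values of antitone functions, and an antitone function \<open>\<nat>\<^sup>n \<rightarrow> \<nat>\<close> depends only on the truncation of
  its argument at some bound.
\<close>

section \<open>The semiring of submodules of the polynomial ring\<close>

text \<open>Since \<open>br_poly\<close> and \<open>br_poly2\<close> are definite descriptions,
  their coefficients mean nothing before existence and uniqueness of these polynomials are known.
  The obstacle to existence is that \<Lambda>(p, q) is a sum of lengths along i + j = p + q - 1 that
  reaches small i, where agreement with a polynomial for large i and j says nothing. The lengths are
  therefore shown to be finite sums of products f(i) g(j) with f and g eventually polynomial. The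
  constant (d + 1)(r - 1) comes from a count. The vectors with all entries at least p number binom(q
  - (r - 1)p + r - 1, r - 1), and the coefficient of q^(r-2) in it contains -(r - 1)^2 p/(r - 1)!.
  Multiplied by the p^d term of the length of R/I^p and by (d + 1)! (r - 2)!, this becomes -(d +
  1)(r - 1) e(R/I). A single small entry is some c < p, so these vectors miss the summand c = p of
  the function of R/K_j + R/I. That summand is the length of R/I^p, which has degree at most d and
  does not reach p^(d+1). Vectors with two small entries need only a bound on R/J(p, e) that is
  uniform in e.\<close>

typedef (overloaded) 'a msub = "{A :: 'a::comm_ring_1 mpoly set. is_submodule A}"
  morphisms set_of Abs_msub
  using poly_mod.subspace_0 poly_mod.subspace_single_0 by blast

lemma is_submodule_set_of [simp]: "is_submodule (set_of A)"
  using set_of[of A] by simp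

lemma set_of_Abs [simp]: "is_submodule A \<Longrightarrow> set_of (Abs_msub A) = A"
  by (simp add: Abs_msub_inverse)

lemma zero_in_set_of [simp]: "0 \<in> set_of A"
  by (rule poly_mod.subspace_0) simp

lemma set_of_add: "f \<in> set_of A \<Longrightarrow> g \<in> set_of A \<Longrightarrow> f + g \<in> set_of A"
  by (rule poly_mod.subspace_add) simp_all

lemma set_of_diff: "f \<in> set_of A \<Longrightarrow> g \<in> set_of A \<Longrightarrow> f - g \<in> set_of A"
  by (rule poly_mod.subspace_diff) simp_all

lemma set_of_scale: "f \<in> set_of A \<Longrightarrow> const_poly c * f \<in> set_of A"
  by (rule poly_mod.subspace_scale) simp_all

lemma set_of_sum: "(\<And>x. x \<in> X \<Longrightarrow> f x \<in> set_of A) \<Longrightarrow> sum f X \<in> set_of A"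
  by (rule poly_mod.subspace_sum) simp_all

lemma is_submoduleI:
  assumes "0 \<in> A" "\<And>f g. f \<in> A \<Longrightarrow> g \<in> A \<Longrightarrow> f + g \<in> A"
    "\<And>c f. f \<in> A \<Longrightarrow> const_poly c * f \<in> A"
  shows "is_submodule A"
  using assms by (simp add: poly_mod.subspace_def)

lemma const_poly_1 [simp]: "const_poly 1 = 1"
  by (simp add: const_poly_def)

lemma const_poly_0 [simp]: "const_poly 0 = 0"
  by (simp add: const_poly_def)

lemma const_poly_add: "const_poly (a + b) = const_poly a + const_poly b"
  by (simp add: const_poly_def single_add)

lemma const_poly_mult: "const_poly (a * b) = const_poly a * const_poly b"
  by (simp add: const_poly_def mult_single)

lemma const_poly_eq_iff [simp]: "const_poly a = const_poly b \<longleftrightarrow> a = b"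
  by (metis const_poly_def lookup_single_eq)

text \<open>The unit is R itself, embedded as the constant polynomials, so \<open>A \<le> 1\<close>
  says that \<open>A\<close> is an ideal of R.\<close>

instantiation msub :: (comm_ring_1) "{order, inf, zero, one, plus, times}"
begin

definition "A \<le> B \<longleftrightarrow> set_of A \<subseteq> set_of B"
definition "A < B \<longleftrightarrow> set_of A \<subset> set_of B"
definition "inf A B = Abs_msub (set_of A \<inter> set_of B)"
definition "0 = Abs_msub {0}"
definition "1 = Abs_msub (submodule_span {1})"
definition "A + B = Abs_msub (set_of A + set_of B)"
definition "A * B = Abs_msub (module_prod (set_of A) (set_of B))"

instance
  by standard (auto simp: less_eq_msub_def less_msub_def set_of_inject)

end

lemma set_of_inf: "set_of (inf A B) = set_of A \<inter> set_of B"
  by (simp add: inf_msub_def poly_mod.subspace_inter)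

lemma set_of_0: "set_of 0 = {0}"
  by (simp add: zero_msub_def poly_mod.subspace_single_0)

lemma set_of_1: "set_of 1 = (range const_poly :: 'a::comm_ring_1 mpoly set)"
  by (simp only: one_msub_def set_of_Abs[OF poly_mod.subspace_span]) (simp add: poly_mod.span_singleton)

lemma set_of_plus: "set_of (A + B) = set_of A + set_of B"
proof -
  have "set_of A + set_of B = submodule_span (set_of A \<union> set_of B)"
    by (auto simp: poly_mod.span_Un poly_mod.span_eq_iff[THEN iffD2] set_plus_def)
  then show ?thesis by (simp only: plus_msub_def set_of_Abs[OF poly_mod.subspace_span])
qed

lemma set_of_times: "set_of (A * B) = module_prod (set_of A) (set_of B)"
  by (simp add: times_msub_def module_prod_def)

lemma times_in_set_of: "f \<in> set_of A \<Longrightarrow> g \<in> set_of B \<Longrightarrow> f * g \<in> set_of (A * B)"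
  by (auto simp: set_of_times module_prod_def intro!: poly_mod.span_base)

text \<open>A product is the span of the products of elements, so upper bounds are tested on these.
  This universal property replaces computations with spans.\<close>

lemma times_le_iff: "A * B \<le> C \<longleftrightarrow> (\<forall>f\<in>set_of A. \<forall>g\<in>set_of B. f * g \<in> set_of C)"
proof
  assume "\<forall>f\<in>set_of A. \<forall>g\<in>set_of B. f * g \<in> set_of C"
  then have "module_prod (set_of A) (set_of B) \<subseteq> set_of C"
    unfolding module_prod_def by (intro poly_mod.span_minimal) auto
  then show "A * B \<le> C" by (simp add: less_eq_msub_def set_of_times)
qed (auto simp: less_eq_msub_def dest: times_in_set_of)

lemma plus_in_set_of: "f \<in> set_of A \<Longrightarrow> g \<in> set_of B \<Longrightarrow> f + g \<in> set_of (A + B)"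
  by (auto simp: set_of_plus)

lemma plus_le_iff: "A + B \<le> C \<longleftrightarrow> A \<le> C \<and> B \<le> C" for A B C :: "'a::comm_ring_1 msub"
proof
  assume *: "A + B \<le> C"
  have "f \<in> set_of C" if "f \<in> set_of A" for f
    using plus_in_set_of[OF that zero_in_set_of[of B]] * by (auto simp: less_eq_msub_def)
  moreover have "f \<in> set_of C" if "f \<in> set_of B" for f
    using plus_in_set_of[OF zero_in_set_of[of A] that] * by (auto simp: less_eq_msub_def)
  ultimately show "A \<le> C \<and> B \<le> C" by (auto simp: less_eq_msub_def)
next
  assume "A \<le> C \<and> B \<le> C"
  then show "A + B \<le> C"
    by (auto simp: less_eq_msub_def set_of_plus set_plus_def intro!: set_of_add)
qed

text \<open>A Yoneda principle for the order: together with \<open>plus_le_iff\<close> it yields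
  laws of addition without touching elements.\<close>

lemma msub_eqI: "(\<And>C. A \<le> C \<longleftrightarrow> B \<le> C) \<Longrightarrow> A = B" for A B :: "'a::comm_ring_1 msub"
  using order_antisym[of A B] by blast

text \<open>The \<open>k\<close> with \<open>k * h\<close> in \<open>D\<close> form a submodule (a
  colon module), so membership passes from products of elements to their span.\<close>

lemma times_le_colon:
  assumes "\<And>f g. f \<in> set_of A \<Longrightarrow> g \<in> set_of B \<Longrightarrow> f * g * h \<in> set_of D" "k \<in> set_of (A * B)"
  shows "k * h \<in> set_of D"
proof -
  have sub: "is_submodule {k. k * h \<in> set_of D}"
  proof (rule is_submoduleI)
    fix c f assume "f \<in> {k. k * h \<in> set_of D}"
    then show "const_poly c * f \<in> {k. k * h \<in> set_of D}"
      by (simp only: mem_Collect_eq mult.assoc) (rule set_of_scale)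
  qed (simp_all add: distrib_right set_of_add)
  have "A * B \<le> Abs_msub {k. k * h \<in> set_of D}"
    using assms(1) by (simp only: times_le_iff set_of_Abs[OF sub]) simp
  then have "k \<in> {k. k * h \<in> set_of D}"
    using assms(2) unfolding less_eq_msub_def set_of_Abs[OF sub] by (rule subsetD)
  then show ?thesis by simp
qed

lemma times_times_le_iff:
  "A * B * C \<le> D \<longleftrightarrow> (\<forall>f\<in>set_of A. \<forall>g\<in>set_of B. \<forall>h\<in>set_of C. f * g * h \<in> set_of D)"
proof
  assume "A * B * C \<le> D"
  then show "\<forall>f\<in>set_of A. \<forall>g\<in>set_of B. \<forall>h\<in>set_of C. f * g * h \<in> set_of D"
    by (meson times_le_iff times_in_set_of)
next
  assume *: "\<forall>f\<in>set_of A. \<forall>g\<in>set_of B. \<forall>h\<in>set_of C. f * g * h \<in> set_of D"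
  have "k * h \<in> set_of D" if "k \<in> set_of (A * B)" "h \<in> set_of C" for k h
    by (rule times_le_colon[OF _ that(1)]) (use * that(2) in blast)
  then show "A * B * C \<le> D"
    by (simp add: times_le_iff)
qed

lemma times_msub_commute: "A * B = B * A" for A B :: "'a::comm_ring_1 msub"
proof -
  have "A * B \<le> B * A" for A B :: "'a msub"
    unfolding times_le_iff by (metis mult.commute times_in_set_of)
  then show ?thesis by (simp add: order_antisym)
qed

lemma times_msub_assoc: "A * B * C = A * (B * C)" for A B C :: "'a::comm_ring_1 msub"
proof -
  have "A * B * C \<le> A * (B * C)" for A B C :: "'a msub"
    unfolding times_times_le_iff by (simp only: mult.assoc) (blast intro: times_in_set_of)
  \<comment> \<open>Commutativity turns the instance with \<open>A\<close> and \<open>C\<close>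
    exchanged into the reverse inclusion.\<close>
  from this[of A B C] this[of C B A] show ?thesis
    by (simp only: times_msub_commute[of _ A] times_msub_commute[of C] order_antisym)
qed

instance msub :: (comm_ring_1) comm_semiring_1
proof
  fix A B C :: "'a msub"
  show "A * B = B * A" by (rule times_msub_commute)
  show "A * B * C = A * (B * C)" by (rule times_msub_assoc)
  show "A + B = B + A" by (rule msub_eqI) (auto simp: plus_le_iff)
  show "A + B + C = A + (B + C)" by (rule msub_eqI) (auto simp: plus_le_iff)
  have zero_le: "0 \<le> C" for C :: "'a msub" by (simp add: less_eq_msub_def set_of_0)
  show "0 + A = A" by (rule msub_eqI) (simp add: plus_le_iff zero_le)
  show *: "0 * A = 0"
    by (rule order_antisym) (simp_all add: zero_le times_le_iff set_of_0)
  show "A * 0 = 0"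
    using * by (simp add: times_msub_commute)
  show "1 * A = A"
  proof (rule order_antisym)
    show "1 * A \<le> A" by (auto simp: times_le_iff set_of_1 set_of_scale)
    have "f \<in> set_of (1 * A)" if "f \<in> set_of A" for f
      using times_in_set_of[of 1 1 f A] that by (simp add: set_of_1) (metis const_poly_1 rangeI)
    then show "A \<le> 1 * A" by (auto simp: less_eq_msub_def)
  qed
  show "(0::'a msub) \<noteq> 1"
  proof
    assume "(0::'a msub) = 1"
    then have "range (const_poly :: 'a \<Rightarrow> _) = {0}" by (metis set_of_0 set_of_1)
    then show False by (metis const_poly_0 const_poly_eq_iff rangeI singletonD zero_neq_one)
  qed
  show "(A + B) * C = A * C + B * C"
  proof (rule msub_eqI)
    fix D
    have "(A + B) * C \<le> D" if "A * C \<le> D" "B * C \<le> D"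
      unfolding times_le_iff
    proof (intro ballI)
      fix f g assume "f \<in> set_of (A + B)" "g \<in> set_of C"
      then obtain a b where "f = a + b" "a \<in> set_of A" "b \<in> set_of B"
        by (auto simp: set_of_plus set_plus_def)
      then show "f * g \<in> set_of D"
        using that \<open>g \<in> set_of C\<close> by (simp add: times_le_iff distrib_right set_of_add)
    qed
    moreover have "A * C \<le> D \<and> B * C \<le> D" if D: "(A + B) * C \<le> D"
    proof -
      have "f \<in> set_of (A + B)" if "f \<in> set_of A \<or> f \<in> set_of B" for f
        using that plus_in_set_of[of f A 0 B] plus_in_set_of[of 0 A f B] by auto
      then show ?thesis using D by (auto simp: times_le_iff)
    qed
    ultimately show "(A + B) * C \<le> D \<longleftrightarrow> A * C + B * C \<le> D" by (auto simp: plus_le_iff)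
  qed
qed

instance msub :: (comm_ring_1) "{ordered_comm_semiring, canonically_ordered_monoid_add, semilattice_inf}"
proof
  fix A B C :: "'a msub"
  show "A \<le> B \<longleftrightarrow> (\<exists>C. B = A + C)"
  proof
    assume "A \<le> B"
    then have "B = A + B" by (intro msub_eqI) (auto simp: plus_le_iff)
    then show "\<exists>C. B = A + C" ..
  next
    assume "\<exists>C. B = A + C"
    then show "A \<le> B" using plus_le_iff[of A _ B] by auto
  qed
  show "C + A \<le> C + B" if "A \<le> B"
  proof -
    have "C \<le> C + B" "B \<le> C + B" using plus_le_iff[of C B "C + B"] by auto
    then show ?thesis using that by (simp add: plus_le_iff)
  qed
  show "A \<le> B \<Longrightarrow> C * A \<le> C * B"
    unfolding times_le_iff by (auto simp: less_eq_msub_def intro: times_in_set_of)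
qed (auto simp: less_eq_msub_def set_of_inf)

lemma msub_add_idem [simp]: "A + A = A" for A :: "'a::comm_ring_1 msub"
  by (rule msub_eqI) (simp add: plus_le_iff)

lemma msub_add_absorb: "A \<le> B \<Longrightarrow> A + B = B" for A :: "'a::comm_ring_1 msub"
  by (rule msub_eqI) (auto simp add: plus_le_iff)

lemma sum_le_msub_iff:
  "finite X \<Longrightarrow> sum f X \<le> C \<longleftrightarrow> (\<forall>x\<in>X. f x \<le> C)" for C :: "'a::comm_ring_1 msub"
  by (induction X rule: finite_induct) (auto simp: plus_le_iff)

lemma le_sum_msub: "finite X \<Longrightarrow> x \<in> X \<Longrightarrow> f x \<le> sum f X" for f :: "_ \<Rightarrow> 'a::comm_ring_1 msub"
  using sum_le_msub_iff[of X f "sum f X"] by simp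

lemma msub_mult_mono: "A \<le> B \<Longrightarrow> C \<le> D \<Longrightarrow> A * C \<le> B * D" for A :: "'a::comm_ring_1 msub"
  by (rule mult_mono) auto

lemma msub_power_mono: "A \<le> B \<Longrightarrow> A ^ n \<le> B ^ n" for A :: "'a::comm_ring_1 msub"
  by (induction n) (auto intro: msub_mult_mono)

lemma set_of_sum_msub: "set_of (sum f X) = sum (\<lambda>x. set_of (f x)) X"
  by (induction X rule: infinite_finite_induct) (auto simp: set_of_0 set_of_plus set_zero)

lemma msub_modular:
  fixes A B C :: "'a::comm_ring_1 msub"
  assumes "A \<le> C"
  shows "inf (A + B) C \<le> A + inf B C"
proof -
  have "f \<in> set_of (A + inf B C)" if f: "f \<in> set_of (A + B)" "f \<in> set_of C" for f
  proof -
    obtain a b where ab: "f = a + b" "a \<in> set_of A" "b \<in> set_of B"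
      using f by (auto simp: set_of_plus set_plus_def)
    then have "b \<in> set_of C"
      using assms f(2) set_of_diff[of f C a] by (auto simp: less_eq_msub_def)
    then show ?thesis using ab by (auto simp: set_of_inf intro: plus_in_set_of)
  qed
  then show ?thesis by (auto simp: less_eq_msub_def set_of_inf)
qed

section \<open>Cyclic submodules\<close>

definition cyc :: "'a::comm_ring_1 mpoly \<Rightarrow> 'a msub" where
  "cyc f = Abs_msub (submodule_span {f})"

lemma set_of_cyc: "set_of (cyc f) = range (\<lambda>c. const_poly c * f)"
  by (simp only: cyc_def set_of_Abs[OF poly_mod.subspace_span]) (rule poly_mod.span_singleton)

lemma cyc_le_iff: "cyc f \<le> A \<longleftrightarrow> f \<in> set_of A"
proof
  have "const_poly 1 * f \<in> set_of (cyc f)" unfolding set_of_cyc by blast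
  then show "cyc f \<le> A \<Longrightarrow> f \<in> set_of A" by (auto simp: less_eq_msub_def)
qed (auto simp: less_eq_msub_def set_of_cyc set_of_scale)

lemma in_cyc [simp]: "f \<in> set_of (cyc f)"
  by (simp flip: cyc_le_iff)

lemma cyc_times_le_iff: "cyc f * A \<le> B \<longleftrightarrow> (\<forall>g\<in>set_of A. f * g \<in> set_of B)"
proof
  assume *: "\<forall>g\<in>set_of A. f * g \<in> set_of B"
  show "cyc f * A \<le> B"
    unfolding times_le_iff set_of_cyc
  proof clarify
    fix c g assume "g \<in> set_of A"
    then show "const_poly c * f * g \<in> set_of B"
      unfolding mult.assoc using * by (intro set_of_scale) blast
  qed
next
  assume "cyc f * A \<le> B"
  then show "\<forall>g\<in>set_of A. f * g \<in> set_of B"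
    unfolding times_le_iff using in_cyc by blast
qed

lemma cyc_mult: "cyc f * cyc g = cyc (f * g)"
proof (rule order_antisym)
  show "cyc f * cyc g \<le> cyc (f * g)"
    unfolding cyc_times_le_iff set_of_cyc[of g]
  proof clarify
    fix c
    have "const_poly c * (f * g) \<in> set_of (cyc (f * g))" by (intro set_of_scale in_cyc)
    then show "f * (const_poly c * g) \<in> set_of (cyc (f * g))"
      by (simp only: mult.left_commute)
  qed
  show "cyc (f * g) \<le> cyc f * cyc g"
    unfolding cyc_le_iff by (intro times_in_set_of in_cyc)
qed

lemma cyc_1 [simp]: "cyc 1 = 1"
  by (simp add: set_of_inject[symmetric] set_of_cyc set_of_1)

lemma cyc_power: "cyc f ^ n = cyc (f ^ n)"
  by (induction n) (simp_all add: cyc_mult)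

text \<open>In an idempotent semiring the binomial coefficients disappear.\<close>

lemma of_nat_msub: "n > 0 \<Longrightarrow> (of_nat n :: 'a::comm_ring_1 msub) = 1"
  by (induction n rule: nat_induct_non_zero) auto

lemma msub_binomial: "(A + B) ^ n = (\<Sum>k\<le>n. A ^ k * B ^ (n - k))" for A :: "'a::comm_ring_1 msub"
  by (auto simp: binomial_ring of_nat_msub intro!: sum.cong)

section \<open>Lengths\<close>

definition qlen :: "'a::comm_ring_1 msub \<Rightarrow> 'a msub \<Rightarrow> enat" where
  "qlen N L = Sup {enat n | n. \<exists>K. (\<forall>i\<le>n. L \<le> K i \<and> K i \<le> N) \<and> (\<forall>i<n. K i < K (Suc i))}"

lemma quot_length_set_of: "quot_length (set_of N) (set_of L) = qlen N L"
proof -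
  have "(\<exists>K :: nat \<Rightarrow> 'a mpoly set. (\<forall>i\<le>n. is_submodule (K i) \<and> set_of L \<subseteq> K i \<and> K i \<subseteq> set_of N) \<and> (\<forall>i<n. K i \<subset> K (Suc i)))
    \<longleftrightarrow> (\<exists>K. (\<forall>i\<le>n. L \<le> K i \<and> K i \<le> N) \<and> (\<forall>i<n. K i < K (Suc i)))" (is "?A \<longleftrightarrow> ?B") for n
  proof
    assume ?A
    then obtain K where "(\<forall>i\<le>n. is_submodule (K i) \<and> set_of L \<subseteq> K i \<and> K i \<subseteq> set_of N) \<and> (\<forall>i<n. K i \<subset> K (Suc i))" ..
    then show ?B
      by (intro exI[of _ "\<lambda>i. Abs_msub (K i)"]) (simp add: less_eq_msub_def less_msub_def)
  next
    assume ?B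
    then obtain K where "(\<forall>i\<le>n. L \<le> K i \<and> K i \<le> N) \<and> (\<forall>i<n. K i < K (Suc i))" ..
    then show ?A
      by (intro exI[of _ "\<lambda>i. set_of (K i)"]) (simp add: less_eq_msub_def less_msub_def)
  qed
  then show ?thesis
    unfolding quot_length_def qlen_def by simp
qed

lemma qlen_ge:
  "(\<And>i. i \<le> n \<Longrightarrow> L \<le> K i \<and> K i \<le> N) \<Longrightarrow> (\<And>i. i < n \<Longrightarrow> K i < K (Suc i)) \<Longrightarrow> enat n \<le> qlen N L"
  unfolding qlen_def by (rule Sup_upper) blast

lemma qlen_le:
  assumes "\<And>n K. (\<And>i. i \<le> n \<Longrightarrow> L \<le> K i \<and> K i \<le> N) \<Longrightarrow> (\<And>i. i < n \<Longrightarrow> K i < K (Suc i)) \<Longrightarrow> enat n \<le> c"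
  shows "qlen N L \<le> c"
  unfolding qlen_def by (rule Sup_least) (use assms in blast)

text \<open>\<open>Sup\<close> on \<open>enat\<close> is infinite on infinite sets, so a finite
  value is a maximum over a finite set. The hypothesis \<open>L \<le> N\<close> makes this set
  nonempty.\<close>

lemma qlen_attained:
  assumes "qlen N L = enat n" "L \<le> N"
  obtains K where "\<And>i. i \<le> n \<Longrightarrow> L \<le> K i \<and> K i \<le> N" "\<And>i. i < n \<Longrightarrow> K i < K (Suc i)"
proof -
  define A where "A = {enat n | n. \<exists>K. (\<forall>i\<le>n. L \<le> K i \<and> K i \<le> N) \<and> (\<forall>i<n. K i < K (Suc i))}"
  have "enat 0 \<in> A"
    using assms(2) by (auto simp: A_def intro!: exI[of _ "\<lambda>_. L"])
  then have ne: "A \<noteq> {}" by blast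
  have S: "Sup A = enat n" using assms(1) by (simp add: qlen_def A_def)
  then have "finite A" using ne by (auto simp: Sup_enat_def split: if_splits)
  then have "enat n \<in> A" using S ne Max_in[of A] by (auto simp: Sup_enat_def)
  then show ?thesis unfolding A_def using that by blast
qed

text \<open>Omitting repetitions leaves a strict chain. The induction keeps the last member of the
  thinned chain equal to \<open>K n\<close>, so that a further strict step can be appended.\<close>

lemma weak_chain_le_qlen:
  assumes "\<And>i. i \<le> n \<Longrightarrow> L \<le> K i \<and> K i \<le> N" "\<And>i. i < n \<Longrightarrow> K i \<le> K (Suc i)"
  shows "enat (card {i. i < n \<and> K i < K (Suc i)}) \<le> qlen N L"
proof -
  have "\<exists>C. (\<forall>i\<le>card {i. i < n \<and> K i < K (Suc i)}. L \<le> C i \<and> C i \<le> N) \<and>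
      (\<forall>i<card {i. i < n \<and> K i < K (Suc i)}. C i < C (Suc i)) \<and> C (card {i. i < n \<and> K i < K (Suc i)}) = K n"
    using assms
  proof (induction n)
    case 0
    then show ?case by (intro exI[of _ "\<lambda>_. K 0"]) auto
  next
    case (Suc n)
    define c where "c = card {i. i < n \<and> K i < K (Suc i)}"
    obtain C where C: "\<forall>i\<le>c. L \<le> C i \<and> C i \<le> N" "\<forall>i<c. C i < C (Suc i)" "C c = K n"
    proof -
      have "\<exists>C. (\<forall>i\<le>c. L \<le> C i \<and> C i \<le> N) \<and> (\<forall>i<c. C i < C (Suc i)) \<and> C c = K n"
        unfolding c_def using Suc.prems by (intro Suc.IH) auto
      then show thesis using that by blast
    qed
    show ?case
    proof (cases "K n < K (Suc n)")
      case True
      then have "{i. i < Suc n \<and> K i < K (Suc i)} = insert n {i. i < n \<and> K i < K (Suc i)}"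
        by (auto simp: less_Suc_eq)
      then have "card {i. i < Suc n \<and> K i < K (Suc i)} = Suc c"
        by (simp add: c_def)
      then show ?thesis
        using C True Suc.prems(1)[of "Suc n"]
        by (intro exI[of _ "\<lambda>i. if i \<le> c then C i else K (Suc n)"]) (auto simp: less_Suc_eq le_Suc_eq)
    next
      case False
      then have "{i. i < Suc n \<and> K i < K (Suc i)} = {i. i < n \<and> K i < K (Suc i)}"
        by (auto simp: less_Suc_eq)
      moreover have "K n = K (Suc n)" using Suc.prems(2)[of n] False by simp
      ultimately show ?thesis using C unfolding c_def by auto
    qed
  qed
  then show ?thesis by (elim exE) (rule qlen_ge, blast+)
qed

lemma qlen_mono:
  assumes "N \<le> N'" "L \<le> L'"
  shows "qlen N L' \<le> qlen N' L"
proof (rule qlen_le)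
  fix n K
  assume K: "\<And>i. i \<le> n \<Longrightarrow> L' \<le> K i \<and> K i \<le> N" "\<And>i. i < n \<Longrightarrow> K i < K (Suc i)"
  show "enat n \<le> qlen N' L"
  proof (rule qlen_ge[where K = K])
    fix i assume "i \<le> n"
    then show "L \<le> K i \<and> K i \<le> N'"
      using order_trans[OF assms(2), of "K i"] order_trans[OF _ assms(1), of "K i"] K(1)[of i] by simp
  qed (rule K(2))
qed

lemma qlen_same [simp]: "qlen N N = 0"
proof -
  have "qlen N N \<le> 0"
  proof (rule qlen_le)
    fix n K assume *: "\<And>i. i \<le> n \<Longrightarrow> N \<le> K i \<and> K i \<le> N" "\<And>i. i < n \<Longrightarrow> K i < K (Suc i)"
    have "n = 0"
    proof (rule ccontr)
      assume "n \<noteq> 0"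
      then have "K 0 < K 1" "K 1 \<le> N" "N \<le> K 0" using *(1)[of 0] *(1)[of 1] *(2)[of 0] by auto
      then have "K 0 < K 0" by order
      then show False by simp
    qed
    then show "enat n \<le> 0" by (simp add: zero_enat_def)
  qed
  then show ?thesis by simp
qed

text \<open>A chain from \<open>L\<close> to \<open>K\<close> is continued by one from
  \<open>K\<close> to \<open>N\<close>. At the joint the member \<open>B b\<close> gives way to
  \<open>A 0\<close>, which lies above it because \<open>B b \<le> K \<le> A 0\<close>.\<close>

lemma qlen_add_ge:
  assumes "L \<le> K" "K \<le> N"
  shows "qlen N K + qlen K L \<le> qlen N L"
proof (cases "qlen N L")
  case (enat c)
  have "qlen N K \<le> qlen N L" "qlen K L \<le> qlen N L"
    using assms by (auto intro!: qlen_mono)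
  then obtain a b where ab: "qlen N K = enat a" "qlen K L = enat b"
    using enat enat_ile by metis
  obtain A where A: "\<And>i. i \<le> a \<Longrightarrow> K \<le> A i \<and> A i \<le> N" "\<And>i. i < a \<Longrightarrow> A i < A (Suc i)"
    using qlen_attained[OF ab(1) assms(2)] by blast
  obtain B where B: "\<And>i. i \<le> b \<Longrightarrow> L \<le> B i \<and> B i \<le> K" "\<And>i. i < b \<Longrightarrow> B i < B (Suc i)"
    using qlen_attained[OF ab(2) assms(1)] by blast
  have "enat (a + b) \<le> qlen N L"
  proof (rule qlen_ge)
    fix i assume i: "i \<le> a + b"
    show "L \<le> (if i < b then B i else A (i - b)) \<and> (if i < b then B i else A (i - b)) \<le> N"
      using i A(1)[of "i - b"] B(1)[of i] assms by (auto intro: order_trans)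
  next
    fix i assume i: "i < a + b"
    consider "Suc i < b" | "Suc i = b" | "b \<le> i" by linarith
    then show "(if i < b then B i else A (i - b)) < (if Suc i < b then B (Suc i) else A (Suc i - b))"
    proof cases
      case 2
      then show ?thesis using B(2)[of i] B(1)[of b] A(1)[of 0] by (auto simp: intro: order.strict_trans2)
    next
      case 3
      then show ?thesis using A(2)[of "i - b"] i by (auto simp: Suc_diff_le)
    qed (use B(2) in auto)
  qed
  then show ?thesis by (simp add: ab)
qed simp

text \<open>Consequence of the modular law: for comparable submodules nothing is lost by passing to
  the pair of their sum and their intersection with \<open>K\<close>.\<close>

lemma msub_modular_eq:
  fixes A B K :: "'a::comm_ring_1 msub"
  assumes "A \<le> B" "inf A K = inf B K" "A + K = B + K"
  shows "A = B"
proof (rule order_antisym)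
  have "B \<le> inf (A + K) B"
    using plus_le_iff[of B K "B + K"] assms(3) by simp
  also have "\<dots> \<le> A + inf K B" by (rule msub_modular) fact
  also have "\<dots> \<le> A"
    using assms(2) by (simp add: plus_le_iff inf.commute) (metis inf.cobounded1 inf.commute)
  finally show "B \<le> A" .
qed fact

text \<open>Adding \<open>K\<close> and intersecting with \<open>K\<close> turn a chain into a weak
  chain above \<open>K\<close> and one below. By \<open>msub_modular_eq\<close> each strict step
  stays strict in at least one of them, which gives additivity without composition series.\<close>

lemma qlen_add_le:
  assumes "L \<le> K" "K \<le> N"
  shows "qlen N L \<le> qlen N K + qlen K L"
proof (rule qlen_le)
  fix n C
  assume C: "\<And>i. i \<le> n \<Longrightarrow> L \<le> C i \<and> C i \<le> N" "\<And>i. i < n \<Longrightarrow> C i < C (Suc i)"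
  define X where "X = {i. i < n \<and> C i + K < C (Suc i) + K}"
  define Y where "Y = {i. i < n \<and> inf (C i) K < inf (C (Suc i)) K}"
  have "enat (card X) \<le> qlen N K"
    unfolding X_def
  proof (rule weak_chain_le_qlen)
    fix i assume "i \<le> n"
    then show "K \<le> C i + K \<and> C i + K \<le> N"
      using C(1)[of i] assms plus_le_iff[of "C i" K "C i + K"] by (auto simp: plus_le_iff)
  next
    fix i assume "i < n"
    then show "C i + K \<le> C (Suc i) + K" using C(2)[of i] by (intro add_right_mono) simp
  qed
  moreover have "enat (card Y) \<le> qlen K L"
    unfolding Y_def
  proof (rule weak_chain_le_qlen)
    fix i assume "i \<le> n"
    then show "L \<le> inf (C i) K \<and> inf (C i) K \<le> K"
      using C(1)[of i] assms by auto
  next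
    fix i assume "i < n"
    then show "inf (C i) K \<le> inf (C (Suc i)) K" using C(2)[of i] by (auto intro: le_infI1)
  qed
  moreover have "n \<le> card X + card Y"
  proof -
    have "i \<in> X \<union> Y" if "i < n" for i
    proof (rule ccontr)
      assume *: "i \<notin> X \<union> Y"
      have le: "C i \<le> C (Suc i)" using C(2)[OF that] by simp
      have "C i + K = C (Suc i) + K"
        using * that add_right_mono[OF le, of K] by (auto simp: X_def order.strict_iff_order)
      moreover have "inf (C i) K = inf (C (Suc i)) K"
        using * that inf_mono[OF le order_refl, of K] by (auto simp: Y_def order.strict_iff_order)
      ultimately have "C i = C (Suc i)" using msub_modular_eq le by blast
      then show False using C(2)[OF that] by simp
    qed
    then have "{..<n} \<subseteq> X \<union> Y" by blast
    moreover have "finite (X \<union> Y)" by (simp add: X_def Y_def)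
    ultimately have "card {..<n} \<le> card (X \<union> Y)" by (intro card_mono)
    then show ?thesis using card_Un_le[of X Y] by simp
  qed
  ultimately have "enat (card X) + enat (card Y) \<le> qlen N K + qlen K L" "enat n \<le> enat (card X) + enat (card Y)"
    by (auto simp del: plus_enat_simps intro: add_mono) simp
  then show "enat n \<le> qlen N K + qlen K L" by (rule order_trans[rotated])
qed

lemma qlen_add: "L \<le> K \<Longrightarrow> K \<le> N \<Longrightarrow> qlen N L = qlen N K + qlen K L"
  by (intro order_antisym qlen_add_le qlen_add_ge)

lemma qlen_filtration:
  assumes "\<And>i. i < n \<Longrightarrow> K i \<le> K (Suc i)"
  shows "qlen (K n) (K 0) = (\<Sum>i<n. qlen (K (Suc i)) (K i))"
  using assms
proof (induction n)
  case (Suc n)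
  have "K 0 \<le> K n"
    using Suc.prems by (induction n) (auto intro: order_trans)
  then have "qlen (K (Suc n)) (K 0) = qlen (K (Suc n)) (K n) + qlen (K n) (K 0)"
    using Suc.prems by (intro qlen_add) auto
  then show ?case using Suc by (simp add: add.commute)
qed simp

text \<open>Chains between \<open>L'\<close> and \<open>N'\<close> are pulled back along the linear
  map; surjectivity modulo \<open>L'\<close> keeps their steps strict.\<close>

lemma qlen_image_le:
  fixes \<phi> :: "'a::comm_ring_1 mpoly \<Rightarrow> 'a mpoly"
  assumes add: "\<And>f g. \<phi> (f + g) = \<phi> f + \<phi> g"
    and scale: "\<And>c f. \<phi> (const_poly c * f) = const_poly c * \<phi> f"
    and surj: "\<And>g. g \<in> set_of N' \<Longrightarrow> \<exists>f\<in>set_of N. \<exists>l\<in>set_of L'. g = \<phi> f + l"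
    and L: "\<And>f. f \<in> set_of L \<Longrightarrow> \<phi> f \<in> set_of L'"
    and "L \<le> N"
  shows "qlen N' L' \<le> qlen N L"
proof (rule qlen_le)
  fix n K
  assume K: "\<And>i. i \<le> n \<Longrightarrow> L' \<le> K i \<and> K i \<le> N'" "\<And>i. i < n \<Longrightarrow> K i < K (Suc i)"
  have zero: "\<phi> 0 = 0" using scale[of 0 0] by simp
  have sub: "is_submodule {f \<in> set_of N. \<phi> f \<in> set_of A}" for A
    by (rule is_submoduleI) (simp_all add: zero add scale set_of_add set_of_scale)
  define C where "C = (\<lambda>A. Abs_msub {f \<in> set_of N. \<phi> f \<in> set_of A})"
  have C: "set_of (C A) = {f \<in> set_of N. \<phi> f \<in> set_of A}" for A
    unfolding C_def by (rule set_of_Abs) (rule sub)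
  show "enat n \<le> qlen N L"
  proof (rule qlen_ge)
    fix i assume "i \<le> n"
    then have "L' \<le> K i" using K(1) by blast
    then show "L \<le> C (K i) \<and> C (K i) \<le> N"
      using L \<open>L \<le> N\<close> by (auto simp: less_eq_msub_def C)
  next
    fix i assume i: "i < n"
    have sub: "set_of (K i) \<subset> set_of (K (Suc i))" using K(2)[OF i] by (simp add: less_msub_def)
    then obtain g where g: "g \<in> set_of (K (Suc i))" "g \<notin> set_of (K i)" by blast
    have "g \<in> set_of N'" using g(1) K(1)[of "Suc i"] i by (auto simp: less_eq_msub_def)
    then obtain f l where fl: "f \<in> set_of N" "l \<in> set_of L'" "g = \<phi> f + l" using surj by blast
    have l: "l \<in> set_of (K i)" using fl(2) K(1)[of i] i by (auto simp: less_eq_msub_def)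
    have "\<phi> f \<in> set_of (K (Suc i))"
      using set_of_diff[OF g(1), of l] l sub fl(3) by auto
    moreover have "\<phi> f \<notin> set_of (K i)"
      using g(2) l fl(3) by (auto simp: set_of_add)
    ultimately show "C (K i) < C (K (Suc i))"
      using fl(1) sub by (auto simp: less_msub_def C)
  qed
qed

lemma set_of_cyc_times: "set_of (cyc x * N) = (*) x ` set_of N"
proof -
  have sub: "is_submodule ((*) x ` set_of N)"
  proof (rule is_submoduleI)
    show "0 \<in> (*) x ` set_of N" by (rule image_eqI[of _ _ 0]) simp_all
  next
    fix f g assume "f \<in> (*) x ` set_of N" "g \<in> (*) x ` set_of N"
    then obtain a b where "f = x * a" "g = x * b" "a \<in> set_of N" "b \<in> set_of N" by blast
    then show "f + g \<in> (*) x ` set_of N"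
      by (intro image_eqI[of _ _ "a + b"]) (simp_all only: distrib_left set_of_add)
  next
    fix c f assume "f \<in> (*) x ` set_of N"
    then obtain a where "f = x * a" "a \<in> set_of N" by blast
    then show "const_poly c * f \<in> (*) x ` set_of N"
      by (intro image_eqI[of _ _ "const_poly c * a"]) (simp_all only: mult.left_commute set_of_scale)
  qed
  have "cyc x * N \<le> Abs_msub ((*) x ` set_of N)"
    unfolding cyc_times_le_iff set_of_Abs[OF sub] by blast
  moreover have "Abs_msub ((*) x ` set_of N) \<le> cyc x * N"
    unfolding less_eq_msub_def set_of_Abs[OF sub] by (auto intro: times_in_set_of)
  ultimately show ?thesis
    by (metis order_antisym set_of_Abs[OF sub])
qed

text \<open>Multiplication by \<open>x\<close> induces a surjection from N/L onto (L' + xN)/L'. This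
  is the source of both the antitone Hilbert functions and the growth bounds.\<close>

lemma qlen_cyc_times_le:
  assumes "cyc x * L \<le> L'" "L \<le> N"
  shows "qlen (L' + cyc x * N) L' \<le> qlen N L"
proof (rule qlen_image_le[where \<phi> = "(*) x"])
  fix g assume "g \<in> set_of (L' + cyc x * N)"
  then show "\<exists>f\<in>set_of N. \<exists>l\<in>set_of L'. g = x * f + l"
    by (auto simp: set_of_plus set_plus_def set_of_cyc_times add.commute)
next
  fix f assume "f \<in> set_of L"
  then show "x * f \<in> set_of L'" using assms(1) by (auto simp: cyc_times_le_iff)
qed (simp_all add: assms distrib_left mult.left_commute)

lemma qlen_plus_le: "B \<le> A \<Longrightarrow> qlen (X + A) (X + B) \<le> qlen A B"
  using qlen_cyc_times_le[of 1 B "X + B" A] plus_le_iff[of X B "X + B"]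
  by (simp add: add.assoc msub_add_absorb)

text \<open>By the isomorphism theorems (X + A)/(X + B) is A/(B + (X \<inter> A)), and the
  hypothesis on \<open>inf X A\<close> reduces the denominator to \<open>B\<close>.\<close>

lemma qlen_plus_eq:
  assumes "B \<le> A" "inf X A \<le> B"
  shows "qlen (X + A) (X + B) = qlen A B"
proof (rule order_antisym[OF qlen_plus_le[OF assms(1)]])
  show "qlen A B \<le> qlen (X + A) (X + B)"
  proof (rule qlen_le)
    fix n K
    assume K: "\<And>i. i \<le> n \<Longrightarrow> B \<le> K i \<and> K i \<le> A" "\<And>i. i < n \<Longrightarrow> K i < K (Suc i)"
    show "enat n \<le> qlen (X + A) (X + B)"
    proof (rule qlen_ge)
      fix i assume "i \<le> n"
      then show "X + B \<le> X + K i \<and> X + K i \<le> X + A"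
        using K(1)[of i] by (auto intro: add_left_mono)
    next
      fix i assume i: "i < n"
      have le: "K i \<le> K (Suc i)" using K(2)[OF i] by simp
      have "X + K i \<noteq> X + K (Suc i)"
      proof
        assume eq: "X + K i = X + K (Suc i)"
        have "inf X (K (Suc i)) \<le> inf X A"
          using K(1)[of "Suc i"] i by (intro inf_mono) auto
        also have "\<dots> \<le> K i" using assms(2) K(1)[of i] i by auto
        finally have "inf (K (Suc i)) X = inf (K i) X"
          using le by (intro order_antisym) (auto simp: inf.commute intro: le_infI2)
        then have "K i = K (Suc i)"
          using msub_modular_eq[OF le, of X] eq by (simp add: add.commute)
        then show False using K(2)[OF i] by simp
      qed
      then show "X + K i < X + K (Suc i)"
        using add_left_mono[OF le, of X] by (simp add: order.strict_iff_order)
    qed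
  qed
qed

text \<open>Adjoining the generators in increasing order filters the quotient with cyclic factors.
  The order will be the lexicographic one on exponent vectors.\<close>

lemma qlen_cyc_filtration:
  fixes g :: "'b::linorder \<Rightarrow> 'a::comm_ring_1 mpoly"
  assumes "finite A"
  shows "qlen (U + (\<Sum>a\<in>A. cyc (g a))) U =
    (\<Sum>a\<in>A. qlen (U + (\<Sum>b\<in>{b\<in>A. b < a}. cyc (g b)) + cyc (g a)) (U + (\<Sum>b\<in>{b\<in>A. b < a}. cyc (g b))))"
  using assms
proof (induction A rule: finite_linorder_max_induct)
  case (insert a A)
  let ?V = "U + (\<Sum>a\<in>A. cyc (g a))"
  have a: "a \<notin> A" using insert by auto
  have "qlen (U + (\<Sum>a\<in>insert a A. cyc (g a))) U = qlen (?V + cyc (g a)) U"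
    using insert a by (simp add: ac_simps)
  also have "\<dots> = qlen (?V + cyc (g a)) ?V + qlen ?V U"
    by (rule qlen_add) (auto simp: le_iff_add)
  finally have "qlen (U + (\<Sum>a\<in>insert a A. cyc (g a))) U = qlen (?V + cyc (g a)) ?V + qlen ?V U" .
  moreover have "{b\<in>insert a A. b < c} = {b\<in>A. b < c}" if "c \<in> A" for c
    using insert that by auto
  moreover have "{b\<in>insert a A. b < a} = A"
    using insert by auto
  ultimately show ?case
    using insert a by (simp cong: sum.cong)
qed simp

text \<open>Each new generator contributes a cyclic factor that is killed by \<open>Q\<close>, hence
  a quotient of R/Q.\<close>

lemma qlen_span_le:
  assumes "finite X" "Q \<le> 1" "\<And>a. a \<in> X \<Longrightarrow> cyc (g a) * Q \<le> W"
  shows "qlen (W + (\<Sum>a\<in>X. cyc (g a))) W \<le> of_nat (card X) * qlen 1 Q"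
  using assms(1,3)
proof (induction X rule: finite_induct)
  case (insert a X)
  let ?V = "W + (\<Sum>a\<in>X. cyc (g a))"
  have "W \<le> ?V" by (auto simp: le_iff_add)
  have "qlen (?V + cyc (g a)) W = qlen (?V + cyc (g a)) ?V + qlen ?V W"
    by (rule qlen_add) (auto simp: le_iff_add)
  also have "\<dots> \<le> qlen 1 Q + of_nat (card X) * qlen 1 Q"
  proof (rule add_mono)
    have "cyc (g a) * Q \<le> ?V" using insert.prems[of a] \<open>W \<le> ?V\<close> by auto
    from qlen_cyc_times_le[OF this assms(2)]
    show "qlen (?V + cyc (g a)) ?V \<le> qlen 1 Q" by simp
  qed (use insert in auto)
  finally show ?case
    using insert by (simp add: add.assoc add.commute[of "sum _ _"] distrib_right)
qed simp

section \<open>Eventually polynomial functions\<close>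

definition evpoly :: "(nat \<Rightarrow> rat) \<Rightarrow> bool" where
  "evpoly f \<longleftrightarrow> (\<exists>P N. \<forall>n\<ge>N. f n = poly P (of_nat n))"

lemma evpolyI: "(\<And>n. n \<ge> N \<Longrightarrow> f n = poly P (of_nat n)) \<Longrightarrow> evpoly f"
  unfolding evpoly_def by blast

lemma evpoly_poly [simp]: "evpoly (\<lambda>n. poly P (of_nat n))"
  by (rule evpolyI) (rule refl)

lemma evpoly_const [simp]: "evpoly (\<lambda>_. c)"
  using evpoly_poly[of "[:c:]"] by simp

lemma evpoly_of_nat [simp]: "evpoly of_nat"
  using evpoly_poly[of "[:0, 1:]"] by simp

lemma evpoly_cong:
  assumes "evpoly f" "\<And>n. n \<ge> N \<Longrightarrow> f n = g n"
  shows "evpoly g"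
proof -
  obtain P M where "\<And>n. n \<ge> M \<Longrightarrow> f n = poly P (of_nat n)"
    using assms(1) unfolding evpoly_def by blast
  then show ?thesis using assms(2) by (intro evpolyI[of "max M N" _ P]) (metis max.bounded_iff)
qed

lemma evpoly_add [simp]:
  assumes "evpoly f" "evpoly g"
  shows "evpoly (\<lambda>n. f n + g n)"
proof -
  obtain P M Q N where "\<And>n. n \<ge> M \<Longrightarrow> f n = poly P (of_nat n)" "\<And>n. n \<ge> N \<Longrightarrow> g n = poly Q (of_nat n)"
    using assms unfolding evpoly_def by blast
  then show ?thesis by (intro evpolyI[of "max M N" _ "P + Q"]) simp
qed

lemma evpoly_mult [simp]:
  assumes "evpoly f" "evpoly g"
  shows "evpoly (\<lambda>n. f n * g n)"
proof -
  obtain P M Q N where "\<And>n. n \<ge> M \<Longrightarrow> f n = poly P (of_nat n)" "\<And>n. n \<ge> N \<Longrightarrow> g n = poly Q (of_nat n)"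
    using assms unfolding evpoly_def by blast
  then show ?thesis by (intro evpolyI[of "max M N" _ "P * Q"]) simp
qed

lemma evpoly_sum [simp]: "(\<And>x. x \<in> A \<Longrightarrow> evpoly (f x)) \<Longrightarrow> evpoly (\<lambda>n. \<Sum>x\<in>A. f x n)"
  by (induction A rule: infinite_finite_induct) simp_all

lemma evpoly_minus_index [simp]:
  assumes "evpoly f"
  shows "evpoly (\<lambda>n. f (n - k))"
proof -
  obtain P M where *: "\<And>n. n \<ge> M \<Longrightarrow> f n = poly P (of_nat n)"
    using assms unfolding evpoly_def by blast
  show ?thesis
    by (rule evpolyI[of "M + k" _ "pcompose P [:- of_nat k, 1:]"]) (simp add: * poly_pcompose of_nat_diff)
qed

text \<open>Telescoping (k + 1)^(m+1) - k^(m+1) and expanding by the binomial theorem expresses the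
  sum of m-th powers through those of smaller exponents.\<close>

lemma sum_power_poly: "\<exists>Q. \<forall>n. (\<Sum>k<n. (of_nat k :: rat) ^ m) = poly Q (of_nat n)"
proof (induction m rule: less_induct)
  case (less m)
  then obtain Q where Q: "\<And>j n. j < m \<Longrightarrow> (\<Sum>k<n. (of_nat k :: rat) ^ j) = poly (Q j) (of_nat n)"
    by metis
  define R where "R = smult (1 / of_nat (m + 1))
    (monom 1 (m + 1) - (\<Sum>j<m. smult (of_nat ((m + 1) choose j)) (Q j)))"
  have "(\<Sum>k<n. (of_nat k :: rat) ^ m) = poly R (of_nat n)" for n
  proof -
    have "(of_nat n :: rat) ^ (m + 1) = (\<Sum>k<n. of_nat (Suc k) ^ (m + 1) - of_nat k ^ (m + 1))"
      by (subst sum_lessThan_telescope) simp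
    also have "\<dots> = (\<Sum>k<n. \<Sum>j\<le>m. of_nat ((m + 1) choose j) * of_nat k ^ j)"
    proof (rule sum.cong)
      fix k
      have "(of_nat (Suc k) :: rat) ^ (m + 1) = (of_nat k + 1) ^ (m + 1)" by (simp add: add.commute)
      also have "\<dots> = (\<Sum>j\<le>m + 1. of_nat ((m + 1) choose j) * of_nat k ^ j)"
        by (subst binomial_ring) simp
      finally show "(of_nat (Suc k) :: rat) ^ (m + 1) - of_nat k ^ (m + 1) =
        (\<Sum>j\<le>m. of_nat ((m + 1) choose j) * of_nat k ^ j)" by simp
    qed simp
    also have "\<dots> = (\<Sum>j\<le>m. of_nat ((m + 1) choose j) * (\<Sum>k<n. of_nat k ^ j))"
      by (subst sum.swap) (simp add: sum_distrib_left)
    also have "{..m} = insert m {..<m}" by auto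
    also have "(\<Sum>j\<in>insert m {..<m}. of_nat ((m + 1) choose j) * (\<Sum>k<n. (of_nat k :: rat) ^ j)) =
      of_nat (m + 1) * (\<Sum>k<n. of_nat k ^ m) + (\<Sum>j<m. of_nat ((m + 1) choose j) * poly (Q j) (of_nat n))"
      by (simp add: Q)
    finally show ?thesis
      by (simp add: R_def poly_monom poly_sum field_simps del: of_nat_Suc of_nat_add)
  qed
  then show ?case by blast
qed

section \<open>Polynomial functions of two variables\<close>

definition bipoly :: "(nat \<Rightarrow> nat \<Rightarrow> rat) \<Rightarrow> bool" where
  "bipoly f \<longleftrightarrow> (\<exists>P. \<forall>p q. f p q = poly (poly P [:of_nat p:]) (of_nat q))"

lemma bipolyI: "(\<And>p q. f p q = poly (poly P [:of_nat p:]) (of_nat q)) \<Longrightarrow> bipoly f"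
  unfolding bipoly_def by blast

lemma bipoly_const [simp]: "bipoly (\<lambda>_ _. c)"
  by (rule bipolyI[of _ "[:[:c:]:]"]) simp

lemma bipoly_fst [simp]: "bipoly (\<lambda>p q. of_nat p)"
  by (rule bipolyI[of _ "[:0, 1:]"]) simp

lemma bipoly_snd [simp]: "bipoly (\<lambda>p q. of_nat q)"
  by (rule bipolyI[of _ "[:[:0, 1:]:]"]) simp

lemma bipoly_add [simp]:
  assumes "bipoly f" "bipoly g"
  shows "bipoly (\<lambda>p q. f p q + g p q)"
proof -
  obtain P Q where "\<And>p q. f p q = poly (poly P [:of_nat p:]) (of_nat q)"
    "\<And>p q. g p q = poly (poly Q [:of_nat p:]) (of_nat q)"
    using assms unfolding bipoly_def by blast
  then show ?thesis by (intro bipolyI[of _ "P + Q"]) simp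
qed

lemma bipoly_mult [simp]:
  assumes "bipoly f" "bipoly g"
  shows "bipoly (\<lambda>p q. f p q * g p q)"
proof -
  obtain P Q where "\<And>p q. f p q = poly (poly P [:of_nat p:]) (of_nat q)"
    "\<And>p q. g p q = poly (poly Q [:of_nat p:]) (of_nat q)"
    using assms unfolding bipoly_def by blast
  then show ?thesis by (intro bipolyI[of _ "P * Q"]) simp
qed

lemma bipoly_diff [simp]: "bipoly f \<Longrightarrow> bipoly g \<Longrightarrow> bipoly (\<lambda>p q. f p q - g p q)"
  using bipoly_add[of f "\<lambda>p q. (- 1) * g p q"] bipoly_mult[OF bipoly_const[of "- 1"], of g] by simp

lemma bipoly_sum [simp]: "(\<And>x. x \<in> A \<Longrightarrow> bipoly (f x)) \<Longrightarrow> bipoly (\<lambda>p q. \<Sum>x\<in>A. f x p q)"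
  by (induction A rule: infinite_finite_induct) simp_all

lemma bipoly_poly [simp]: "bipoly f \<Longrightarrow> bipoly (\<lambda>p q. poly P (f p q))"
  by (induction P) simp_all

lemma bipoly_compose: "bipoly f \<Longrightarrow> bipoly g \<Longrightarrow> bipoly (\<lambda>p q. poly (poly P [:f p q:]) (g p q))"
  by (induction P) simp_all

lemma evpoly_compose: "evpoly f \<Longrightarrow> evpoly g \<Longrightarrow> evpoly (\<lambda>n. poly (poly P [:f n:]) (g n))"
proof (induction P)
  case (pCons c P)
  have "evpoly (\<lambda>n. poly c (g n))" using pCons.prems(2) by (induction c) simp_all
  then show ?case using pCons by simp
qed simp

lemma bipoly_sum_fst:
  assumes "bipoly f"
  shows "bipoly (\<lambda>p q. \<Sum>i<p. f i q)"
proof -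
  have power: "bipoly (\<lambda>p q. \<Sum>i<p. of_nat i ^ a)" for a
  proof -
    obtain Q where "\<forall>n. (\<Sum>k<n. (of_nat k :: rat) ^ a) = poly Q (of_nat n)"
      using sum_power_poly by blast
    then show ?thesis by simp
  qed
  \<comment> \<open>The extra factor \<open>of_nat i ^ a\<close> absorbs the multiplication by the
    summation variable that arises in the \<open>pCons\<close> case.\<close>
  have *: "bipoly (\<lambda>p q. \<Sum>i<p. of_nat i ^ a * poly (poly P [:of_nat i:]) (of_nat q))" for P a
  proof (induction P arbitrary: a)
    case (pCons c P)
    have "of_nat i ^ a * poly (poly (pCons c P) [:of_nat i:]) (of_nat q) =
      of_nat i ^ a * poly c (of_nat q) + of_nat i ^ Suc a * poly (poly P [:of_nat i:]) (of_nat q)" for i q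
      by (simp add: distrib_left)
    then have eq: "(\<Sum>i<p. of_nat i ^ a * poly (poly (pCons c P) [:of_nat i:]) (of_nat q)) =
      (\<Sum>i<p. of_nat i ^ a) * poly c (of_nat q) +
      (\<Sum>i<p. of_nat i ^ Suc a * poly (poly P [:of_nat i:]) (of_nat q))" for p q
      by (simp only: sum.distrib sum_distrib_right)
    show ?case
      unfolding eq by (intro bipoly_add bipoly_mult power pCons.IH bipoly_poly bipoly_snd)
  qed simp
  obtain P where "\<And>p q. f p q = poly (poly P [:of_nat p:]) (of_nat q)"
    using assms unfolding bipoly_def by blast
  then show ?thesis using *[of 0 P] by simp
qed

text \<open>The difference is taken in the rationals, so the summand is a polynomial for all i and
  s. The total s stays a free variable, to be used with s = p + q - 1 and with s = n - 1.\<close>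

lemma poly_convolution:
  "\<exists>R. \<forall>n s. (\<Sum>i<n. poly P (of_nat i) * poly Q (of_nat s - of_nat i)) =
     (poly (poly R [:of_nat n:]) (of_nat s) :: rat)"
proof -
  have "bipoly (\<lambda>i s. poly P (of_nat i) * poly Q (of_nat s - of_nat i))" by simp
  then have "bipoly (\<lambda>n s. \<Sum>i<n. poly P (of_nat i) * poly Q (of_nat s - of_nat i))"
    by (rule bipoly_sum_fst)
  then show ?thesis unfolding bipoly_def .
qed

definition evbipoly :: "(nat \<Rightarrow> nat \<Rightarrow> rat) \<Rightarrow> bool" where
  "evbipoly f \<longleftrightarrow> (\<exists>P N. \<forall>p\<ge>N. \<forall>q\<ge>N. f p q = poly (poly P [:of_nat p:]) (of_nat q))"

lemma evbipoly_add:
  assumes "evbipoly f" "evbipoly g"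
  shows "evbipoly (\<lambda>p q. f p q + g p q)"
proof -
  obtain P Q M N where "\<And>p q. p \<ge> M \<Longrightarrow> q \<ge> M \<Longrightarrow> f p q = poly (poly P [:of_nat p:]) (of_nat q)"
    "\<And>p q. p \<ge> N \<Longrightarrow> q \<ge> N \<Longrightarrow> g p q = poly (poly Q [:of_nat p:]) (of_nat q)"
    using assms unfolding evbipoly_def by blast
  then show ?thesis
    unfolding evbipoly_def by (intro exI[of _ "P + Q"] exI[of _ "max M N"]) simp
qed

text \<open>For i < p the argument p + q - 1 - i is at least q, so \<open>g\<close> may be replaced
  by its polynomial throughout. Only the finitely many i below the bound for \<open>f\<close> need a
  correction, and that is a polynomial in p and q.\<close>

lemma evbipoly_shifted_convolution:
  assumes "evpoly f" "evpoly g"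
  shows "evbipoly (\<lambda>p q. \<Sum>i<p. f i * g (p + q - Suc i))"
proof -
  obtain P M Q M' where *: "\<And>n. n \<ge> M \<Longrightarrow> f n = poly P (of_nat n)" "\<And>n. n \<ge> M' \<Longrightarrow> g n = poly Q (of_nat n)"
    using assms unfolding evpoly_def by blast
  define N where "N = max M M'"
  have N: "f n = poly P (of_nat n)" "g n = poly Q (of_nat n)" if "n \<ge> N" for n
    using that * by (auto simp: N_def)
  obtain R where R: "\<And>n s. (\<Sum>i<n. poly P (of_nat i) * poly Q (of_nat s - of_nat i)) =
     poly (poly R [:of_nat n:]) (of_nat s)"
    using poly_convolution by blast
  let ?s = "\<lambda>p q. of_nat p + of_nat q - 1 :: rat"
  have eq: "(\<Sum>i<p. f i * g (p + q - Suc i)) = poly (poly R [:of_nat p:]) (?s p q) +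
    (\<Sum>i<N. (f i - poly P (of_nat i)) * poly Q (?s p q - of_nat i))" if pq: "p \<ge> Suc N" "q \<ge> Suc N" for p q
  proof -
    have g: "g (p + q - Suc i) = poly Q (?s p q - of_nat i)" if "i < p" for i
    proof -
      have "p + q - Suc i \<ge> N" using that pq by linarith
      moreover have "(of_nat (p + q - Suc i) :: rat) = ?s p q - of_nat i"
        using that pq by (subst of_nat_diff) auto
      ultimately show ?thesis using N(2) by simp
    qed
    have "(\<Sum>i<p. f i * g (p + q - Suc i)) = (\<Sum>i<p. f i * poly Q (?s p q - of_nat i))"
      by (rule sum.cong) (simp_all add: g)
    also have "\<dots> = (\<Sum>i<p. poly P (of_nat i) * poly Q (?s p q - of_nat i)) +
       (\<Sum>i<p. (f i - poly P (of_nat i)) * poly Q (?s p q - of_nat i))"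
      by (simp add: algebra_simps flip: sum.distrib)
    also have "(\<Sum>i<p. (f i - poly P (of_nat i)) * poly Q (?s p q - of_nat i)) =
       (\<Sum>i<N. (f i - poly P (of_nat i)) * poly Q (?s p q - of_nat i))"
      by (rule sum.mono_neutral_right) (use pq N in auto)
    also have "(\<Sum>i<p. poly P (of_nat i) * poly Q (?s p q - of_nat i)) =
      poly (poly R [:of_nat p:]) (of_nat (p + q - 1))"
      unfolding R[symmetric] using pq by (intro sum.cong) (auto simp: of_nat_diff)
    also have "of_nat (p + q - 1) = ?s p q" using pq by (simp add: of_nat_diff)
    finally show ?thesis .
  qed
  have "bipoly (\<lambda>p q. poly (poly R [:of_nat p:]) (?s p q) +
    (\<Sum>i<N. (f i - poly P (of_nat i)) * poly Q (?s p q - of_nat i)))"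
    by (intro bipoly_add bipoly_compose bipoly_sum bipoly_mult bipoly_poly bipoly_diff bipoly_const
        bipoly_fst bipoly_snd)
  then show ?thesis
    using eq unfolding bipoly_def evbipoly_def by metis
qed

lemma evpoly_convolution_finite:
  assumes "\<And>i. i \<ge> N \<Longrightarrow> f i = 0" "evpoly g"
  shows "evpoly (\<lambda>n. \<Sum>i<n. f i * g (n - Suc i))"
proof (rule evpoly_cong)
  show "evpoly (\<lambda>n. \<Sum>i<N. f i * g (n - Suc i))" using assms(2) by simp
  fix n assume "n \<ge> N"
  then show "(\<Sum>i<N. f i * g (n - Suc i)) = (\<Sum>i<n. f i * g (n - Suc i))"
    by (intro sum.mono_neutral_left) (use assms in auto)
qed

text \<open>Here both factors meet small arguments. With polynomials P and Q for \<open>f\<close>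
  and \<open>g\<close>, the convolution splits as (f - P) with g, plus P with (g - Q), plus P with
  Q; in the first two one factor vanishes from some point on.\<close>

lemma evpoly_convolution:
  assumes "evpoly f" "evpoly g"
  shows "evpoly (\<lambda>n. \<Sum>i<n. f i * g (n - Suc i))"
proof -
  obtain P M Q N where *: "\<And>n. n \<ge> M \<Longrightarrow> f n = poly P (of_nat n)" "\<And>n. n \<ge> N \<Longrightarrow> g n = poly Q (of_nat n)"
    using assms unfolding evpoly_def by blast
  let ?P = "\<lambda>i. poly P (of_nat i)" let ?Q = "\<lambda>i. poly Q (of_nat i)"
  have 1: "evpoly (\<lambda>n. \<Sum>i<n. (f i - ?P i) * g (n - Suc i))"
    by (rule evpoly_convolution_finite[of M]) (use * assms in auto)
  have "evpoly (\<lambda>n. \<Sum>i<n. (g i - ?Q i) * ?P (n - Suc i))"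
    by (rule evpoly_convolution_finite[of N]) (use * in auto)
  also have "(\<lambda>n. \<Sum>i<n. (g i - ?Q i) * ?P (n - Suc i)) = (\<lambda>n. \<Sum>i<n. ?P i * (g (n - Suc i) - ?Q (n - Suc i)))"
    by (rule ext, subst sum.nat_diff_reindex[symmetric]) (auto simp: mult.commute intro!: sum.cong)
  finally have 2: "evpoly (\<lambda>n. \<Sum>i<n. ?P i * (g (n - Suc i) - ?Q (n - Suc i)))" .
  obtain R where R: "\<And>n s. (\<Sum>i<n. poly P (of_nat i) * poly Q (of_nat s - of_nat i)) =
     poly (poly R [:of_nat n:]) (of_nat s)"
    using poly_convolution by blast
  have 3: "evpoly (\<lambda>n. \<Sum>i<n. ?P i * ?Q (n - Suc i))"
  proof (rule evpoly_cong)
    show "evpoly (\<lambda>n. poly (poly R [:of_nat n:]) (of_nat (n - 1)))"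
      by (intro evpoly_compose evpoly_minus_index[of of_nat] evpoly_of_nat)
    fix n
    show "poly (poly R [:of_nat n:]) (of_nat (n - 1)) = (\<Sum>i<n. ?P i * ?Q (n - Suc i))"
      unfolding R[symmetric] by (intro sum.cong) (auto simp: of_nat_diff diff_diff_eq)
  qed
  have "(\<lambda>n. \<Sum>i<n. f i * g (n - Suc i)) = (\<lambda>n. (\<Sum>i<n. (f i - ?P i) * g (n - Suc i)) +
    (\<Sum>i<n. ?P i * (g (n - Suc i) - ?Q (n - Suc i))) + (\<Sum>i<n. ?P i * ?Q (n - Suc i)))"
    by (simp add: algebra_simps flip: sum.distrib)
  then show ?thesis using 1 2 3 by simp
qed

lemma evpoly_partial_sum:
  assumes "evpoly f"
  shows "evpoly (\<lambda>n. \<Sum>i\<le>n. f i)"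
proof -
  have "evpoly (\<lambda>n. \<Sum>i<n. f i * 1)"
    using evpoly_convolution[OF assms evpoly_const[of 1]] .
  then have "evpoly (\<lambda>n. (\<Sum>i<n. f i) + f n)" using assms by (simp del: sum.lessThan_Suc)
  then show ?thesis by (simp add: lessThan_Suc_atMost[symmetric])
qed

text \<open>Finite sums of products f(i) g(j). Unlike \<open>evbipoly\<close> this also controls the
  strips where one argument is small and the other large, which sums along antidiagonals pass
  through.\<close>

inductive seppoly :: "(nat \<Rightarrow> nat \<Rightarrow> rat) \<Rightarrow> bool" where
  zero: "seppoly (\<lambda>_ _. 0)"
| add_prod: "seppoly H \<Longrightarrow> evpoly f \<Longrightarrow> evpoly g \<Longrightarrow> seppoly (\<lambda>i j. H i j + f i * g j)"

lemma seppoly_prod: "evpoly f \<Longrightarrow> evpoly g \<Longrightarrow> seppoly (\<lambda>i j. f i * g j)"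
  using seppoly.add_prod[OF seppoly.zero] by simp

lemma seppoly_add:
  assumes "seppoly H" "seppoly G"
  shows "seppoly (\<lambda>i j. H i j + G i j)"
  using assms(2,1)
proof induction
  case (add_prod G f g)
  from seppoly.add_prod[OF add_prod.IH[OF add_prod.prems] add_prod.hyps(2,3)]
  show ?case by (simp add: add.assoc)
qed simp

lemma seppoly_sum: "(\<And>x. x \<in> A \<Longrightarrow> seppoly (H x)) \<Longrightarrow> seppoly (\<lambda>i j. \<Sum>x\<in>A. H x i j)"
  by (induction A rule: infinite_finite_induct) (simp_all add: seppoly_add seppoly.zero)

lemma seppoly_swap: "seppoly H \<Longrightarrow> seppoly (\<lambda>i j. H j i)"
proof (induction rule: seppoly.induct)
  case (add_prod H f g)
  then show ?case using seppoly.add_prod[of "\<lambda>i j. H j i" g f] by (simp add: mult.commute)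
qed (rule seppoly.zero)

lemma seppoly_shift: "seppoly H \<Longrightarrow> seppoly (\<lambda>i j. if k \<le> i then H (i - k) j else 0)"
proof (induction rule: seppoly.induct)
  case (add_prod H f g)
  have "evpoly (\<lambda>i. if k \<le> i then f (i - k) else 0)"
    by (rule evpoly_cong[of "\<lambda>i. f (i - k)" k]) (use add_prod in auto)
  from seppoly.add_prod[OF add_prod.IH this add_prod.hyps(3)]
  show ?case by (rule back_subst[of seppoly]) (simp add: fun_eq_iff)
qed (simp add: seppoly.zero)

lemma seppoly_partial_sum: "seppoly H \<Longrightarrow> seppoly (\<lambda>i j. \<Sum>k\<le>i. H k j)"
proof (induction rule: seppoly.induct)
  case (add_prod H f g)
  from seppoly.add_prod[OF add_prod.IH evpoly_partial_sum[OF add_prod.hyps(2)] add_prod.hyps(3)]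
  show ?case by (rule back_subst[of seppoly]) (simp add: fun_eq_iff sum.distrib sum_distrib_right)
qed (simp add: seppoly.zero)

text \<open>This antidiagonal sum is the shape in which \<Lambda>(p, q) appears when the factors
  \<open>M\<close> of \<open>M ^ p * F ^ q\<close> are replaced by \<open>F\<close> one at a
  time.\<close>

lemma seppoly_evbipoly: "seppoly H \<Longrightarrow> evbipoly (\<lambda>p q. \<Sum>i<p. H i (p + q - Suc i))"
proof (induction rule: seppoly.induct)
  case zero
  then show ?case unfolding evbipoly_def by (intro exI[of _ 0]) simp
next
  case (add_prod H f g)
  from evbipoly_add[OF add_prod.IH evbipoly_shifted_convolution[OF add_prod.hyps(2,3)]]
  show ?case by (simp add: sum.distrib)
qed

lemma seppoly_evpoly: "seppoly H \<Longrightarrow> evpoly (\<lambda>n. \<Sum>i<n. H i (n - Suc i))"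
proof (induction rule: seppoly.induct)
  case (add_prod H f g)
  from evpoly_add[OF add_prod.IH evpoly_convolution[OF add_prod.hyps(2,3)]]
  show ?case by (simp add: sum.distrib)
qed simp

section \<open>Antitone functions of exponent vectors\<close>

definition antitone :: "nat \<Rightarrow> (nat list \<Rightarrow> nat) \<Rightarrow> bool" where
  "antitone n h \<longleftrightarrow> (\<forall>a b. length a = n \<longrightarrow> list_all2 (\<le>) a b \<longrightarrow> h b \<le> h a)"

lemma antitoneD: "antitone n h \<Longrightarrow> length a = n \<Longrightarrow> list_all2 (\<le>) a b \<Longrightarrow> h b \<le> h a"
  by (simp add: antitone_def)

lemma antitone_Cons: "antitone (Suc n) h \<Longrightarrow> antitone n (\<lambda>a. h (k # a))"
  by (simp add: antitone_def)

lemma antitone_Cons_le: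
  "antitone (Suc n) h \<Longrightarrow> length a = n \<Longrightarrow> k \<le> l \<Longrightarrow> h (l # a) \<le> h (k # a)"
  by (rule antitoneD) (auto simp: list_all2_refl)

lemma list_all2_map_min: "list_all2 (\<le>) (map (min N) a) (a :: nat list)"
  by (induction a) auto

text \<open>A form of Dickson's lemma: the limit in the first variable is antitone in the others, hence by
  induction it takes its values on a finite set, where it is reached uniformly.\<close>

lemma antitone_stable:
  assumes IH: "\<And>h. antitone n h \<Longrightarrow> \<exists>N. \<forall>a. length a = n \<longrightarrow> h a = h (map (min N) a)"
    and h: "antitone (Suc n) h"
  shows "\<exists>N. \<forall>k\<ge>N. \<forall>a. length a = n \<longrightarrow> h (k # a) = h (N # a)"
proof -
  \<comment> \<open>Since \<open>h\<close> decreases in its first argument, its least value there is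
    also the eventual one.\<close>
  define g where "g = (\<lambda>a. LEAST x. \<exists>k. x = h (k # a))"
  have g_le: "g a \<le> h (k # a)" for a k
    unfolding g_def by (rule Least_le) blast
  have g_ex: "\<exists>k. g a = h (k # a)" for a
    unfolding g_def by (rule LeastI[of "\<lambda>x. \<exists>k. x = h (k # a)" "h (0 # a)"]) blast
  have "antitone n g"
    unfolding antitone_def
  proof (intro allI impI)
    fix a b :: "nat list" assume ab: "length a = n" "list_all2 (\<le>) a b"
    obtain k where "g a = h (k # a)" using g_ex by blast
    moreover have "h (k # b) \<le> h (k # a)" using h ab by (intro antitoneD) auto
    ultimately show "g b \<le> g a" using g_le[of b k] by simp
  qed
  then obtain M where M: "\<And>a. length a = n \<Longrightarrow> g a = g (map (min M) a)" using IH by blast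
  define A where "A = {a :: nat list. set a \<subseteq> {..M} \<and> length a = n}"
  have "finite A" unfolding A_def by (rule finite_lists_length_eq) simp
  obtain K where K: "\<And>a. g a = h (K a # a)" using g_ex by metis
  \<comment> \<open>Past \<open>N\<close> the limit has been reached at every one of the finitely
    many vectors truncated at \<open>M\<close>.\<close>
  define N where "N = Max (insert 0 (K ` A))"
  have N: "K a \<le> N" if "a \<in> A" for a
    unfolding N_def using \<open>finite A\<close> that by (intro Max_ge) auto
  have eq: "h (k # a) = g a" if "k \<ge> N" "length a = n" for k a
  proof -
    let ?b = "map (min M) a"
    have b: "?b \<in> A" using that by (auto simp: A_def)
    \<comment> \<open>Any \<open>a\<close> dominates its truncation, where the limit has already
      been reached, and both have the same limit \<open>g a\<close>.\<close>
    have "h (k # a) \<le> h (k # ?b)"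
      using h that list_all2_map_min by (intro antitoneD) auto
    also have "\<dots> \<le> h (K ?b # ?b)"
      using h that N[OF b] by (intro antitone_Cons_le) auto
    also have "\<dots> = g a" using K M that by metis
    finally show ?thesis using g_le[of a k] by simp
  qed
  then show ?thesis by (intro exI[of _ N]) simp
qed

text \<open>\<open>antitone_stable\<close> cuts off the first coordinate at \<open>M\<close>, which
  leaves the finitely many slices k \<le> M, each covered by the induction hypothesis. The maximum
  of all bounds then serves.\<close>

lemma antitone_truncation: "antitone n h \<Longrightarrow> \<exists>N. \<forall>a. length a = n \<longrightarrow> h a = h (map (min N) a)"
proof (induction n arbitrary: h)
  case (Suc n)
  obtain M where M: "\<And>k a. k \<ge> M \<Longrightarrow> length a = n \<Longrightarrow> h (k # a) = h (M # a)"
    using antitone_stable[OF Suc.IH Suc.prems] by blast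
  have "\<exists>N. \<forall>a. length a = n \<longrightarrow> h (k # a) = h (k # map (min N) a)" for k
    using Suc.IH[OF antitone_Cons[OF Suc.prems]] .
  then obtain N where N: "\<And>k a. length a = n \<Longrightarrow> h (k # a) = h (k # map (min (N k)) a)" by metis
  define L where "L = Max (insert M (N ` {..M}))"
  have L: "M \<le> L" "k \<le> M \<Longrightarrow> N k \<le> L" for k
    unfolding L_def by (intro Max_ge; simp)+
  have NL: "h (k # a) = h (k # map (min L) a)" if "k \<le> M" "length a = n" for k a
  proof -
    have eq: "map (min (N k)) (map (min L) a) = map (min (N k)) a"
      using L(2)[OF that(1)] by (auto simp: min_def)
    show ?thesis using N[of a k] N[of "map (min L) a" k] that by (simp only: eq length_map)
  qed
  have "h a = h (map (min L) a)" if a: "length a = Suc n" for a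
  proof -
    obtain k b where kb: "a = k # b" "length b = n" using a by (cases a) auto
    show ?thesis
    proof (cases "k \<le> M")
      case True
      then have "min L k = k" using L(1) by simp
      then show ?thesis using NL[of k b] True kb by simp
    next
      case False
      then have "h (k # b) = h (M # map (min L) b)" using M[of k b] NL[of M b] kb by simp
      moreover have "h (min L k # map (min L) b) = h (M # map (min L) b)"
        using False kb L by (intro M) auto
      ultimately show ?thesis using kb by simp
    qed
  qed
  then show ?case by blast
qed simp

text \<open>The list of booleans tags generators: in the application \<open>True\<close> marks
  generators of \<open>M\<close> and \<open>False\<close> those of \<open>F\<close>. This is the
  partial degree of a monomial in the generators of one kind.\<close>

fun wdeg :: "bool \<Rightarrow> bool list \<Rightarrow> nat list \<Rightarrow> nat" where
  "wdeg t (b # w) (k # a) = (if b = t then k else 0) + wdeg t w a"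
| "wdeg t _ _ = 0"

definition expts :: "bool list \<Rightarrow> nat \<Rightarrow> nat \<Rightarrow> nat list set" where
  "expts w i j = {a. length a = length w \<and> wdeg True w a = i \<and> wdeg False w a = j}"

lemma expts_Nil: "expts [] i j = (if i = 0 \<and> j = 0 then {[]} else {})"
  by (auto simp: expts_def)

lemma expts_Cons_True: "expts (True # w) i j = (\<Union>k\<le>i. (#) k ` expts w (i - k) j)"
proof (rule set_eqI)
  fix a
  show "a \<in> expts (True # w) i j \<longleftrightarrow> a \<in> (\<Union>k\<le>i. (#) k ` expts w (i - k) j)"
    by (cases a) (auto simp: expts_def image_iff)
qed

lemma expts_Cons_False: "expts (False # w) i j = (\<Union>k\<le>j. (#) k ` expts w i (j - k))"
proof (rule set_eqI)
  fix a
  show "a \<in> expts (False # w) i j \<longleftrightarrow> a \<in> (\<Union>k\<le>j. (#) k ` expts w i (j - k))"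
    by (cases a) (auto simp: expts_def image_iff)
qed

lemma finite_expts [simp]: "finite (expts w i j)"
proof (induction w arbitrary: i j)
  case (Cons b w)
  then show ?case by (cases b) (auto simp: expts_Cons_True expts_Cons_False)
qed (simp add: expts_Nil)

lemma sum_UN_Cons:
  "(\<And>k. finite (B k)) \<Longrightarrow> (\<Sum>a\<in>(\<Union>k\<le>n. (#) k ` B k). h a) = (\<Sum>k\<le>n. \<Sum>a\<in>B k. h (k # a))"
  for h :: "nat list \<Rightarrow> 'b::comm_monoid_add"
  by (subst sum.UNION_disjoint) (auto simp: sum.reindex)

lemma sum_expts_True:
  "(\<Sum>a\<in>expts (True # w) i j. h a) = (\<Sum>k\<le>i. \<Sum>a\<in>expts w (i - k) j. h (k # a))"
  for h :: "nat list \<Rightarrow> 'b::comm_monoid_add"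
  unfolding expts_Cons_True by (rule sum_UN_Cons) simp

lemma sum_expts_False:
  "(\<Sum>a\<in>expts (False # w) i j. h a) = (\<Sum>k\<le>j. \<Sum>a\<in>expts w i (j - k). h (k # a))"
  for h :: "nat list \<Rightarrow> 'b::comm_monoid_add"
  unfolding expts_Cons_False by (rule sum_UN_Cons) simp

text \<open>For k < N the summands are shifts of single functions; from N on the function is always
  \<open>F N\<close>, and the tail collapses to one of its partial sums.\<close>

lemma seppoly_stable_convolution:
  fixes F :: "nat \<Rightarrow> nat \<Rightarrow> nat \<Rightarrow> rat"
  assumes "\<And>k. seppoly (F k)" "\<And>k. k \<ge> N \<Longrightarrow> F k = F N"
  shows "seppoly (\<lambda>i j. \<Sum>k\<le>i. F k (i - k) j)"
proof -
  let ?G = "\<lambda>i j. (\<Sum>k<N. if k \<le> i then F k (i - k) j else 0) +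
    (if N \<le> i then \<Sum>k\<le>i - N. F N k j else 0)"
  have "seppoly ?G"
    by (intro seppoly_add seppoly_sum seppoly_shift[of _ N, OF seppoly_partial_sum] seppoly_shift assms)
  moreover have "(\<Sum>k\<le>i. F k (i - k) j) = ?G i j" for i j
  proof -
    have "(\<Sum>k\<le>i. F k (i - k) j) = (\<Sum>k\<in>{..i} \<inter> {..<N}. F k (i - k) j) + (\<Sum>k\<in>{N..i}. F k (i - k) j)"
      by (subst sum.union_disjoint[symmetric]) (auto intro!: sum.cong)
    also have "(\<Sum>k\<in>{..i} \<inter> {..<N}. F k (i - k) j) = (\<Sum>k<N. if k \<le> i then F k (i - k) j else 0)"
      by (rule sum.mono_neutral_cong_left) auto
    also have "(\<Sum>k\<in>{N..i}. F k (i - k) j) = (\<Sum>k\<in>{N..i}. F N (i - k) j)"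
    proof (rule sum.cong)
      fix k assume "k \<in> {N..i}"
      then have "F k = F N" by (intro assms(2)) simp
      then show "F k (i - k) j = F N (i - k) j" by (simp only:)
    qed simp
    also have "\<dots> = (if N \<le> i then \<Sum>k\<le>i - N. F N k j else 0)"
    proof (cases "N \<le> i")
      case True
      have "(\<Sum>k\<in>{N..i}. F N (i - k) j) = (\<Sum>k\<le>i - N. F N k j)"
        by (rule sum.reindex_bij_witness[of _ "\<lambda>k. i - k" "\<lambda>k. i - k"]) (use True in auto)
      then show ?thesis using True by simp
    qed simp
    finally show ?thesis .
  qed
  ultimately show ?thesis by simp
qed

text \<open>Induction on the generators: the sum is a convolution over the first exponent k, and by
  \<open>antitone_stable\<close> the inner functions no longer depend on k once k is large.\<close>

lemma seppoly_expts:
  "antitone (length w) h \<Longrightarrow> seppoly (\<lambda>i j. of_nat (\<Sum>a\<in>expts w i j. h a))"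
proof (induction w arbitrary: h)
  case Nil
  have "(\<lambda>i j. of_nat (\<Sum>a\<in>expts [] i j. h a)) =
    (\<lambda>i j. (if i = 0 then of_nat (h []) else 0) * (if j = 0 then 1 else 0 :: rat))"
    by (auto simp: expts_Nil fun_eq_iff)
  moreover have "evpoly (\<lambda>i. if i = 0 then c else 0)" for c
    by (rule evpolyI[of 1 _ 0]) simp
  ultimately show ?case by (simp add: seppoly_prod)
next
  case (Cons b w)
  then have h: "antitone (Suc (length w)) h" by simp
  obtain N where N: "\<And>k a. k \<ge> N \<Longrightarrow> length a = length w \<Longrightarrow> h (k # a) = h (N # a)"
    using antitone_stable[OF antitone_truncation h] by blast
  let ?F = "\<lambda>k i j. of_nat (\<Sum>a\<in>expts w i j. h (k # a)) :: rat"
  have F: "seppoly (?F k)" for k using Cons.IH[OF antitone_Cons[OF h]] .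
  have stable: "?F k = ?F N" if "k \<ge> N" for k
    using N[OF that] by (auto simp: fun_eq_iff expts_def intro!: sum.cong)
  show ?case
  proof (cases b)
    case True
    then show ?thesis
      using seppoly_stable_convolution[of ?F N, OF F stable] by (simp add: sum_expts_True)
  next
    case False
    \<comment> \<open>For a generator tagged \<open>False\<close> the convolution runs in the second
      argument, so the arguments are exchanged.\<close>
    have stable': "(\<lambda>j i. ?F k i j) = (\<lambda>j i. ?F N i j)" if "k \<ge> N" for k
      using stable[OF that] by (simp only: fun_eq_iff) simp
    from seppoly_stable_convolution[of "\<lambda>k j i. ?F k i j" N, OF seppoly_swap[OF F] stable']
    have "seppoly (\<lambda>j i. \<Sum>k\<le>j. ?F k i (j - k))" .
    from seppoly_swap[OF this] show ?thesis using False by (simp add: sum_expts_False)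
  qed
qed

section \<open>Hilbert functions of filtrations\<close>

fun monom_of :: "'b::comm_monoid_mult list \<Rightarrow> nat list \<Rightarrow> 'b" where
  "monom_of (g # gs) (k # a) = g ^ k * monom_of gs a"
| "monom_of _ _ = 1"

lemma monom_of_add:
  "length a = length b \<Longrightarrow> monom_of gs (map2 (+) a b) = monom_of gs a * monom_of gs b"
proof (induction gs a arbitrary: b rule: monom_of.induct)
  case (1 g gs k a)
  then obtain l c where b: "b = l # c" "length a = length c" by (cases b) auto
  show ?case using 1 by (simp add: b power_add ac_simps)
qed auto

lemma monom_of_zeros: "set a \<subseteq> {0} \<Longrightarrow> monom_of gs a = 1"
  by (induction gs a rule: monom_of.induct) auto

definition gspan :: "bool \<Rightarrow> (bool \<times> 'a::comm_ring_1 mpoly) list \<Rightarrow> 'a msub" where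
  "gspan t gs = sum_list (map (\<lambda>(b, g). if b = t then cyc g else 0) gs)"

text \<open>The monomials of bidegree (i, j) in the generators span the product of the powers; one
  generator is split off at a time by \<open>msub_binomial\<close>.\<close>

lemma sum_expts_cyc:
  "(\<Sum>a\<in>expts (map fst gs) i j. cyc (monom_of (map snd gs) a)) = gspan True gs ^ i * gspan False gs ^ j"
proof (induction gs arbitrary: i j)
  case Nil
  then show ?case by (auto simp: expts_Nil gspan_def power_0_left)
next
  case (Cons x gs)
  obtain b g where x: "x = (b, g)" by (cases x)
  have mon: "cyc (monom_of (map snd ((c, g) # gs)) (k # a)) = cyc g ^ k * cyc (monom_of (map snd gs) a)" for c k a
    by (simp add: cyc_mult cyc_power)
  show ?case
  proof (cases b)
    case True
    have "(\<Sum>a\<in>expts (map fst (x # gs)) i j. cyc (monom_of (map snd (x # gs)) a)) =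
      (\<Sum>k\<le>i. cyc g ^ k * (gspan True gs ^ (i - k) * gspan False gs ^ j))"
      using True unfolding list.map(2)[of fst] x fst_conv
      by (simp only: simp_thms sum_expts_True mon Cons.IH[symmetric] sum_distrib_left)
    also have "\<dots> = (cyc g + gspan True gs) ^ i * gspan False gs ^ j"
      by (simp only: msub_binomial sum_distrib_right mult.assoc)
    finally show ?thesis using True by (simp add: x gspan_def)
  next
    case False
    have "(\<Sum>a\<in>expts (map fst (x # gs)) i j. cyc (monom_of (map snd (x # gs)) a)) =
      (\<Sum>k\<le>j. cyc g ^ k * (gspan True gs ^ i * gspan False gs ^ (j - k)))"
      using False unfolding list.map(2)[of fst] x fst_conv
      by (simp only: simp_thms sum_expts_False mon Cons.IH[symmetric] sum_distrib_left)
    also have "\<dots> = gspan True gs ^ i * (\<Sum>k\<le>j. cyc g ^ k * gspan False gs ^ (j - k))"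
      by (simp only: sum_distrib_left mult.left_commute)
    also have "\<dots> = gspan True gs ^ i * (cyc g + gspan False gs) ^ j"
      by (simp only: msub_binomial)
    finally show ?thesis using False by (simp add: x gspan_def)
  qed
qed

text \<open>The lexicographic order is a monomial order.\<close>

lemma map2_add_less_mono:
  "length a = length c \<Longrightarrow> length b = length c \<Longrightarrow> a < b \<Longrightarrow> map2 (+) a c < map2 (+) b (c :: nat list)"
proof (induction c arbitrary: a b)
  case (Cons k c)
  obtain x a' y b' where "a = x # a'" "b = y # b'"
    using Cons.prems by (cases a; cases b) auto
  then show ?case using Cons by auto
qed auto

lemma map2_add_minus: "list_all2 (\<le>) a b \<Longrightarrow> map2 (+) a (map2 (-) b a) = (b :: nat list)"
  by (induction rule: list_all2_induct) auto

lemma wdeg_add: "length a = length b \<Longrightarrow> wdeg t w (map2 (+) a b) = wdeg t w a + wdeg t w b"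
proof (induction t w a arbitrary: b rule: wdeg.induct)
  case (1 t b' w k a)
  then obtain l c where b: "b = l # c" "length a = length c" by (cases b) auto
  show ?case using 1 by (simp add: b)
qed auto

lemma wdeg_zeros: "wdeg t w (replicate n 0) = 0"
proof (induction w arbitrary: n)
  case (Cons b w)
  then show ?case by (cases n) auto
qed simp

lemma sum_enat: "(\<Sum>a\<in>A. enat (h a)) = enat (\<Sum>a\<in>A. h a)"
  by (induction A rule: infinite_finite_induct) (simp_all add: zero_enat_def)

lemma power_shift_le:
  fixes X :: "'a::comm_ring_1 msub"
  assumes "\<And>i. X * U i \<le> U (Suc i)"
  shows "X ^ n * U i \<le> U (i + n)"
proof (induction n)
  case (Suc n)
  have "X ^ Suc n * U i = X * (X ^ n * U i)" by (simp only: power_Suc mult.assoc)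
  also have "\<dots> \<le> X * U (i + n)" by (intro msub_mult_mono order_refl Suc)
  also have "\<dots> \<le> U (i + Suc n)" using assms by simp
  finally show ?case .
qed simp

text \<open>Order the monomials in the generators lexicographically; the contribution of each of them to
  the length is antitone in the exponent vector, since multiplication by a monomial respects the
  order.\<close>

lemma hilbert_function_antitone:
  fixes gs :: "(bool \<times> 'a::comm_ring_1 mpoly) list"
  defines "w \<equiv> map fst gs" and "X \<equiv> gspan True gs" and "Y \<equiv> gspan False gs"
  assumes UX: "\<And>i j. X * U i j \<le> U (Suc i) j" and UY: "\<And>i j. Y * U i j \<le> U i (Suc j)"
    and fin: "qlen (U 0 0 + cyc g0) (U 0 0) \<noteq> \<infinity>"
  shows "\<exists>h. antitone (length gs) h \<and>
    (\<forall>i j. qlen (U i j + cyc g0 * (X ^ i * Y ^ j)) (U i j) = enat (\<Sum>a\<in>expts w i j. h a))"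
proof -
  let ?m = "monom_of (map snd gs)"
  \<comment> \<open>The submodule already reached before the monomial with exponent \<open>a\<close>
    is adjoined.\<close>
  define W where "W = (\<lambda>i j a. U i j + (\<Sum>b\<in>{b\<in>expts w i j. b < a}. cyc (g0 * ?m b)))"
  \<comment> \<open>The bidegree is read off from \<open>a\<close> itself, so that the contribution
    becomes a function of \<open>a\<close> alone and can be compared across bidegrees.\<close>
  define W' where "W' = (\<lambda>a. W (wdeg True w a) (wdeg False w a) a)"
  define hE where "hE = (\<lambda>a. qlen (W' a + cyc (g0 * ?m a)) (W' a))"
  have cyc_m: "cyc (?m a) \<le> X ^ wdeg True w a * Y ^ wdeg False w a" if "length a = length w" for a
    unfolding X_def Y_def sum_expts_cyc[symmetric] w_def[symmetric]
    by (rule le_sum_msub[OF finite_expts]) (simp add: expts_def that)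
  have UXY: "X ^ n * Y ^ k * U i j \<le> U (i + n) (j + k)" for n k i j
  proof -
    have "X ^ n * Y ^ k * U i j = X ^ n * (Y ^ k * U i j)" by (simp only: mult.assoc)
    also have "\<dots> \<le> X ^ n * U i (j + k)" by (intro msub_mult_mono order_refl power_shift_le UY)
    also have "\<dots> \<le> U (i + n) (j + k)" by (rule power_shift_le) (rule UX)
    finally show ?thesis .
  qed
  have anti: "hE b \<le> hE a" if a: "length a = length w" and ab: "list_all2 (\<le>) a b" for a b
  proof -
    define c where "c = map2 (-) b a"
    have lb: "length b = length w" using a list_all2_lengthD[OF ab] by simp
    have lc: "length c = length w" using a lb by (simp add: c_def)
    have b: "b = map2 (+) a c" using map2_add_minus[OF ab] by (simp add: c_def)
    let ?i = "wdeg True w a" and ?j = "wdeg False w a" and ?i' = "wdeg True w c" and ?j' = "wdeg False w c"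
    have deg: "wdeg True w b = ?i + ?i'" "wdeg False w b = ?j + ?j'"
      unfolding b by (simp_all add: wdeg_add a lc)
    have U_le: "U (?i + ?i') (?j + ?j') \<le> W' b"
      by (simp add: W'_def W_def deg le_iff_add) blast
    \<comment> \<open>Multiplication by the monomial with exponent b - a sends monomials below
      \<open>a\<close> to monomials below \<open>b\<close>, so it maps what lies before
      \<open>a\<close> into what lies before \<open>b\<close>.\<close>
    have le: "cyc (?m c) * W' a \<le> W' b"
    proof -
      have "cyc (?m c) * U ?i ?j \<le> X ^ ?i' * Y ^ ?j' * U ?i ?j"
        by (intro msub_mult_mono order_refl cyc_m lc)
      also have "\<dots> \<le> U (?i + ?i') (?j + ?j')" by (rule UXY)
      also note U_le
      finally have 1: "cyc (?m c) * U ?i ?j \<le> W' b" .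
      have 2: "cyc (?m c) * cyc (g0 * ?m e) \<le> W' b" if e: "e \<in> expts w ?i ?j" "e < a" for e
      proof -
        have le: "length e = length w" using e by (simp add: expts_def)
        have e': "map2 (+) e c \<in> {x \<in> expts w (?i + ?i') (?j + ?j'). x < b}"
          using e le lc a unfolding b by (auto simp: expts_def wdeg_add intro!: map2_add_less_mono)
        have "?m c * (g0 * ?m e) = g0 * (?m c * ?m e)" by (rule mult.left_commute)
        also have "?m c * ?m e = ?m e * ?m c" by (rule mult.commute)
        also have "\<dots> = ?m (map2 (+) e c)" by (rule monom_of_add[symmetric]) (simp add: le lc)
        finally have "?m c * (g0 * ?m e) = g0 * ?m (map2 (+) e c)" .
        then have "cyc (?m c) * cyc (g0 * ?m e) = cyc (g0 * ?m (map2 (+) e c))"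
          by (simp only: cyc_mult)
        also have "\<dots> \<le> (\<Sum>b\<in>{x \<in> expts w (?i + ?i') (?j + ?j'). x < b}. cyc (g0 * ?m b))"
          by (rule le_sum_msub[OF _ e']) simp
        also have "\<dots> \<le> W' b" by (simp add: W'_def W_def deg le_iff_add add.commute) (metis add.commute)
        finally show ?thesis .
      qed
      have W'a: "W' a = U ?i ?j + (\<Sum>b\<in>{b\<in>expts w ?i ?j. b < a}. cyc (g0 * ?m b))"
        by (simp only: W'_def W_def)
      show ?thesis
        unfolding W'a distrib_left sum_distrib_left plus_le_iff
        using 1 2 by (simp add: sum_le_msub_iff)
    qed
    have "W' b + cyc (g0 * ?m b) = W' b + cyc (?m c) * (W' a + cyc (g0 * ?m a))"
    proof -
      have "?m c * (g0 * ?m a) = g0 * (?m c * ?m a)" by (rule mult.left_commute)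
      also have "?m c * ?m a = ?m a * ?m c" by (rule mult.commute)
      also have "\<dots> = ?m b" unfolding b by (rule monom_of_add[symmetric]) (simp add: a lc)
      finally have "?m c * (g0 * ?m a) = g0 * ?m b" .
      then have "W' b + cyc (?m c) * (W' a + cyc (g0 * ?m a)) = W' b + cyc (?m c) * W' a + cyc (g0 * ?m b)"
        by (simp only: distrib_left cyc_mult add.assoc)
      also have "W' b + cyc (?m c) * W' a = W' b"
        using msub_add_absorb[OF le] by (simp only: add.commute)
      finally show ?thesis by (rule sym)
    qed
    moreover have "W' a \<le> W' a + cyc (g0 * ?m a)" by (auto simp: le_iff_add)
    ultimately show ?thesis
      unfolding hE_def using qlen_cyc_times_le[OF le, of "W' a + cyc (g0 * ?m a)"] by simp
  qed
  \<comment> \<open>By antitonicity the largest contribution is that of the zero vector, that is of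
    \<open>g0\<close> itself, which \<open>fin\<close> bounds.\<close>
  have hE_fin: "hE a \<noteq> \<infinity>" if a: "length a = length w" for a
  proof -
    let ?z = "replicate (length w) 0 :: nat list"
    have "hE a \<le> hE ?z"
      by (rule anti) (auto simp: list_all2_conv_all_nth a)
    also have "hE ?z \<le> qlen (U 0 0 + cyc g0) (U 0 0)"
    proof -
      have m: "?m ?z = 1" by (rule monom_of_zeros) auto
      have U_le: "U 0 0 \<le> W' ?z" by (simp add: W'_def W_def wdeg_zeros le_iff_add) blast
      have "U 0 0 \<le> U 0 0 + cyc g0" by (auto simp: le_iff_add)
      from qlen_plus_le[OF this, of "W' ?z"]
      show ?thesis
        unfolding hE_def m using msub_add_absorb[OF U_le] by (simp add: ac_simps)
    qed
    finally show ?thesis using fin by (auto dest: enat_ile)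
  qed
  define h where "h = the_enat \<circ> hE"
  have h: "hE a = enat (h a)" if "length a = length w" for a
    using hE_fin[OF that] by (auto simp: h_def)
  have len: "length gs = length w" by (simp add: w_def)
  have "antitone (length gs) h"
    unfolding antitone_def
  proof (intro allI impI)
    fix a b :: "nat list" assume ab: "length a = length gs" "list_all2 (\<le>) a b"
    then have "length b = length w" using list_all2_lengthD[OF ab(2)] len by simp
    then show "h b \<le> h a" using anti[of a b] ab h[of a] h[of b] len by simp
  qed
  moreover have "qlen (U i j + cyc g0 * (X ^ i * Y ^ j)) (U i j) = enat (\<Sum>a\<in>expts w i j. h a)" for i j
  proof -
    have "cyc g0 * (X ^ i * Y ^ j) = (\<Sum>a\<in>expts w i j. cyc (g0 * ?m a))"
      unfolding X_def Y_def sum_expts_cyc[symmetric] w_def[symmetric] by (simp only: sum_distrib_left cyc_mult)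
    then have "qlen (U i j + cyc g0 * (X ^ i * Y ^ j)) (U i j) =
      (\<Sum>a\<in>expts w i j. qlen (W i j a + cyc (g0 * ?m a)) (W i j a))"
      unfolding W_def by (simp only: qlen_cyc_filtration[OF finite_expts])
    also have "\<dots> = (\<Sum>a\<in>expts w i j. enat (h a))"
    proof (rule sum.cong)
      fix a assume "a \<in> expts w i j"
      then have "length a = length w" "wdeg True w a = i" "wdeg False w a = j" by (auto simp: expts_def)
      then show "qlen (W i j a + cyc (g0 * ?m a)) (W i j a) = enat (h a)"
        using h[of a] by (simp add: hE_def W'_def)
    qed simp
    also have "\<dots> = enat (\<Sum>a\<in>expts w i j. h a)"
      by (rule sum_enat)
    finally show ?thesis .
  qed
  ultimately show ?thesis by blast
qed

definition fin_gen :: "'a::comm_ring_1 msub \<Rightarrow> bool" where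
  "fin_gen A \<longleftrightarrow> (\<exists>gs. A = sum_list (map cyc gs))"

lemma gspan_append: "gspan t (xs @ ys) = gspan t xs + gspan t ys"
  by (simp add: gspan_def)

lemma gspan_Pair: "gspan t (map (Pair s) gs) = (if s = t then sum_list (map cyc gs) else 0)"
  by (induction gs) (auto simp: gspan_def)

text \<open>In the application \<open>F\<close> is the degree-one part of the polynomial ring with
  the variables as the \<open>t l\<close>, and \<open>Q\<close> is a power of the maximal ideal with
  \<open>Q * F \<le> M\<close>. It is \<open>Q\<close> that makes all lengths finite.\<close>

locale filtration =
  fixes M F Q :: "'a::comm_ring_1 msub" and t :: "nat \<Rightarrow> 'a mpoly" and r :: nat
  assumes fin_gen_M: "fin_gen M"
    and F: "F = (\<Sum>l<r. cyc (t l))"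
    and M_le: "M \<le> F"
    and Q_le: "Q \<le> 1" and Q_fin: "qlen 1 Q \<noteq> \<infinity>" and QF_le: "Q * F \<le> M"
begin

text \<open>Since \<open>F\<close> is the sum of the \<open>cyc (t l)\<close>, the step from
  \<open>M ^ Suc i * F ^ j\<close> to \<open>M ^ i * F ^ Suc j\<close> is made by adjoining the
  products with t 0, ..., t (r - 1) in turn. Each of these falls under
  \<open>hilbert_function_antitone\<close> with \<open>g0 = t l\<close>.\<close>

lemma graded_pieces_seppoly:
  "\<exists>H. seppoly (\<lambda>i j. of_nat (H i j)) \<and>
    (\<forall>i j. qlen (M ^ i * F ^ Suc j) (M ^ Suc i * F ^ j) = enat (H i j))"
proof -
  obtain ms where ms: "M = sum_list (map cyc ms)" using fin_gen_M by (auto simp: fin_gen_def)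
  define gs where "gs = map (Pair True) ms @ map (Pair False) (map t [0..<r])"
  have gM: "gspan True gs = M" by (simp only: gs_def gspan_append gspan_Pair ms) simp
  have gF: "gspan False gs = F"
    by (simp only: gs_def gspan_append gspan_Pair F) (simp add: interv_sum_list_conv_sum_set_nat lessThan_atLeast0)
  \<comment> \<open>The products with the first \<open>l\<close> generators have been adjoined.
    Multiplication by \<open>M\<close> or \<open>F\<close> carries this family to the neighbouring
    bidegree, as the Hilbert function argument requires.\<close>
  define U where "U = (\<lambda>l i j. M ^ Suc i * F ^ j + (\<Sum>l'<l. cyc (t l') * (M ^ i * F ^ j)))"
  have UM: "M * U l i j = U l (Suc i) j" for l i j
    by (simp only: U_def distrib_left sum_distrib_left power_Suc ac_simps)
  have UF: "F * U l i j = U l i (Suc j)" for l i j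
    by (simp only: U_def distrib_left sum_distrib_left power_Suc ac_simps)
  \<comment> \<open>The cyclic module generated by \<open>t l\<close> modulo \<open>M\<close> is
    killed by \<open>Q\<close>.\<close>
  have fin: "qlen (U l 0 0 + cyc (t l)) (U l 0 0) \<noteq> \<infinity>" if l: "l < r" for l
  proof -
    have "cyc (t l) * Q \<le> F * Q"
      unfolding F by (intro msub_mult_mono le_sum_msub[of _ l "\<lambda>l. cyc (t l)"] order_refl) (simp_all add: l)
    also have "\<dots> \<le> M" using QF_le by (simp add: mult.commute)
    also have "\<dots> \<le> U l 0 0" by (auto simp: U_def le_iff_add)
    finally have "cyc (t l) * Q \<le> U l 0 0" .
    from qlen_cyc_times_le[OF this Q_le] show ?thesis
      using Q_fin by (cases "qlen 1 Q") (auto dest: enat_ile)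
  qed
  have "\<exists>h. antitone (length gs) h \<and>
    (\<forall>i j. qlen (U l i j + cyc (t l) * (M ^ i * F ^ j)) (U l i j) = enat (\<Sum>a\<in>expts (map fst gs) i j. h a))"
    if "l < r" for l
    using hilbert_function_antitone[of gs "U l" "t l"] UM UF fin[OF that] by (simp add: gM gF)
  then obtain h where h: "\<And>l. l < r \<Longrightarrow> antitone (length gs) (h l)"
    "\<And>l i j. l < r \<Longrightarrow> qlen (U l i j + cyc (t l) * (M ^ i * F ^ j)) (U l i j) = enat (\<Sum>a\<in>expts (map fst gs) i j. h l a)"
    by metis
  define H where "H = (\<lambda>i j. \<Sum>l<r. \<Sum>a\<in>expts (map fst gs) i j. h l a)"
  have "seppoly (\<lambda>i j. of_nat (H i j))"
    unfolding H_def of_nat_sum[of _ "{..<r}"]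
    by (intro seppoly_sum seppoly_expts) (simp add: h)
  moreover have "qlen (M ^ i * F ^ Suc j) (M ^ Suc i * F ^ j) = enat (H i j)" for i j
  proof -
    have Suc: "U (Suc l) i j = U l i j + cyc (t l) * (M ^ i * F ^ j)" for l
      by (simp add: U_def ac_simps)
    have le: "M ^ Suc i * F ^ j \<le> M ^ i * F ^ Suc j"
      using msub_mult_mono[OF M_le order_refl, of "M ^ i * F ^ j"] by (simp add: ac_simps)
    have "U r i j = M ^ Suc i * F ^ j + F * (M ^ i * F ^ j)"
      by (simp only: U_def F[symmetric] sum_distrib_right[symmetric])
    also have "F * (M ^ i * F ^ j) = M ^ i * F ^ Suc j"
      by (simp only: power_Suc mult.left_commute)
    finally have r: "U r i j = M ^ i * F ^ Suc j"
      using msub_add_absorb[OF le] by (simp only:)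
    have "qlen (U r i j) (U 0 i j) = (\<Sum>l<r. qlen (U (Suc l) i j) (U l i j))"
      by (rule qlen_filtration) (auto simp: Suc le_iff_add)
    also have "\<dots> = (\<Sum>l<r. enat (\<Sum>a\<in>expts (map fst gs) i j. h l a))"
      by (intro sum.cong refl) (simp only: Suc h(2) lessThan_iff)
    finally show ?thesis by (simp only: r sum_enat H_def) (simp add: U_def)
  qed
  ultimately show ?thesis by blast
qed

text \<open>The factors \<open>M\<close> are replaced by \<open>F\<close> one at a time, through M^p
  F^q \<le> M^(p-1) F^(q+1) \<le> ... \<le> F^(p+q). Reversing the summation makes i the exponent of
  \<open>M\<close> in the larger module.\<close>

lemma qlen_power_eq_sum:
  "qlen (F ^ (p + q)) (M ^ p * F ^ q) =
    (\<Sum>i<p. qlen (M ^ i * F ^ Suc (p + q - Suc i)) (M ^ Suc i * F ^ (p + q - Suc i)))"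
proof -
  let ?K = "\<lambda>i. M ^ (p - i) * F ^ (q + i)"
  have "qlen (?K p) (?K 0) = (\<Sum>i<p. qlen (?K (Suc i)) (?K i))"
  proof (rule qlen_filtration)
    fix i assume "i < p"
    then have "p - i = Suc (p - Suc i)" by simp
    then have "?K i = M * (M ^ (p - Suc i) * F ^ (q + i))" by (simp only: power_Suc mult.assoc)
    also have "\<dots> \<le> F * (M ^ (p - Suc i) * F ^ (q + i))" by (intro msub_mult_mono M_le order_refl)
    also have "\<dots> = ?K (Suc i)" by (simp add: ac_simps)
    finally show "?K i \<le> ?K (Suc i)" .
  qed
  also have "\<dots> = (\<Sum>i<p. qlen (?K (Suc (p - Suc i))) (?K (p - Suc i)))"
    by (rule sum.nat_diff_reindex[symmetric])
  also have "\<dots> = (\<Sum>i<p. qlen (M ^ i * F ^ Suc (p + q - Suc i)) (M ^ Suc i * F ^ (p + q - Suc i)))"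
  proof (rule sum.cong)
    fix i assume "i \<in> {..<p}"
    then have *: "p - Suc (p - Suc i) = i" "q + Suc (p - Suc i) = Suc (p + q - Suc i)"
      "p - (p - Suc i) = Suc i" "q + (p - Suc i) = p + q - Suc i" by auto
    show "qlen (?K (Suc (p - Suc i))) (?K (p - Suc i)) =
      qlen (M ^ i * F ^ Suc (p + q - Suc i)) (M ^ Suc i * F ^ (p + q - Suc i))"
      by (simp only: *)
  qed simp
  finally show ?thesis by (simp add: add.commute)
qed

text \<open>The case q = 0 is a separate conclusion because \<open>evbipoly\<close> speaks only
  about large q; it provides the ordinary Buchsbaum-Rim function.\<close>

lemma qlen_power_polynomial:
  obtains L where "\<And>p q. qlen (F ^ (p + q)) (M ^ p * F ^ q) = enat (L p q)"
    "evbipoly (\<lambda>p q. of_nat (L p q))" "evpoly (\<lambda>p. of_nat (L p 0))"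
proof -
  obtain H where H: "seppoly (\<lambda>i j. of_nat (H i j))"
    "\<And>i j. qlen (M ^ i * F ^ Suc j) (M ^ Suc i * F ^ j) = enat (H i j)"
    using graded_pieces_seppoly by blast
  show thesis
  proof
    show "qlen (F ^ (p + q)) (M ^ p * F ^ q) = enat (\<Sum>i<p. H i (p + q - Suc i))" for p q
      by (simp only: qlen_power_eq_sum H(2) sum_enat)
    show "evbipoly (\<lambda>p q. of_nat (\<Sum>i<p. H i (p + q - Suc i)))"
      using seppoly_evbipoly[OF H(1)] by simp
    show "evpoly (\<lambda>p. of_nat (\<Sum>i<p. H i (p + 0 - Suc i)))"
      using seppoly_evpoly[OF H(1)] by simp
  qed
qed

end

section \<open>Monomial gradings\<close>

abbreviation lookup where "lookup \<equiv> Poly_Mapping.lookup"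
abbreviation keys where "keys \<equiv> Poly_Mapping.keys"
abbreviation single where "single \<equiv> Poly_Mapping.single"

lemma lookup_const_poly_mult: "lookup (const_poly c * f) e = c * lookup f e"
  unfolding const_poly_def mult_map_scale_conv_mult[symmetric] Poly_Mapping.map.rep_eq
  by (simp add: when_def)

lemma const_poly_mult_single: "const_poly c * single e b = single e (c * b)"
  by (simp add: const_poly_def mult_single)

lemma single_mult_const_poly: "single e b * const_poly c = single e (b * c)"
  by (simp add: const_poly_def mult_single)

definition Tm :: "(nat \<Rightarrow>\<^sub>0 nat) \<Rightarrow> 'a::comm_ring_1 msub" where
  "Tm e = cyc (single e 1)"

lemma set_of_Tm: "set_of (Tm e) = range (single e)"
  by (simp add: Tm_def set_of_cyc const_poly_mult_single)

lemma Tm_0: "Tm 0 = 1"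
  by (simp add: Tm_def)

lemma Tm_add: "Tm (e + e') = Tm e * Tm e'"
  by (simp add: Tm_def cyc_mult mult_single)

lemma Tm_power: "Tm e ^ n = Tm (of_nat n * e)"
  by (induction n) (simp_all add: Tm_0 distrib_right flip: Tm_add)

lemma Tm_sum: "(\<Prod>x\<in>X. Tm (f x)) = Tm (\<Sum>x\<in>X. f x)"
  by (induction X rule: infinite_finite_induct) (simp_all add: Tm_0 Tm_add)

lemma le_one_const: "A \<le> 1 \<Longrightarrow> f \<in> set_of A \<Longrightarrow> \<exists>c. f = const_poly c"
  by (auto simp: less_eq_msub_def set_of_1)

lemma in_Tm_times:
  assumes "A \<le> 1" "f \<in> set_of (Tm e * A)"
  shows "\<exists>c. f = single e c \<and> const_poly c \<in> set_of A"
proof -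
  obtain a where a: "f = single e 1 * a" "a \<in> set_of A"
    using assms(2) by (auto simp: Tm_def set_of_cyc_times)
  then obtain c where "a = const_poly c" using le_one_const[OF assms(1)] by blast
  then show ?thesis using a by (auto simp: single_mult_const_poly)
qed

lemma poly_mapping_eq_sum_singles: "(\<Sum>e\<in>keys f. single e (lookup f e)) = f"
proof (rule poly_mapping_eqI)
  fix k
  have "lookup (\<Sum>e\<in>keys f. single e (lookup f e)) k = (\<Sum>e\<in>keys f. if e = k then lookup f e else 0)"
    by (simp add: lookup_sum lookup_single when_def)
  also have "\<dots> = lookup f k" by (simp add: in_keys_iff)
  finally show "lookup (\<Sum>e\<in>keys f. single e (lookup f e)) k = lookup f k" .
qed

lemma is_submodule_keys: "is_submodule {f. keys f \<subseteq> E}"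
proof (rule is_submoduleI)
  fix c and f :: "'a mpoly" assume "f \<in> {f. keys f \<subseteq> E}"
  then show "const_poly c * f \<in> {f. keys f \<subseteq> E}"
    by (force simp: in_keys_iff lookup_const_poly_mult)
qed (auto dest!: subsetD[OF keys_add])

lemma set_of_sum_Tm:
  assumes "finite E"
  shows "set_of (\<Sum>e\<in>E. Tm e) = {f. keys f \<subseteq> E}"
proof
  have "(\<Sum>e\<in>E. Tm e) \<le> Abs_msub {f :: 'a mpoly. keys f \<subseteq> E}"
    unfolding sum_le_msub_iff[OF assms]
    by (auto simp: less_eq_msub_def is_submodule_keys set_of_Tm split: if_splits)
  then show "set_of (\<Sum>e\<in>E. Tm e) \<subseteq> {f :: 'a mpoly. keys f \<subseteq> E}"
    by (simp add: less_eq_msub_def is_submodule_keys)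
  show "{f :: 'a mpoly. keys f \<subseteq> E} \<subseteq> set_of (\<Sum>e\<in>E. Tm e)"
  proof
    fix f :: "'a mpoly" assume "f \<in> {f. keys f \<subseteq> E}"
    then have f: "keys f \<subseteq> E" by simp
    have "(\<Sum>e\<in>keys f. single e (lookup f e)) \<in> set_of (\<Sum>e\<in>E. Tm e)"
    proof (rule set_of_sum)
      fix e assume "e \<in> keys f"
      then have "Tm e \<le> (\<Sum>e\<in>E. Tm e :: 'a msub)" using assms f by (intro le_sum_msub) auto
      then show "single e (lookup f e) \<in> set_of (\<Sum>e\<in>E. Tm e)"
        by (auto simp: less_eq_msub_def set_of_Tm)
    qed
    then show "f \<in> set_of (\<Sum>e\<in>E. Tm e)" by (simp only: poly_mapping_eq_sum_singles)
  qed
qed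

text \<open>Multiplication by the monomial in one direction and extraction of its coefficient in the
  other induce surjections between R/J and R t^e / J t^e.\<close>

lemma qlen_Tm_times:
  assumes "J \<le> 1"
  shows "qlen (Tm e) (Tm e * J) = qlen 1 J"
proof (rule order_antisym)
  have "Tm e * J \<le> Tm e * 1" by (intro msub_mult_mono order_refl assms)
  then have le: "Tm e * J \<le> Tm e" by simp
  show "qlen (Tm e) (Tm e * J) \<le> qlen 1 J"
    using qlen_cyc_times_le[OF order_refl assms, of "single e 1"] msub_add_absorb[OF le]
    by (simp add: Tm_def)
  show "qlen 1 J \<le> qlen (Tm e) (Tm e * J)"
  proof (rule qlen_image_le[where \<phi> = "\<lambda>f. const_poly (lookup f e)"])
    fix g :: "'a mpoly" assume "g \<in> set_of 1"
    then obtain c where c: "g = const_poly c" by (auto simp: set_of_1)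
    have "g = const_poly (lookup (single e c) e) + 0" by (simp add: c)
    then show "\<exists>f\<in>set_of (Tm e). \<exists>l\<in>set_of J. g = const_poly (lookup f e) + l"
      using zero_in_set_of[of J] unfolding set_of_Tm by blast
  next
    fix f assume "f \<in> set_of (Tm e * J)"
    then obtain c where "f = single e c" "const_poly c \<in> set_of J"
      using in_Tm_times[OF assms] by blast
    then show "const_poly (lookup f e) \<in> set_of J" by simp
  qed (simp_all add: le lookup_add const_poly_add lookup_const_poly_mult const_poly_mult)
qed

lemma Tm_times_le: "J \<le> 1 \<Longrightarrow> Tm e * J \<le> Tm e"
  using msub_mult_mono[of "Tm e" "Tm e" J 1] by simp

lemma inf_sum_Tm:
  assumes "finite E" "e \<notin> E"
  shows "inf (\<Sum>e\<in>E. Tm e) (Tm e) = (0 :: 'a::comm_ring_1 msub)"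
proof -
  have "f = 0" if f: "f \<in> set_of (\<Sum>e\<in>E. Tm e)" "f \<in> set_of (Tm e)" for f :: "'a mpoly"
  proof -
    obtain c where c: "f = single e c" using f(2) by (auto simp: set_of_Tm)
    have "lookup f e = 0"
      using f(1) assms by (auto simp: set_of_sum_Tm in_keys_iff)
    then show ?thesis using c by simp
  qed
  then have "inf (\<Sum>e\<in>E. Tm e) (Tm e) \<le> (0 :: 'a msub)"
    unfolding less_eq_msub_def set_of_inf set_of_0 by blast
  then show ?thesis by simp
qed

text \<open>Distinct monomials span submodules with zero intersection, so
  \<open>qlen_plus_eq\<close> splits off one monomial component at a time.\<close>

lemma qlen_graded:
  assumes "finite E" "\<And>e. e \<in> E \<Longrightarrow> J e \<le> 1"
  shows "qlen (\<Sum>e\<in>E. Tm e) (\<Sum>e\<in>E. Tm e * J e) = (\<Sum>e\<in>E. qlen 1 (J e))"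
  using assms
proof (induction E rule: finite_induct)
  case (insert e E)
  let ?A = "\<Sum>e\<in>E. Tm e" and ?B = "\<Sum>e\<in>E. Tm e * J e"
  have BA: "?B \<le> ?A" using insert.prems by (intro sum_mono Tm_times_le) auto
  have J: "Tm e * J e \<le> Tm e" using insert.prems by (intro Tm_times_le) auto
  have "qlen (Tm e + ?A) (Tm e * J e + ?B) = qlen (Tm e + ?A) (Tm e * J e + ?A) + qlen (Tm e * J e + ?A) (Tm e * J e + ?B)"
    by (intro qlen_add add_mono J BA order_refl)
  also have "qlen (Tm e * J e + ?A) (Tm e * J e + ?B) = qlen ?A ?B"
  proof (rule qlen_plus_eq[OF BA])
    have "inf (Tm e * J e) ?A \<le> inf ?A (Tm e)" using J by (auto intro: le_infI1)
    also have "\<dots> = 0" using insert.hyps by (rule inf_sum_Tm)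
    finally show "inf (Tm e * J e) ?A \<le> ?B" by (simp add: order_trans)
  qed
  also have "qlen (Tm e + ?A) (Tm e * J e + ?A) = qlen (?A + Tm e) (?A + Tm e * J e)"
    by (simp only: add.commute)
  also have "\<dots> = qlen (Tm e) (Tm e * J e)"
    by (intro qlen_plus_eq[OF J]) (simp add: inf_sum_Tm[OF insert.hyps])
  finally show ?case using insert by (simp add: qlen_Tm_times)
qed simp

text \<open>Exponent vectors of the monomials of degree \<open>p\<close>. An arbitrary set of
  variables permits induction on the variables and the removal of a single index.\<close>

definition exps :: "nat set \<Rightarrow> nat \<Rightarrow> (nat \<Rightarrow>\<^sub>0 nat) set" where
  "exps X p = {e. keys e \<subseteq> X \<and> (\<Sum>i\<in>X. lookup e i) = p}"

lemma exps_empty: "exps {} p = (if p = 0 then {0} else {})"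
  by (auto simp: exps_def)

lemma exps_insert:
  assumes "finite X" "i \<notin> X"
  shows "exps (insert i X) p = (\<Union>k\<le>p. (\<lambda>e. single i k + e) ` exps X (p - k))"
proof (intro equalityI subsetI)
  fix e assume e: "e \<in> exps (insert i X) p"
  define e' where "e' = e - single i (lookup e i)"
  have e': "lookup e' j = (if j = i then 0 else lookup e j)" for j
    by (simp add: e'_def lookup_minus lookup_single when_def)
  have eq: "e = single i (lookup e i) + e'"
    by (rule poly_mapping_eqI) (simp add: lookup_add e' lookup_single when_def)
  have "keys e' \<subseteq> X"
  proof
    fix x assume "x \<in> keys e'"
    then have "x \<noteq> i" "x \<in> keys e" by (auto simp: in_keys_iff e' split: if_splits)
    then show "x \<in> X" using e by (auto simp: exps_def)
  qed
  moreover have "(\<Sum>j\<in>X. lookup e' j) = (\<Sum>j\<in>X. lookup e j)"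
    using assms by (intro sum.cong) (auto simp: e')
  ultimately have "e' \<in> exps X (p - lookup e i)" "lookup e i \<le> p"
    using e assms by (auto simp: exps_def)
  then show "e \<in> (\<Union>k\<le>p. (\<lambda>e. single i k + e) ` exps X (p - k))"
    using eq by blast
next
  fix e assume "e \<in> (\<Union>k\<le>p. (\<lambda>e. single i k + e) ` exps X (p - k))"
  then obtain k e' where k: "k \<le> p" "e = single i k + e'" "e' \<in> exps X (p - k)" by blast
  have "lookup e' i = 0" using k(3) assms by (auto simp: exps_def in_keys_iff)
  moreover have "(\<Sum>j\<in>X. lookup (single i k + e') j) = (\<Sum>j\<in>X. lookup e' j)"
    using assms by (intro sum.cong) (auto simp: lookup_add lookup_single when_def)
  moreover have "keys e \<subseteq> insert i X"
    using k keys_add[of "single i k" e'] by (auto simp: exps_def split: if_splits)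
  ultimately show "e \<in> exps (insert i X) p"
    using k assms by (auto simp: exps_def lookup_add)
qed

lemma finite_exps [simp]: "finite X \<Longrightarrow> finite (exps X p)"
proof (induction X arbitrary: p rule: finite_induct)
  case (insert i X)
  then show ?case by (simp add: exps_insert)
qed (simp add: exps_empty)

lemma sum_exps_insert:
  fixes h :: "_ \<Rightarrow> 'b::comm_monoid_add"
  assumes "finite X" "i \<notin> X"
  shows "(\<Sum>e\<in>exps (insert i X) p. h e) = (\<Sum>k\<le>p. \<Sum>e\<in>exps X (p - k). h (single i k + e))"
proof -
  have *: "lookup (single i k + e) i = k" if "e \<in> exps X n" for e k n
    using that assms by (auto simp: exps_def lookup_add in_keys_iff)
  have "(\<lambda>e. single i k + e) ` exps X (p - k) \<inter> (\<lambda>e. single i l + e) ` exps X (p - l) = {}"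
    if "k \<noteq> l" for k l
  proof (rule equals0I)
    fix x assume "x \<in> (\<lambda>e. single i k + e) ` exps X (p - k) \<inter> (\<lambda>e. single i l + e) ` exps X (p - l)"
    then obtain e e' where "x = single i k + e" "e \<in> exps X (p - k)" "x = single i l + e'" "e' \<in> exps X (p - l)"
      by blast
    then have "lookup x i = k" "lookup x i = l" by (metis *)+
    then show False using that by simp
  qed
  then show ?thesis
    unfolding exps_insert[OF assms] using assms
    by (subst sum.UNION_disjoint) (auto simp: sum.reindex)
qed

definition expow :: "nat set \<Rightarrow> (nat \<Rightarrow> 'b::comm_monoid_mult) \<Rightarrow> (nat \<Rightarrow>\<^sub>0 nat) \<Rightarrow> 'b" where
  "expow X A e = (\<Prod>i\<in>X. A i ^ lookup e i)"

lemma expow_add: "expow X A (e + e') = expow X A e * expow X A e'"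
  by (simp add: expow_def lookup_add power_add prod.distrib)

lemma expow_insert_add:
  assumes "finite X" "i \<notin> X" "e \<in> exps X n"
  shows "expow (insert i X) A (single i k + e) = A i ^ k * expow X A e"
proof -
  have "lookup e i = 0" using assms by (auto simp: exps_def in_keys_iff)
  moreover have "expow X A (single i k + e) = expow X A e"
    unfolding expow_def using assms(2)
    by (intro prod.cong refl) (auto simp: lookup_add lookup_single when_def)
  ultimately show ?thesis using assms by (simp add: expow_def lookup_add)
qed

lemma msub_multinomial:
  "finite X \<Longrightarrow> (\<Sum>i\<in>X. A i) ^ p = (\<Sum>e\<in>exps X p. expow X A e)" for A :: "nat \<Rightarrow> 'a::comm_ring_1 msub"
proof (induction X arbitrary: p rule: finite_induct)
  case empty
  then show ?case by (auto simp: exps_empty expow_def power_0_left)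
next
  case (insert i X)
  have "(\<Sum>e\<in>exps (insert i X) p. expow (insert i X) A e) =
    (\<Sum>k\<le>p. \<Sum>e\<in>exps X (p - k). expow (insert i X) A (single i k + e))"
    using insert.hyps by (rule sum_exps_insert)
  also have "\<dots> = (\<Sum>k\<le>p. \<Sum>e\<in>exps X (p - k). A i ^ k * expow X A e)"
    using insert.hyps by (intro sum.cong refl expow_insert_add)
  also have "\<dots> = (\<Sum>k\<le>p. A i ^ k * (\<Sum>i\<in>X. A i) ^ (p - k))"
    by (simp only: insert.IH sum_distrib_left)
  finally show ?case using insert.hyps by (simp add: msub_binomial)
qed

lemma expow_le_one: "(\<And>i. i \<in> X \<Longrightarrow> A i \<le> 1) \<Longrightarrow> expow X A e \<le> 1" for A :: "nat \<Rightarrow> 'a::comm_ring_1 msub"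
proof (induction X rule: infinite_finite_induct)
  case (insert i X)
  have "A i ^ lookup e i \<le> 1" using msub_power_mono[of "A i" 1 "lookup e i"] insert.prems by simp
  then have "A i ^ lookup e i * expow X A e \<le> 1 * 1" using insert by (intro msub_mult_mono) auto
  then show ?case using insert by (simp add: expow_def)
qed (simp_all add: expow_def)

lemma expow_Tm:
  assumes "finite X" "keys e \<subseteq> X"
  shows "expow X (\<lambda>i. Tm (single i 1)) e = Tm e"
proof -
  have "(\<Sum>i\<in>X. of_nat (lookup e i) * single i 1) = e"
  proof (rule poly_mapping_eqI)
    fix j
    have *: "of_nat n * single i (Suc 0) = single i n" for i n :: nat
      by (induction n) (simp_all add: distrib_right single_add[symmetric])
    show "lookup (\<Sum>i\<in>X. of_nat (lookup e i) * single i 1) j = lookup e j"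
      using assms by (auto simp: * lookup_sum lookup_single when_def in_keys_iff)
  qed
  then show ?thesis by (simp add: expow_def Tm_power Tm_sum)
qed

lemma expow_mult: "expow X (\<lambda>i. A i * B i) e = expow X A e * expow X B e"
  by (simp add: expow_def power_mult_distrib prod.distrib)

section \<open>The free module, the relation module and their powers\<close>

definition free_mod :: "nat \<Rightarrow> 'a::comm_ring_1 msub" where
  "free_mod r = (\<Sum>i<r. Tm (single i 1))"

definition ker_mod :: "nat \<Rightarrow> (nat \<Rightarrow> 'a::comm_ring_1 msub) \<Rightarrow> 'a msub" where
  "ker_mod r A = (\<Sum>i<r. Tm (single i 1) * A i)"

lemma exps_keys: "e \<in> exps X p \<Longrightarrow> keys e \<subseteq> X"
  by (simp add: exps_def)

lemma ker_mod_power: "ker_mod r A ^ p = (\<Sum>e\<in>exps {..<r} p. Tm e * expow {..<r} A e)"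
  unfolding ker_mod_def msub_multinomial[OF finite_lessThan] expow_mult
  by (intro sum.cong refl) (simp only: expow_Tm[OF finite_lessThan exps_keys])

lemma free_mod_eq: "free_mod r = ker_mod r (\<lambda>_. 1)"
  by (simp add: free_mod_def ker_mod_def)

lemma free_mod_power: "free_mod r ^ p = (\<Sum>e\<in>exps {..<r} p. Tm e)"
  by (simp add: free_mod_eq ker_mod_power expow_def)

lemma sym_comp_eq: "sym_comp r p = set_of (free_mod r ^ p)"
  unfolding free_mod_power set_of_sum_Tm[OF finite_exps[OF finite_lessThan]]
  by (auto simp: sym_comp_def exps_def)

text \<open>The ideal J(p, e) of the overview: a degree-\<open>p\<close> vector \<open>a\<close>
  contributes exactly when the monomial of \<open>a\<close> divides that of \<open>e\<close>. The
  dependence on q is hidden in the degree of \<open>e\<close>.\<close>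

definition trunc_sum :: "nat \<Rightarrow> (nat \<Rightarrow> 'a::comm_ring_1 msub) \<Rightarrow> nat \<Rightarrow> (nat \<Rightarrow>\<^sub>0 nat) \<Rightarrow> 'a msub" where
  "trunc_sum r A p e = (\<Sum>a\<in>{a\<in>exps {..<r} p. \<forall>i. lookup a i \<le> lookup e i}. expow {..<r} A a)"

lemma exps_add: "a \<in> exps X p \<Longrightarrow> b \<in> exps X q \<Longrightarrow> a + b \<in> exps X (p + q)"
  using keys_add[of a b] by (auto simp: exps_def lookup_add sum.distrib)

text \<open>The monomial of \<open>e\<close> arises as that of \<open>a\<close> from the power of M
  times that of \<open>e - a\<close> from the power of F, and only the former brings a coefficient
  ideal.\<close>

lemma ker_mod_free_mod_power:
  "ker_mod r A ^ p * free_mod r ^ q = (\<Sum>e\<in>exps {..<r} (p + q). Tm e * trunc_sum r A p e)"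
proof (rule order_antisym)
  let ?R = "\<Sum>e\<in>exps {..<r} (p + q). Tm e * trunc_sum r A p e"
  have "Tm a * expow {..<r} A a * Tm b \<le> ?R" if a: "a \<in> exps {..<r} p" and b: "b \<in> exps {..<r} q" for a b
  proof -
    have "Tm a * expow {..<r} A a * Tm b = Tm (a + b) * expow {..<r} A a"
      by (simp add: Tm_add ac_simps)
    also have "\<dots> \<le> Tm (a + b) * trunc_sum r A p (a + b)"
      unfolding trunc_sum_def using a
      by (intro msub_mult_mono order_refl le_sum_msub) (auto simp: lookup_add)
    also have "\<dots> \<le> ?R"
      by (rule le_sum_msub[where f = "\<lambda>e. Tm e * trunc_sum r A p e"]) (use exps_add[OF a b] in auto)
    finally show ?thesis .
  qed
  then show "ker_mod r A ^ p * free_mod r ^ q \<le> ?R"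
    unfolding ker_mod_power free_mod_power sum_product by (simp add: sum_le_msub_iff)
next
  show "(\<Sum>e\<in>exps {..<r} (p + q). Tm e * trunc_sum r A p e) \<le> ker_mod r A ^ p * free_mod r ^ q"
    unfolding sum_le_msub_iff[OF finite_exps[OF finite_lessThan]]
  proof
    fix e assume e: "e \<in> exps {..<r} (p + q)"
    have "Tm e * expow {..<r} A a \<le> ker_mod r A ^ p * free_mod r ^ q"
      if a: "a \<in> exps {..<r} p" "\<forall>i. lookup a i \<le> lookup e i" for a
    proof -
      have eq: "e = a + (e - a)"
        using a(2) by (intro poly_mapping_eqI) (simp add: lookup_add lookup_minus)
      have "(\<Sum>i<r. lookup a i) + (\<Sum>i<r. lookup (e - a) i) = p + q"
        using e by (subst (asm) eq) (simp add: exps_def lookup_add sum.distrib)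
      then have "(\<Sum>i<r. lookup (e - a) i) = q" using a by (simp add: exps_def)
      moreover have "keys (e - a) \<subseteq> keys e" by (auto simp: in_keys_iff lookup_minus)
      ultimately have b: "e - a \<in> exps {..<r} q" using e by (auto simp: exps_def)
      have "Tm e * expow {..<r} A a = Tm a * expow {..<r} A a * Tm (e - a)"
        by (subst eq) (simp add: Tm_add ac_simps)
      also have "\<dots> \<le> ker_mod r A ^ p * free_mod r ^ q"
        unfolding ker_mod_power free_mod_power
        by (intro msub_mult_mono le_sum_msub[where f = "\<lambda>a. Tm a * expow {..<r} A a"]
            le_sum_msub[where f = Tm] finite_exps finite_lessThan a b)
      finally show ?thesis .
    qed
    then show "Tm e * trunc_sum r A p e \<le> ker_mod r A ^ p * free_mod r ^ q"
      unfolding trunc_sum_def sum_distrib_left by (subst sum_le_msub_iff) auto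
  qed
qed

lemma trunc_sum_le_one: "(\<And>i. i < r \<Longrightarrow> A i \<le> 1) \<Longrightarrow> trunc_sum r A p e \<le> 1"
  unfolding trunc_sum_def by (subst sum_le_msub_iff) (auto intro: expow_le_one)

lemma qlen_ker_mod_free_mod:
  assumes "\<And>i. i < r \<Longrightarrow> A i \<le> 1"
  shows "qlen (free_mod r ^ (p + q)) (ker_mod r A ^ p * free_mod r ^ q) =
    (\<Sum>e\<in>exps {..<r} (p + q). qlen 1 (trunc_sum r A p e))"
  unfolding ker_mod_free_mod_power
  unfolding free_mod_power
  by (rule qlen_graded) (auto intro: trunc_sum_le_one assms)

lemma qlen_ker_mod_power:
  assumes "\<And>i. i < r \<Longrightarrow> A i \<le> 1"
  shows "qlen (free_mod r ^ p) (ker_mod r A ^ p) = (\<Sum>e\<in>exps {..<r} p. qlen 1 (expow {..<r} A e))"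
  unfolding ker_mod_power free_mod_power
  by (rule qlen_graded) (auto intro: expow_le_one assms)

lemma ker_mod_le_free_mod: "(\<And>i. i < r \<Longrightarrow> A i \<le> 1) \<Longrightarrow> ker_mod r A \<le> free_mod r"
  unfolding ker_mod_def free_mod_def by (intro sum_mono Tm_times_le) auto

section \<open>Components of the Rees algebra\<close>

lemma is_submodule_component:
  "is_submodule {f. \<forall>e\<in>E. single e (lookup f e) \<in> set_of (N e)}"
  by (rule is_submoduleI)
    (auto simp: lookup_add single_add set_of_add lookup_const_poly_mult simp flip: const_poly_mult_single
      intro: set_of_scale)

lemma rees_alg_subset_powers:
  assumes "f \<in> rees_alg (set_of M)"
  shows "\<exists>n. f \<in> set_of (\<Sum>k<n. M ^ k)"
  using assms
proof induction
  case (const c)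
  show ?case by (rule exI[of _ 1]) (simp add: set_of_1)
next
  case (gen f)
  have "M ^ 1 \<le> (\<Sum>k<2. M ^ k)" by (rule le_sum_msub) auto
  then show ?case using gen by (intro exI[of _ 2]) (auto simp: less_eq_msub_def)
next
  case (add f g)
  then obtain n m where nm: "f \<in> set_of (\<Sum>k<n. M ^ k)" "g \<in> set_of (\<Sum>k<m. M ^ k)" by blast
  have "(\<Sum>k<n. M ^ k) \<le> (\<Sum>k<n+m. M ^ k)" "(\<Sum>k<m. M ^ k) \<le> (\<Sum>k<n+m. M ^ k)"
    by (auto simp: sum_le_msub_iff intro!: le_sum_msub)
  then show ?case using nm by (intro exI[of _ "n + m"] set_of_add) (auto simp: less_eq_msub_def)
next
  case (mult f g)
  then obtain n m where nm: "f \<in> set_of (\<Sum>k<n. M ^ k)" "g \<in> set_of (\<Sum>k<m. M ^ k)" by blast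
  have "M ^ i * M ^ j \<le> (\<Sum>k<n+m. M ^ k)" if "i < n" "j < m" for i j
    unfolding power_add[symmetric] using that by (intro le_sum_msub) auto
  then have "(\<Sum>k<n. M ^ k) * (\<Sum>k<m. M ^ k) \<le> (\<Sum>k<n+m. M ^ k)"
    unfolding sum_product by (simp add: sum_le_msub_iff)
  then show ?case using times_in_set_of[OF nm] by (auto simp: less_eq_msub_def)
qed

lemma powers_subset_rees_alg: "set_of (M ^ p) \<subseteq> rees_alg (set_of M)"
proof -
  have zero: "0 \<in> rees_alg (set_of M)" using rees_alg.const[of 0] by simp
  have sub: "is_submodule (rees_alg (set_of M))"
    by (rule is_submoduleI) (auto intro: zero rees_alg.intros)
  have "M ^ p \<le> Abs_msub (rees_alg (set_of M))"
  proof (induction p)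
    case 0
    show ?case by (auto simp: less_eq_msub_def sub set_of_1 intro: rees_alg.const)
  next
    case (Suc p)
    then show ?case
      unfolding power_Suc times_le_iff
      by (auto simp: less_eq_msub_def sub intro: rees_alg.gen rees_alg.mult)
  qed
  then show ?thesis by (simp add: less_eq_msub_def sub)
qed

text \<open>Elements of the Rees algebra need not be homogeneous, but they lie in finite sums of
  powers of M. These powers are spanned by monomial components, so the degree-p components of such
  an element lie in M^p.\<close>

lemma rees_comp_eq:
  assumes A: "\<And>i. i < r \<Longrightarrow> A i \<le> 1"
  shows "rees_comp r (set_of (ker_mod r A)) p = set_of (ker_mod r A ^ p)"
proof
  let ?M = "ker_mod r A"
  have "?M ^ p \<le> free_mod r ^ p" by (intro msub_power_mono ker_mod_le_free_mod A)
  then show "set_of (?M ^ p) \<subseteq> rees_comp r (set_of ?M) p"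
    unfolding rees_comp_def sym_comp_eq using powers_subset_rees_alg by (auto simp: less_eq_msub_def)
  \<comment> \<open>All polynomials whose components of degree \<open>p\<close> lie in
    \<open>?M ^ p\<close>. This submodule contains every power of \<open>?M\<close>: the power of
    exponent \<open>p\<close> by definition, the others because they have no such
    components.\<close>
  let ?X = "{f. \<forall>e\<in>exps {..<r} p. single e (lookup f e) \<in> set_of (?M ^ p)}"
  have sub: "is_submodule ?X" by (rule is_submodule_component)
  have "?M ^ k \<le> Abs_msub ?X" for k
    unfolding ker_mod_power[of r A k] sum_le_msub_iff[OF finite_exps[OF finite_lessThan]]
    unfolding less_eq_msub_def set_of_Abs[OF sub]
  proof (intro ballI subsetI CollectI)
    fix e f e'
    assume e: "e \<in> exps {..<r} k" and f: "f \<in> set_of (Tm e * expow {..<r} A e)" and e': "e' \<in> exps {..<r} p"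
    obtain c where c: "f = single e c" using in_Tm_times[OF _ f] A expow_le_one by blast
    show "single e' (lookup f e') \<in> set_of (?M ^ p)"
    proof (cases "e = e'")
      case True
      then have "k = p" using e e' by (simp add: exps_def)
      have "Tm e * expow {..<r} A e \<le> ?M ^ p"
        unfolding ker_mod_power using e by (intro le_sum_msub) (auto simp: \<open>k = p\<close>)
      then show ?thesis using f True c by (auto simp: less_eq_msub_def)
    qed (simp add: c lookup_single_not_eq)
  qed
  then have le: "(\<Sum>k<n. ?M ^ k) \<le> Abs_msub ?X" for n by (simp add: sum_le_msub_iff)
  show "rees_comp r (set_of ?M) p \<subseteq> set_of (?M ^ p)"
  proof
    fix f assume f: "f \<in> rees_comp r (set_of ?M) p"
    then obtain n where "f \<in> set_of (\<Sum>k<n. ?M ^ k)"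
      using rees_alg_subset_powers by (auto simp: rees_comp_def)
    then have X: "f \<in> ?X" using le[of n] by (auto simp: less_eq_msub_def set_of_Abs[OF sub])
    have "keys f \<subseteq> exps {..<r} p"
      using f by (auto simp: rees_comp_def sym_comp_def exps_def)
    then have "(\<Sum>e\<in>keys f. single e (lookup f e)) \<in> set_of (?M ^ p)"
      using X by (intro set_of_sum) auto
    then show "f \<in> set_of (?M ^ p)" by (simp only: poly_mapping_eq_sum_singles)
  qed
qed

section \<open>Ideals of R and kernels for sums of cyclic modules\<close>

definition ideal_mod :: "'a::comm_ring_1 set \<Rightarrow> 'a msub" where
  "ideal_mod J = Abs_msub (const_poly ` J)"

lemma set_of_ideal_mod: "is_ideal J \<Longrightarrow> set_of (ideal_mod J) = const_poly ` J"
proof -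
  assume J: "is_ideal J"
  have "is_submodule (const_poly ` J)"
  proof (rule is_submoduleI)
    show "0 \<in> const_poly ` J" using ring_mod.subspace_0[OF J] by (intro image_eqI[of _ _ 0]) simp_all
  next
    fix f g assume "f \<in> const_poly ` J" "g \<in> const_poly ` J"
    then obtain a b where "f = const_poly a" "g = const_poly b" "a \<in> J" "b \<in> J" by blast
    then show "f + g \<in> const_poly ` J"
      using ring_mod.subspace_add[OF J] by (intro image_eqI[of _ _ "a + b"]) (simp_all add: const_poly_add)
  next
    fix c f assume "f \<in> const_poly ` J"
    then obtain a where "f = const_poly a" "a \<in> J" by blast
    then show "const_poly c * f \<in> const_poly ` J"
      using ring_mod.subspace_scale[OF J] by (intro image_eqI[of _ _ "c * a"]) (simp_all add: const_poly_mult)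
  qed
  then show ?thesis unfolding ideal_mod_def by (rule set_of_Abs)
qed

lemma ideal_mod_le_one: "is_ideal J \<Longrightarrow> ideal_mod J \<le> 1"
  by (auto simp: less_eq_msub_def set_of_ideal_mod set_of_1)

lemma cyclic_sum_ker_eq:
  assumes "\<And>i. i < length Js \<Longrightarrow> is_ideal (Js ! i)"
  shows "cyclic_sum_ker Js = set_of (ker_mod (length Js) (\<lambda>i. ideal_mod (Js ! i)))"
  unfolding cyclic_sum_ker_def ker_mod_def set_of_sum_msub
  using assms
  by (intro sum.cong refl)
    (auto simp: Tm_def set_of_cyc_times set_of_ideal_mod image_image single_mult_const_poly)

lemma br_fun2_eq:
  assumes "\<And>i. i < length Js \<Longrightarrow> is_ideal (Js ! i)"
  defines "A \<equiv> \<lambda>i. ideal_mod (Js ! i)" and "r \<equiv> length Js"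
  shows "br_fun2 r (cyclic_sum_ker Js) p q = qlen (free_mod r ^ (p + q)) (ker_mod r A ^ p * free_mod r ^ q)"
proof -
  have ker: "cyclic_sum_ker Js = set_of (ker_mod r A)"
    unfolding A_def r_def by (rule cyclic_sum_ker_eq) (rule assms(1))
  have "A i \<le> 1" if "i < r" for i
    using that assms(1) by (simp add: A_def r_def ideal_mod_le_one)
  then have "rees_comp r (cyclic_sum_ker Js) p = set_of (ker_mod r A ^ p)"
    unfolding ker by (rule rees_comp_eq)
  then show ?thesis
    by (simp only: br_fun2_def sym_comp_eq quot_length_set_of flip: set_of_times)
qed

lemma br_fun_eq:
  assumes "\<And>i. i < length Js \<Longrightarrow> is_ideal (Js ! i)"
  defines "A \<equiv> \<lambda>i. ideal_mod (Js ! i)" and "r \<equiv> length Js"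
  shows "br_fun r (cyclic_sum_ker Js) p = qlen (free_mod r ^ p) (ker_mod r A ^ p)"
proof -
  have ker: "cyclic_sum_ker Js = set_of (ker_mod r A)"
    unfolding A_def r_def by (rule cyclic_sum_ker_eq) (rule assms(1))
  have "A i \<le> 1" if "i < r" for i
    using that assms(1) by (simp add: A_def r_def ideal_mod_le_one)
  then have "rees_comp r (cyclic_sum_ker Js) p = set_of (ker_mod r A ^ p)"
    unfolding ker by (rule rees_comp_eq)
  then show ?thesis
    by (simp only: br_fun_def sym_comp_eq quot_length_set_of flip: set_of_times)
qed

section \<open>The coefficient ideals with at most one small entry\<close>

lemma expow_le_power:
  fixes A :: "nat \<Rightarrow> 'a::comm_ring_1 msub"
  assumes "finite X" "\<And>i. i \<in> X \<Longrightarrow> A i \<le> N"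
  shows "expow X A e \<le> N ^ (\<Sum>i\<in>X. lookup e i)"
  using assms
proof (induction X rule: finite_induct)
  case (insert i X)
  then show ?case
    by (auto simp: expow_def power_add intro!: msub_mult_mono msub_power_mono)
qed (simp add: expow_def)

text \<open>The entries of a degree-\<open>p\<close> vector are at most \<open>p\<close>, so the
  truncation excludes nothing and the multinomial expansion is complete.\<close>

lemma trunc_sum_all_large:
  assumes "\<And>i. i < r \<Longrightarrow> p \<le> lookup e i"
  shows "trunc_sum r A p e = (\<Sum>i<r. A i) ^ p"
proof -
  have "lookup a i \<le> lookup e i" if a: "a \<in> exps {..<r} p" for a i
  proof (cases "i < r")
    case True
    have "lookup a i \<le> (\<Sum>i<r. lookup a i)" using True by (intro member_le_sum) auto
    then show ?thesis using assms[OF True] a by (simp add: exps_def)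
  next
    case False
    then have "lookup a i = 0" using a by (auto simp: exps_def in_keys_iff)
    then show ?thesis by simp
  qed
  then have "{a\<in>exps {..<r} p. \<forall>i. lookup a i \<le> lookup e i} = exps {..<r} p" by blast
  then show ?thesis by (simp add: trunc_sum_def msub_multinomial)
qed

text \<open>The truncation only restricts the exponent of \<open>A j\<close> to at most
  \<open>c\<close>. So at least \<open>p - c\<close> factors come from the other ideals, and the
  remaining \<open>c\<close> may come from any.\<close>

lemma trunc_sum_one_small:
  assumes j: "j < r" and c: "lookup e j = c" "c \<le> p"
    and large: "\<And>i. i < r \<Longrightarrow> i \<noteq> j \<Longrightarrow> p \<le> lookup e i"
  shows "trunc_sum r A p e = (\<Sum>i\<in>{..<r} - {j}. A i) ^ (p - c) * (\<Sum>i<r. A i) ^ c"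
proof (rule order_antisym)
  let ?X = "{..<r} - {j}"
  let ?N = "\<Sum>i\<in>?X. A i" and ?I = "\<Sum>i<r. A i"
  have N_le: "A i \<le> ?N" if "i \<in> ?X" for i using that by (intro le_sum_msub) auto
  have NI: "?N \<le> ?I" by (subst sum_le_msub_iff) (auto intro: le_sum_msub)
  have AI: "A j \<le> ?I" using j by (intro le_sum_msub) auto
  have "expow {..<r} A a \<le> ?N ^ (p - c) * ?I ^ c" if a: "a \<in> exps {..<r} p" "\<forall>i. lookup a i \<le> lookup e i" for a
  proof -
    have aj: "lookup a j \<le> c" using a c by auto
    have sum: "lookup a j + (\<Sum>i\<in>?X. lookup a i) = p"
      using a(1) j by (simp add: exps_def sum.remove[of _ j])
    have "expow {..<r} A a = A j ^ lookup a j * expow ?X A a"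
      using j by (simp add: expow_def prod.remove[of _ j])
    also have "\<dots> \<le> ?I ^ lookup a j * ?N ^ (\<Sum>i\<in>?X. lookup a i)"
      by (intro msub_mult_mono msub_power_mono AI expow_le_power N_le) auto
    \<comment> \<open>Of the factors \<open>?N\<close>, \<open>p - c\<close> are kept and the other
      \<open>c - lookup a j\<close> are enlarged to \<open>?I\<close>.\<close>
    also have "(\<Sum>i\<in>?X. lookup a i) = (p - c) + (c - lookup a j)" using sum aj c by simp
    also have "?I ^ lookup a j * ?N ^ ((p - c) + (c - lookup a j)) =
      ?N ^ (p - c) * (?I ^ lookup a j * ?N ^ (c - lookup a j))"
      by (simp only: power_add ac_simps)
    also have "\<dots> \<le> ?N ^ (p - c) * (?I ^ lookup a j * ?I ^ (c - lookup a j))"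
      by (intro msub_mult_mono msub_power_mono NI order_refl)
    also have "?I ^ lookup a j * ?I ^ (c - lookup a j) = ?I ^ c"
      using aj by (simp flip: power_add)
    finally show ?thesis .
  qed
  then show "trunc_sum r A p e \<le> ?N ^ (p - c) * ?I ^ c"
    unfolding trunc_sum_def by (subst sum_le_msub_iff) auto
  \<comment> \<open>Conversely, both powers are expanded. Since \<open>a\<close> vanishes at
    \<open>j\<close>, the j-th entry of \<open>a + b\<close> is that of \<open>b\<close>, hence at
    most \<open>c\<close>.\<close>
  have "expow ?X A a * expow {..<r} A b \<le> trunc_sum r A p e"
    if a: "a \<in> exps ?X (p - c)" and b: "b \<in> exps {..<r} c" for a b
  proof -
    have aj: "lookup a j = 0" using a by (auto simp: exps_def in_keys_iff)
    have a': "a \<in> exps {..<r} (p - c)" using a aj j by (auto simp: exps_def sum.remove[of _ j])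
    have "a + b \<in> exps {..<r} (p - c + c)" by (rule exps_add[OF a' b])
    then have ab: "a + b \<in> exps {..<r} p" using c by simp
    have "lookup (a + b) i \<le> lookup e i" for i
    proof -
      consider "i = j" | "i \<noteq> j" "i < r" | "\<not> i < r" by blast
      then show ?thesis
      proof cases
        case 1
        have "lookup b j \<le> (\<Sum>i<r. lookup b i)" using j by (intro member_le_sum) auto
        then show ?thesis using 1 aj b c by (simp add: lookup_add exps_def)
      next
        case 2
        have "lookup (a + b) i \<le> (\<Sum>i<r. lookup (a + b) i)" using 2 by (intro member_le_sum) auto
        then show ?thesis using large[of i] 2 ab by (simp add: exps_def)
      next
        case 3
        then have "lookup (a + b) i = 0" using ab by (auto simp: exps_def in_keys_iff)
        then show ?thesis by simp
      qed
    qed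
    then have "expow {..<r} A (a + b) \<le> trunc_sum r A p e"
      unfolding trunc_sum_def using ab by (intro le_sum_msub) auto
    moreover have "expow {..<r} A a = expow ?X A a"
      using j aj by (simp add: expow_def prod.remove[of _ j])
    ultimately show ?thesis by (simp add: expow_add)
  qed
  then show "?N ^ (p - c) * ?I ^ c \<le> trunc_sum r A p e"
    unfolding msub_multinomial[OF finite_lessThan] msub_multinomial[OF finite_Diff[OF finite_lessThan]] sum_product
    by (simp add: sum_le_msub_iff)
qed

section \<open>Counting exponent vectors\<close>

lemma card_exps_insert:
  assumes "finite X" "i \<notin> X"
  shows "card (exps (insert i X) n) = (\<Sum>k\<le>n. card (exps X (n - k)))"
  using sum_exps_insert[OF assms, of "\<lambda>_. 1 :: nat" n] by simp

text \<open>Stars and bars; the induction step is the hockey-stick identity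
  \<open>choose_rising_sum\<close>.\<close>

lemma card_exps:
  assumes "finite X" "X \<noteq> {}"
  shows "card (exps X n) = (n + (card X - 1)) choose (card X - 1)"
  using assms
proof (induction X arbitrary: n rule: finite_ne_induct)
  case (singleton i)
  have "card (exps (insert i {}) n) = (\<Sum>k\<le>n. card (exps {} (n - k)))"
    by (rule card_exps_insert) auto
  also have "\<dots> = (\<Sum>k\<le>n. if k = n then 1 else 0)"
    by (rule sum.cong) (auto simp: exps_empty)
  finally show ?case by simp
next
  case (insert i X)
  obtain s where s: "card X = Suc s" using insert.hyps by (cases "card X") auto
  have "card (exps (insert i X) n) = (\<Sum>k\<le>n. card (exps X (n - k)))"
    using insert.hyps by (intro card_exps_insert)
  also have "\<dots> = (\<Sum>k\<le>n. card (exps X k))"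
    by (rule sum.reindex_bij_witness[of _ "\<lambda>k. n - k" "\<lambda>k. n - k"]) auto
  also have "\<dots> = (\<Sum>k\<le>n. (s + k) choose s)" by (simp add: insert.IH s add.commute)
  also have "\<dots> = (s + n + 1) choose (s + 1)" by (rule choose_rising_sum)
  finally show ?case using insert.hyps s by (simp add: add.commute)
qed

text \<open>In Pochhammer form the count is a product of linear factors in n, whose two leading
  coefficients \<open>prod_linear\<close> provides.\<close>

lemma of_nat_card_exps:
  assumes "finite X" "X \<noteq> {}"
  shows "of_nat (card (exps X n)) =
    pochhammer (of_nat n + 1) (card X - 1) / (fact (card X - 1) :: 'b::field_char_0)"
  unfolding card_exps[OF assms] binomial_gbinomial gbinomial_pochhammer' by simp

lemma card_exps_le:
  assumes "finite X" "X \<noteq> {}"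
  shows "card (exps X n) \<le> Suc n ^ (card X - 1)"
  using assms
proof (induction X arbitrary: n rule: finite_ne_induct)
  case (singleton i)
  then show ?case by (simp add: card_exps)
next
  case (insert i X)
  have "card (exps (insert i X) n) = (\<Sum>k\<le>n. card (exps X (n - k)))"
    using insert.hyps by (intro card_exps_insert)
  also have "\<dots> \<le> (\<Sum>k\<le>n. Suc n ^ (card X - 1))"
    using insert.IH by (intro sum_mono order_trans[OF insert.IH] power_mono) auto
  also have "\<dots> = Suc n ^ Suc (card X - 1)" by simp
  also have "Suc (card X - 1) = card (insert i X) - 1"
    using insert.hyps by (cases "card X") auto
  finally show ?case .
qed

text \<open>Subtracting \<open>p\<close> from every entry is a bijection.\<close>

lemma card_exps_large:
  assumes "finite X" "card X * p \<le> n"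
  shows "card {e \<in> exps X n. \<forall>i\<in>X. p \<le> lookup e i} = card (exps X (n - card X * p))"
proof -
  define s where "s = (\<Sum>i\<in>X. single i p)"
  have s: "lookup s i = (if i \<in> X then p else 0)" for i
    using assms(1) by (simp add: s_def lookup_sum lookup_single when_def)
  have 1: "\<forall>e\<in>{e \<in> exps X n. \<forall>i\<in>X. p \<le> lookup e i}. (e - s) + s = e"
    by (auto intro!: poly_mapping_eqI simp: lookup_add lookup_minus s)
  have 2: "\<forall>e\<in>exps X (n - card X * p). (e + s) - s = e" by simp
  have keys_s: "keys s \<subseteq> X" by (auto simp: in_keys_iff s split: if_splits)
  have 3: "(\<lambda>e. e - s) ` {e \<in> exps X n. \<forall>i\<in>X. p \<le> lookup e i} \<subseteq> exps X (n - card X * p)"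
  proof clarify
    fix e assume e: "e \<in> exps X n" "\<forall>i\<in>X. p \<le> lookup e i"
    have "(\<Sum>i\<in>X. lookup (e - s) i) = (\<Sum>i\<in>X. lookup e i - p)"
      by (intro sum.cong) (auto simp: lookup_minus s)
    also have "\<dots> = n - card X * p"
      using e by (subst sum_subtractf_nat) (auto simp: exps_def)
    moreover have "keys (e - s) \<subseteq> keys e" by (auto simp: in_keys_iff lookup_minus)
    ultimately show "e - s \<in> exps X (n - card X * p)" using e by (auto simp: exps_def)
  qed
  have 4: "(\<lambda>e. e + s) ` exps X (n - card X * p) \<subseteq> {e \<in> exps X n. \<forall>i\<in>X. p \<le> lookup e i}"
  proof clarify
    fix e assume e: "e \<in> exps X (n - card X * p)"
    have "keys (e + s) \<subseteq> X" using keys_s keys_add[of e s] e by (auto simp: exps_def)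
    then show "e + s \<in> exps X n \<and> (\<forall>i\<in>X. p \<le> lookup (e + s) i)"
      using e assms(2) by (simp add: exps_def lookup_add s sum.distrib)
  qed
  show ?thesis
    by (rule bij_betw_same_card, rule bij_betw_byWitness[OF 1 2 3 4])
qed

lemma exps_insert_lookup:
  assumes "finite X" "j \<notin> X" "c \<le> n"
  shows "{e \<in> exps (insert j X) n. lookup e j = c \<and> (\<forall>i\<in>X. R (lookup e i))} =
    (\<lambda>e. single j c + e) ` {e \<in> exps X (n - c). \<forall>i\<in>X. R (lookup e i)}"
proof -
  have *: "lookup e j = 0" if "e \<in> exps X m" for e m
    using that assms(2) by (auto simp: exps_def in_keys_iff)
  have **: "lookup (single j k) i = 0" if "i \<in> X" for i and k :: nat
    using that assms(2) by (auto simp: lookup_single when_def)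
  show ?thesis
    unfolding exps_insert[OF assms(1,2)] using assms(3)
    by (auto simp: lookup_add * ** image_iff)
qed

lemma card_exps_one_small:
  assumes "finite X" "j \<notin> X" "c + card X * p \<le> n"
  shows "card {e \<in> exps (insert j X) n. lookup e j = c \<and> (\<forall>i\<in>X. p \<le> lookup e i)} =
    card (exps X (n - c - card X * p))"
proof -
  have "card {e \<in> exps (insert j X) n. lookup e j = c \<and> (\<forall>i\<in>X. p \<le> lookup e i)} =
    card {e \<in> exps X (n - c). \<forall>i\<in>X. p \<le> lookup e i}"
    using assms by (subst exps_insert_lookup) (auto intro: card_image)
  also have "\<dots> = card (exps X (n - c - card X * p))"
    using assms by (intro card_exps_large) auto
  finally show ?thesis .
qed

text \<open>Two entries have at most \<open>p * p\<close> values, and the others have one degree of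
  freedom fewer than their number. The factor \<open>Suc n\<close> on the left stands for the
  exponent \<open>card X - 3\<close>, which would be negative for two variables; in that case
  \<open>n \<ge> 2 * p\<close> leaves no vectors.\<close>

lemma card_exps_two_small:
  assumes "finite X" "i \<in> X" "j \<in> X" "i \<noteq> j" "n \<ge> 2 * p"
  shows "Suc n * card {e \<in> exps X n. lookup e i < p \<and> lookup e j < p} \<le> p * p * Suc n ^ (card X - 2)"
proof -
  define Y where "Y = X - {i, j}"
  have X: "X = insert i (insert j Y)" and Y: "finite Y" "i \<notin> insert j Y" "j \<notin> Y"
    using assms by (auto simp: Y_def)
  have card: "card X - 2 = card Y" using X Y by simp
  have "{e \<in> exps X n. lookup e i < p \<and> lookup e j < p} \<subseteq>
    (\<Union>u<p. \<Union>v<p. (\<lambda>e. single i u + (single j v + e)) ` exps Y (n - u - v))" (is "?A \<subseteq> ?B")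
  proof
    fix e assume e: "e \<in> ?A"
    then obtain u e' where u: "e = single i u + e'" "e' \<in> exps (insert j Y) (n - u)"
      unfolding X using exps_insert[of "insert j Y" i n] Y by auto
    then obtain v e'' where v: "e' = single j v + e''" "e'' \<in> exps Y (n - u - v)"
      using exps_insert[of Y j "n - u"] Y by auto
    have "lookup e'' i = 0" "lookup e'' j = 0" using v(2) Y by (auto simp: exps_def in_keys_iff)
    then have "lookup e i = u" "lookup e j = v"
      using assms(4) by (simp_all add: u v lookup_add lookup_single when_def)
    then show "e \<in> ?B" using e u v by auto
  qed
  then have "card ?A \<le> card ?B" using Y by (intro card_mono) auto
  also have "\<dots> \<le> (\<Sum>u<p. \<Sum>v<p. card (exps Y (n - u - v)))"
    using Y by (intro order_trans[OF card_UN_le] sum_mono card_image_le) auto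
  finally have "Suc n * card ?A \<le> Suc n * (\<Sum>u<p. \<Sum>v<p. card (exps Y (n - u - v)))"
    by (rule mult_le_mono2)
  also have "\<dots> = (\<Sum>u<p. \<Sum>v<p. Suc n * card (exps Y (n - u - v)))"
    by (simp only: sum_distrib_left)
  also have "\<dots> \<le> (\<Sum>u<p. \<Sum>v<p. Suc n ^ card Y)"
  proof (intro sum_mono)
    fix u v assume uv: "u \<in> {..<p}" "v \<in> {..<p}"
    show "Suc n * card (exps Y (n - u - v)) \<le> Suc n ^ card Y"
    proof (cases "Y = {}")
      case True
      then show ?thesis using uv assms(5) by (simp add: exps_empty)
    next
      case False
      then obtain s where s: "card Y = Suc s" using Y by (cases "card Y") auto
      have "card (exps Y (n - u - v)) \<le> Suc (n - u - v) ^ s"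
        using card_exps_le[OF Y(1) False] s by simp
      also have "\<dots> \<le> Suc n ^ s" by (intro power_mono) auto
      finally show ?thesis unfolding s power_Suc by (rule mult_le_mono2)
    qed
  qed
  finally show ?thesis by (simp add: card)
qed

section \<open>Coefficients of polynomials and growth\<close>

text \<open>The leading term dominates: by induction the tail times n grows without bound, so half
  of it absorbs the new constant term.\<close>

lemma poly_lower_bound:
  fixes R :: "rat poly"
  assumes "R \<noteq> 0"
  shows "\<exists>\<epsilon> N. \<epsilon> > 0 \<and> (\<forall>n\<ge>N. \<epsilon> * of_nat n ^ degree R \<le> \<bar>poly R (of_nat n)\<bar>)"
  using assms
proof (induction R)
  case (pCons a R)
  show ?case
  proof (cases "R = 0")
    case True
    then show ?thesis using pCons by (intro exI[of _ "\<bar>a\<bar>"]) auto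
  next
    case False
    then obtain \<epsilon> N where e: "\<epsilon> > 0" "\<And>n. n \<ge> N \<Longrightarrow> \<epsilon> * of_nat n ^ degree R \<le> \<bar>poly R (of_nat n)\<bar>"
      using pCons by blast
    obtain M where M: "2 * \<bar>a\<bar> / \<epsilon> < of_nat M" using reals_Archimedean2 by blast
    have "\<epsilon> / 2 * of_nat n ^ degree (pCons a R) \<le> \<bar>poly (pCons a R) (of_nat n)\<bar>"
      if n: "n \<ge> Suc (max M N)" for n
    proof -
      let ?n = "of_nat n :: rat"
      have "2 * \<bar>a\<bar> / \<epsilon> < ?n" by (rule order.strict_trans2[OF M]) (use n in simp)
      then have "2 * \<bar>a\<bar> < \<epsilon> * ?n" using e(1) by (simp add: field_simps)
      moreover have "1 \<le> ?n ^ degree R" using n by (intro one_le_power) simp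
      ultimately have a: "2 * \<bar>a\<bar> \<le> \<epsilon> * ?n * ?n ^ degree R"
        using e(1) by (intro order_trans[OF _ mult_left_mono[of 1 "?n ^ degree R" "\<epsilon> * ?n"]]) auto
      have "\<epsilon> * ?n ^ degree R \<le> \<bar>poly R ?n\<bar>" using e(2)[of n] n by simp
      then have "?n * (\<epsilon> * ?n ^ degree R) \<le> ?n * \<bar>poly R ?n\<bar>" by (intro mult_left_mono) auto
      also have "\<dots> = \<bar>?n * poly R ?n\<bar>" by (simp add: abs_mult)
      also have "\<dots> \<le> \<bar>poly (pCons a R) ?n\<bar> + \<bar>a\<bar>" by simp
      finally have "?n * (\<epsilon> * ?n ^ degree R) \<le> \<bar>poly (pCons a R) ?n\<bar> + \<bar>a\<bar>" .
      moreover have "?n * (\<epsilon> * ?n ^ degree R) = \<epsilon> * ?n * ?n ^ degree R"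
        by (simp only: mult.left_commute mult.assoc)
      moreover have "\<epsilon> / 2 * ?n ^ degree (pCons a R) = \<epsilon> * ?n * ?n ^ degree R / 2"
        using False by simp
      ultimately show ?thesis using a by linarith
    qed
    then show ?thesis using e(1) by (intro exI[of _ "\<epsilon> / 2"] exI[of _ "Suc (max M N)"]) auto
  qed
qed simp

text \<open>A degree above \<open>k\<close> would contradict \<open>poly_lower_bound\<close>. The
  shift \<open>c\<close> admits bounds in powers of p + q + 1 for fixed p.\<close>

lemma degree_le_if_bounded:
  fixes R :: "rat poly"
  assumes "\<And>n. n \<ge> N \<Longrightarrow> \<bar>poly R (of_nat n)\<bar> \<le> K * of_nat (n + c) ^ k"
  shows "degree R \<le> k"
proof (rule ccontr)
  assume k: "\<not> degree R \<le> k"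
  then have "R \<noteq> 0" by auto
  then obtain \<epsilon> M where e: "\<epsilon> > 0" "\<And>n. n \<ge> M \<Longrightarrow> \<epsilon> * of_nat n ^ degree R \<le> \<bar>poly R (of_nat n)\<bar>"
    using poly_lower_bound by blast
  obtain L where L: "\<bar>K\<bar> * 2 ^ k / \<epsilon> < of_nat L" using reals_Archimedean2 by blast
  define n where "n = Suc (N + M + L + c)"
  let ?n = "of_nat n :: rat"
  have n: "?n > 0" "1 \<le> ?n" by (simp_all add: n_def)
  have "\<epsilon> * ?n ^ Suc k \<le> \<epsilon> * ?n ^ degree R"
    using k e(1) n by (intro mult_left_mono power_increasing) auto
  also have "\<dots> \<le> K * of_nat (n + c) ^ k"
    using e(2)[of n] assms[of n] by (simp add: n_def)
  also have "\<dots> \<le> \<bar>K\<bar> * (2 * ?n) ^ k"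
    by (intro mult_mono power_mono) (auto simp: n_def)
  also have "\<dots> = \<bar>K\<bar> * 2 ^ k * ?n ^ k" by (simp add: power_mult_distrib)
  finally have "\<epsilon> * ?n * ?n ^ k \<le> \<bar>K\<bar> * 2 ^ k * ?n ^ k"
    by (simp only: power_Suc mult.assoc)
  then have "\<epsilon> * ?n \<le> \<bar>K\<bar> * 2 ^ k"
    by (rule mult_right_le_imp_le) (use n in simp)
  then have "?n \<le> \<bar>K\<bar> * 2 ^ k / \<epsilon>" using e(1) by (simp add: field_simps)
  also have "\<dots> < of_nat L" by (rule L)
  also have "\<dots> \<le> ?n" by (simp add: n_def)
  finally show False by simp
qed

text \<open>The two leading coefficients of a product of monic linear factors: 1 and the sum of the
  constants.\<close>

lemma prod_linear:
  fixes c :: "nat \<Rightarrow> 'b::idom"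
  shows "degree (\<Prod>i<k. [:c i, 1:]) = k" "coeff (\<Prod>i<k. [:c i, 1:]) k = 1"
    "coeff (\<Prod>i<Suc k. [:c i, 1:]) k = (\<Sum>i<Suc k. c i)"
proof -
  show deg: "degree (\<Prod>i<k. [:c i, 1:]) = k" for k
    by (subst degree_prod_eq_sum_degree) auto
  show lead: "coeff (\<Prod>i<k. [:c i, 1:]) k = 1" for k
    using lead_coeff_prod[of "\<lambda>i. [:c i, 1:]" "{..<k}"] by (simp only: deg) simp
  show "coeff (\<Prod>i<Suc k. [:c i, 1:]) k = (\<Sum>i<Suc k. c i)"
  proof (induction k)
    case (Suc k)
    have "(\<Prod>i<Suc (Suc k). [:c i, 1:]) = (\<Prod>i<Suc k. [:c i, 1:]) * [:c (Suc k), 1:]"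
      by (rule prod.lessThan_Suc)
    then have "coeff (\<Prod>i<Suc (Suc k). [:c i, 1:]) (Suc k) =
      c (Suc k) * coeff (\<Prod>i<Suc k. [:c i, 1:]) (Suc k) + coeff (\<Prod>i<Suc k. [:c i, 1:]) k"
      by (simp only: mult.commute[of _ "[:_, _:]"]) (simp add: mult_pCons_left)
    then show ?case using Suc lead[of "Suc k"] by (simp only:) simp
  qed simp
qed

lemma poly_prod_pochhammer:
  "poly (\<Prod>i<k. [:a + of_nat i, 1:]) x = pochhammer (x + a) k" for a :: "'b::comm_ring_1"
  by (simp add: poly_prod pochhammer_prod add_ac atLeast0LessThan)

text \<open>For fixed \<open>p\<close> only the vectors with at most one entry below \<open>p\<close> matter for the two leading
  coefficients in \<open>q\<close>: there are \<open>O(q\<^sup>r\<^sup>-\<^sup>3)\<close> others.\<close>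

lemma coeff_graded_sum:
  fixes g :: "(nat \<Rightarrow>\<^sub>0 nat) \<Rightarrow> nat" and R :: "rat poly"
  assumes r: "r \<ge> 2"
    and R: "\<And>q. q \<ge> N \<Longrightarrow> of_nat (\<Sum>e\<in>exps {..<r} (p + q). g e) = poly R (of_nat q)"
    and large: "\<And>e q. e \<in> exps {..<r} (p + q) \<Longrightarrow> (\<And>i. i < r \<Longrightarrow> p \<le> lookup e i) \<Longrightarrow> g e = a"
    and small: "\<And>e q j. e \<in> exps {..<r} (p + q) \<Longrightarrow> j < r \<Longrightarrow> lookup e j < p \<Longrightarrow>
      (\<And>i. i < r \<Longrightarrow> i \<noteq> j \<Longrightarrow> p \<le> lookup e i) \<Longrightarrow> g e = b j (lookup e j)"
    and bound: "\<And>e q. e \<in> exps {..<r} (p + q) \<Longrightarrow> g e \<le> C"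
  shows "coeff R (r - 2) = of_nat a * (\<Sum>i<r - 1. of_nat (Suc i) - of_nat ((r - 1) * p)) / fact (r - 1)
    + of_nat (\<Sum>j<r. \<Sum>c<p. b j c) / fact (r - 2)"
proof -
  define k where "k = r - 2"
  have rk: "r = Suc (Suc k)" using r by (simp add: k_def)
  \<comment> \<open>\<open>E0\<close>, \<open>E1'\<close> and \<open>E2\<close> collect the vectors
    with no, exactly one, and at least two entries below \<open>p\<close>; \<open>E1 n j c\<close>
    fixes the position and the value of the small entry.\<close>
  define E0 where "E0 = (\<lambda>n. {e \<in> exps {..<r} n. \<forall>i<r. p \<le> lookup e i})"
  define E1 where "E1 = (\<lambda>n j c. {e \<in> exps {..<r} n. lookup e j = c \<and> (\<forall>i\<in>{..<r} - {j}. p \<le> lookup e i)})"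
  define E2 where "E2 = (\<lambda>n. {e \<in> exps {..<r} n. \<exists>i<r. \<exists>j<r. i \<noteq> j \<and> lookup e i < p \<and> lookup e j < p})"
  define E1' where "E1' = (\<lambda>n. \<Union>j<r. \<Union>c<p. E1 n j c)"
  have fin: "finite (E0 n)" "finite (E1 n j c)" "finite (E2 n)" "finite (E1' n)" for n j c
    by (simp_all add: E0_def E1_def E2_def E1'_def)
  have part: "exps {..<r} n = E0 n \<union> E1' n \<union> E2 n" for n
  proof (intro equalityI subsetI)
    fix e assume e: "e \<in> exps {..<r} n"
    show "e \<in> E0 n \<union> E1' n \<union> E2 n"
    proof (cases "\<exists>j<r. lookup e j < p")
      case True
      then obtain j where j: "j < r" "lookup e j < p" by blast
      show ?thesis
      proof (cases "\<exists>i<r. i \<noteq> j \<and> lookup e i < p")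
        case True
        then show ?thesis using e j by (auto simp: E2_def)
      next
        case False
        have "p \<le> lookup e i" if "i \<in> {..<r} - {j}" for i
        proof -
          have "\<not> lookup e i < p" using False that by auto
          then show ?thesis by simp
        qed
        then show ?thesis using e j by (auto simp: E1'_def E1_def)
      qed
    next
      case False
      have "p \<le> lookup e i" if "i < r" for i
      proof -
        have "\<not> lookup e i < p" using False that by blast
        then show ?thesis by simp
      qed
      then show ?thesis using e by (auto simp: E0_def)
    qed
  qed (auto simp: E0_def E1_def E1'_def E2_def)
  have sum_split: "(\<Sum>e\<in>exps {..<r} n. g e) =
    (\<Sum>e\<in>E0 n. g e) + (\<Sum>j<r. \<Sum>c<p. \<Sum>e\<in>E1 n j c. g e) + (\<Sum>e\<in>E2 n. g e)" for n
  proof -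
    have E0: "p \<le> lookup e i" if "e \<in> E0 n" "i < r" for e i using that by (simp add: E0_def)
    have E1: "lookup e j = c \<and> (i < r \<longrightarrow> i \<noteq> j \<longrightarrow> p \<le> lookup e i)" if "e \<in> E1 n j c" for e i j c
      using that by (simp add: E1_def)
    have "E0 n \<inter> E1' n = {}"
    proof (rule equals0I)
      fix e assume e: "e \<in> E0 n \<inter> E1' n"
      then obtain j c where "j < r" "c < p" "e \<in> E1 n j c" by (auto simp: E1'_def)
      then show False using E0[of e j] E1[of e j c] e by auto
    qed
    moreover have "(E0 n \<union> E1' n) \<inter> E2 n = {}"
    proof (rule equals0I)
      fix e assume e: "e \<in> (E0 n \<union> E1' n) \<inter> E2 n"
      then obtain i j where ij: "i < r" "j < r" "i \<noteq> j" "lookup e i < p" "lookup e j < p"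
        by (auto simp: E2_def)
      have "e \<notin> E0 n" using E0[of e i] ij by auto
      then obtain l c where "l < r" "e \<in> E1 n l c" using e by (auto simp: E1'_def)
      then show False using E1[of e l c i] E1[of e l c j] ij by (cases "i = l") auto
    qed
    ultimately have "(\<Sum>e\<in>exps {..<r} n. g e) = (\<Sum>e\<in>E0 n. g e) + (\<Sum>e\<in>E1' n. g e) + (\<Sum>e\<in>E2 n. g e)"
      unfolding part using fin by (simp add: sum.union_disjoint)
    also have "(\<Sum>e\<in>E1' n. g e) = (\<Sum>j<r. \<Sum>c<p. \<Sum>e\<in>E1 n j c. g e)"
    proof -
      have "(\<Union>c<p. E1 n i c) \<inter> (\<Union>c<p. E1 n j c) = {}" if "i < r" "j < r" "i \<noteq> j" for i j
      proof (rule equals0I)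
        fix e assume "e \<in> (\<Union>c<p. E1 n i c) \<inter> (\<Union>c<p. E1 n j c)"
        then obtain c c' where "c < p" "e \<in> E1 n i c" "e \<in> E1 n j c'" by auto
        then show False using E1[of e i c] E1[of e j c' i] that by auto
      qed
      moreover have "E1 n j c \<inter> E1 n j c' = {}" if "c \<noteq> c'" for j c c'
        unfolding E1_def using that by auto
      ultimately show ?thesis
        unfolding E1'_def using fin by (subst sum.UNION_disjoint; simp add: sum.UNION_disjoint)
    qed
    finally show ?thesis .
  qed
  \<comment> \<open>The number of vectors in \<open>E0\<close> as a polynomial in q: p + q - r p = q
    - (r - 1) p remains after subtracting \<open>p\<close> from all r entries. In \<open>P1\<close>
    the entry c is fixed and only the other r - 1 entries are lowered.\<close>
  define P0 where "P0 = smult (of_nat a / fact (r - 1)) (\<Prod>i<r - 1. [:(1 - of_nat ((r - 1) * p)) + of_nat i, 1:] :: rat poly)"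
  define P1 where "P1 = (\<lambda>j c. smult (of_nat (b j c) / fact (r - 2)) (\<Prod>i<r - 2. [:(of_nat p + 1 - of_nat c - of_nat ((r - 1) * p)) + of_nat i, 1:] :: rat poly))"
  have sum0: "of_nat (\<Sum>e\<in>E0 (p + q). g e) = poly P0 (of_nat q)" if q: "q \<ge> r * p" for q
  proof -
    have "(\<Sum>e\<in>E0 (p + q). g e) = (\<Sum>e\<in>E0 (p + q). a)"
      by (intro sum.cong refl large[of _ q]) (auto simp: E0_def)
    also have "\<dots> = card {e \<in> exps {..<r} (p + q). \<forall>i\<in>{..<r}. p \<le> lookup e i} * a"
      by (simp add: E0_def Ball_def)
    also have "card {e \<in> exps {..<r} (p + q). \<forall>i\<in>{..<r}. p \<le> lookup e i} = card (exps {..<r} (p + q - r * p))"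
      using q by (subst card_exps_large) auto
    finally have "of_nat (\<Sum>e\<in>E0 (p + q). g e) = (of_nat a :: rat) * of_nat (card (exps {..<r} (p + q - r * p)))"
      by simp
    also have "of_nat (card (exps {..<r} (p + q - r * p))) =
      (pochhammer (of_nat (p + q - r * p) + 1) (r - 1) / fact (r - 1) :: rat)"
      using rk by (subst of_nat_card_exps) auto
    also have "(of_nat (p + q - r * p) + 1 :: rat) = of_nat q + (1 - of_nat ((r - 1) * p))"
      using q by (simp add: of_nat_diff rk algebra_simps)
    finally show ?thesis unfolding P0_def poly_smult poly_prod_pochhammer by simp
  qed
  have sum1: "of_nat (\<Sum>e\<in>E1 (p + q) j c. g e) = poly (P1 j c) (of_nat q)"
    if q: "q \<ge> r * p" and jc: "j < r" "c < p" for q j c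
  proof -
    have ins: "insert j ({..<r} - {j}) = {..<r}" and card: "card ({..<r} - {j}) = r - 1"
      using jc by auto
    have "(r - 1) * p + p = r * p" using rk by simp
    then have le: "c + card ({..<r} - {j}) * p \<le> p + q" using q jc card by simp
    have "(\<Sum>e\<in>E1 (p + q) j c. g e) = (\<Sum>e\<in>E1 (p + q) j c. b j c)"
      using jc by (intro sum.cong refl) (auto simp: E1_def intro!: small[of _ q j])
    also have "\<dots> = card (E1 (p + q) j c) * b j c" by simp
    also have "card (E1 (p + q) j c) = card (exps ({..<r} - {j}) (p + q - c - (r - 1) * p))"
      unfolding E1_def using card_exps_one_small[OF _ _ le, of j] by (simp only: ins card) simp
    finally have "of_nat (\<Sum>e\<in>E1 (p + q) j c. g e) =
      (of_nat (b j c) :: rat) * of_nat (card (exps ({..<r} - {j}) (p + q - c - (r - 1) * p)))" by simp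
    also have "of_nat (card (exps ({..<r} - {j}) (p + q - c - (r - 1) * p))) =
      (pochhammer (of_nat (p + q - c - (r - 1) * p) + 1) (r - 2) / fact (r - 2) :: rat)"
    proof -
      have "{..<r} - {j} \<noteq> {}" using card rk by fastforce
      then show ?thesis using card rk by (subst of_nat_card_exps) auto
    qed
    also have "(of_nat (p + q - c - (r - 1) * p) + 1 :: rat) =
      of_nat q + (of_nat p + 1 - of_nat c - of_nat ((r - 1) * p))"
    proof -
      have "(of_nat (p + q - c - (r - 1) * p) :: rat) = of_nat (p + q) - of_nat (c + (r - 1) * p)"
        using le by (subst diff_diff_left, subst of_nat_diff) (simp_all only: card)
      then show ?thesis by (simp only: of_nat_add)
    qed
    finally show ?thesis unfolding P1_def poly_smult poly_prod_pochhammer by simp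
  qed
  \<comment> \<open>\<open>D\<close> is the contribution of the vectors with at least two small
    entries.\<close>
  define D where "D = R - P0 - (\<Sum>j<r. \<Sum>c<p. P1 j c)"
  have D: "poly D (of_nat q) = of_nat (\<Sum>e\<in>E2 (p + q). g e)" if q: "q \<ge> max N (r * p)" for q
  proof -
    have "poly R (of_nat q) = of_nat (\<Sum>e\<in>exps {..<r} (p + q). g e)" using R q by simp
    also have "\<dots> = poly P0 (of_nat q) + (\<Sum>j<r. \<Sum>c<p. poly (P1 j c) (of_nat q)) + of_nat (\<Sum>e\<in>E2 (p + q). g e)"
      unfolding sum_split of_nat_add of_nat_sum[of _ "{..<r}"] of_nat_sum[of _ "{..<p}"]
      using q by (simp only: sum0 max.bounded_iff) (simp add: sum1 del: of_nat_sum)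
    finally show ?thesis by (simp add: D_def poly_sum)
  qed
  have E2_bound: "Suc n * card (E2 n) \<le> r * r * (p * p * Suc n ^ k)" if n: "n \<ge> 2 * p" for n
  proof -
    let ?P = "{x \<in> {..<r} \<times> {..<r}. fst x \<noteq> snd x}"
    let ?A = "\<lambda>x. {e \<in> exps {..<r} n. lookup e (fst x) < p \<and> lookup e (snd x) < p}"
    have "E2 n \<subseteq> (\<Union>x\<in>?P. ?A x)" by (fastforce simp: E2_def)
    then have "card (E2 n) \<le> card (\<Union>x\<in>?P. ?A x)" by (intro card_mono) auto
    also have "\<dots> \<le> (\<Sum>x\<in>?P. card (?A x))" by (rule card_UN_le) auto
    finally have "Suc n * card (E2 n) \<le> Suc n * (\<Sum>x\<in>?P. card (?A x))" by (rule mult_le_mono2)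
    also have "\<dots> = (\<Sum>x\<in>?P. Suc n * card (?A x))" by (rule sum_distrib_left)
    also have "\<dots> \<le> (\<Sum>x\<in>?P. p * p * Suc n ^ (card {..<r} - 2))"
      using n by (intro sum_mono card_exps_two_small) auto
    also have "\<dots> = card ?P * (p * p * Suc n ^ k)" by (simp add: k_def)
    also have "\<dots> \<le> card ({..<r} \<times> {..<r}) * (p * p * Suc n ^ k)"
      by (intro mult_le_mono1 card_mono) auto
    finally show ?thesis by (simp add: card_cartesian_product)
  qed
  \<comment> \<open>Multiplying by q + p + 1 expresses that the degree of \<open>D\<close> is below
    \<open>k\<close> without the exponent \<open>k - 1\<close>, and thus also covers r = 2, where k
    = 0 and \<open>D\<close> must vanish.\<close>
  have "degree (D * [:of_nat (Suc p), 1:]) \<le> k"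
  proof (rule degree_le_if_bounded)
    fix q assume q: "q \<ge> max N (r * p)"
    have "2 * p \<le> r * p" using r by simp
    moreover have "r * p \<le> q" using q by simp
    ultimately have "2 * p \<le> p + q" by linarith
    have "(\<Sum>e\<in>E2 (p + q). g e) \<le> (\<Sum>e\<in>E2 (p + q). C)"
      by (intro sum_mono bound[of _ q]) (simp add: E2_def)
    then have "Suc (p + q) * (\<Sum>e\<in>E2 (p + q). g e) \<le> Suc (p + q) * (card (E2 (p + q)) * C)"
      by (intro mult_le_mono2) simp
    also have "\<dots> = Suc (p + q) * card (E2 (p + q)) * C" by (simp only: mult.assoc)
    also have "\<dots> \<le> r * r * (p * p * Suc (p + q) ^ k) * C"
      by (intro mult_le_mono1 E2_bound) fact
    finally have le: "Suc (p + q) * (\<Sum>e\<in>E2 (p + q). g e) \<le> r * r * p * p * C * Suc (p + q) ^ k"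
      by (simp only: mult_ac)
    have "poly (D * [:of_nat (Suc p), 1:]) (of_nat q) = of_nat (Suc (p + q) * (\<Sum>e\<in>E2 (p + q). g e))"
      by (simp add: D[OF q] algebra_simps)
    then have "\<bar>poly (D * [:of_nat (Suc p), 1:]) (of_nat q)\<bar> = of_nat (Suc (p + q) * (\<Sum>e\<in>E2 (p + q). g e))"
      by (simp only: abs_of_nat)
    also have "\<dots> \<le> of_nat (r * r * p * p * C * Suc (p + q) ^ k)"
      by (rule of_nat_mono) (rule le)
    also have "\<dots> = of_nat (r * r * p * p * C) * of_nat (q + Suc p) ^ k"
      by (simp add: add_ac)
    finally show "\<bar>poly (D * [:of_nat (Suc p), 1:]) (of_nat q)\<bar> \<le> of_nat (r * r * p * p * C) * of_nat (q + Suc p) ^ k" .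
  qed
  moreover have "degree (D * [:of_nat (Suc p), 1:]) = Suc (degree D)" if "D \<noteq> 0"
    using that by (subst degree_mult_eq) auto
  ultimately have "coeff D k = 0" by (cases "D = 0") (auto intro: coeff_eq_0)
  then have eq: "coeff R k = coeff P0 k + (\<Sum>j<r. \<Sum>c<p. coeff (P1 j c) k)"
    by (simp add: D_def coeff_sum)
  have P0: "coeff P0 k = of_nat a / fact (r - 1) * (\<Sum>i<r - 1. (1 - of_nat ((r - 1) * p)) + of_nat i)"
    using prod_linear(3)[of "\<lambda>i. (1 - of_nat ((r - 1) * p)) + of_nat i :: rat" k]
    by (simp only: P0_def coeff_smult) (simp add: rk)
  have P1: "coeff (P1 j c) k = of_nat (b j c) / fact (r - 2)" for j c
    using prod_linear(2)[of "\<lambda>i. (of_nat p + 1 - of_nat c - of_nat ((r - 1) * p)) + of_nat i :: rat" k]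
    by (simp only: P1_def coeff_smult k_def[symmetric] mult_1_right times_divide_eq_left)
  have "(\<Sum>j<r. \<Sum>c<p. coeff (P1 j c) k) = of_nat (\<Sum>j<r. \<Sum>c<p. b j c) / fact (r - 2)"
    by (simp add: P1 sum_divide_distrib)
  moreover have "(\<Sum>i<r - 1. (1 - of_nat ((r - 1) * p)) + of_nat i) =
    (\<Sum>i<r - 1. of_nat (Suc i) - of_nat ((r - 1) * p) :: rat)"
    by (intro sum.cong) auto
  ultimately show ?thesis
    unfolding k_def[symmetric] eq P0 by (simp only: times_divide_eq_left)
qed

section \<open>Ideals of the ground ring\<close>

text \<open>The rule \<open>ring_mod.scale_scale\<close> is a simplification rule that associates products to the left and
  loops together with \<open>algebra_simps\<close>; this is why it is deleted in several calls.\<close>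

lemma is_idealI:
  assumes "0 \<in> A" "\<And>x y. x \<in> A \<Longrightarrow> y \<in> A \<Longrightarrow> x + y \<in> A" "\<And>c x. x \<in> A \<Longrightarrow> c * x \<in> A"
  shows "is_ideal A"
  using assms by (simp add: ring_mod.subspace_def)

lemma is_ideal_eq_UNIV: "is_ideal J \<Longrightarrow> 1 \<in> J \<Longrightarrow> J = UNIV"
  using ring_mod.subspace_scale[of J 1] by auto

lemma const_poly_in_ideal_mod: "is_ideal J \<Longrightarrow> const_poly x \<in> set_of (ideal_mod J) \<longleftrightarrow> x \<in> J"
  by (auto simp: set_of_ideal_mod)

lemma ideal_mod_le_iff: "is_ideal J \<Longrightarrow> is_ideal K \<Longrightarrow> ideal_mod J \<le> ideal_mod K \<longleftrightarrow> J \<subseteq> K"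
  by (auto simp: less_eq_msub_def set_of_ideal_mod)

lemma ideal_mod_UNIV: "ideal_mod UNIV = 1"
proof -
  have "set_of (ideal_mod UNIV) = (set_of 1 :: 'a mpoly set)"
    by (simp add: set_of_ideal_mod set_of_1)
  then show ?thesis by (simp add: set_of_inject)
qed

lemma is_ideal_plus:
  assumes "is_ideal A" "is_ideal B"
  shows "is_ideal (A + B)"
proof -
  have "A + B = ideal_span (A \<union> B)"
    using assms by (auto simp: ring_mod.span_Un ring_mod.span_eq_iff[THEN iffD2] set_plus_def)
  then show ?thesis by (simp only: ring_mod.subspace_span)
qed

lemma ideal_mod_plus:
  assumes "is_ideal A" "is_ideal B"
  shows "ideal_mod (A + B) = ideal_mod A + ideal_mod B"
proof -
  have "const_poly ` (A + B) = const_poly ` A + const_poly ` B"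
    by (force simp: set_plus_def const_poly_add)
  then have "set_of (ideal_mod (A + B)) = set_of (ideal_mod A + ideal_mod B)"
    using assms is_ideal_plus[OF assms] by (simp add: set_of_ideal_mod set_of_plus)
  then show ?thesis by (simp add: set_of_inject)
qed

lemma ideal_mod_0: "ideal_mod {0 :: 'a::comm_ring_1} = 0"
proof -
  have "set_of (ideal_mod {0}) = (set_of 0 :: 'a mpoly set)"
    by (simp add: set_of_ideal_mod set_of_0)
  then show ?thesis by (simp add: set_of_inject)
qed

lemma ideal_mod_sum:
  "(\<And>x. x \<in> X \<Longrightarrow> is_ideal (J x)) \<Longrightarrow> is_ideal (\<Sum>x\<in>X. J x) \<and> ideal_mod (\<Sum>x\<in>X. J x) = (\<Sum>x\<in>X. ideal_mod (J x))"
  by (induction X rule: infinite_finite_induct)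
    (simp_all add: is_ideal_plus ideal_mod_plus ideal_mod_0)

lemma ideal_mod_span:
  assumes "finite B"
  shows "ideal_mod (ideal_span B) = (\<Sum>b\<in>B. cyc (const_poly b))"
proof (rule order_antisym)
  let ?R = "\<Sum>b\<in>B. cyc (const_poly b)"
  have ideal: "is_ideal (ideal_span B)" by (rule ring_mod.subspace_span)
  have "is_ideal {x. const_poly x \<in> set_of ?R}"
    by (rule is_idealI) (simp_all add: const_poly_add set_of_add const_poly_mult set_of_scale)
  moreover have "B \<subseteq> {x. const_poly x \<in> set_of ?R}"
  proof
    fix b assume "b \<in> B"
    then have "cyc (const_poly b) \<le> ?R" using assms by (intro le_sum_msub)
    then show "b \<in> {x. const_poly x \<in> set_of ?R}" by (simp add: cyc_le_iff)
  qed
  ultimately have "ideal_span B \<subseteq> {x. const_poly x \<in> set_of ?R}"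
    by (intro ring_mod.span_minimal)
  then show "ideal_mod (ideal_span B) \<le> ?R"
    by (auto simp: less_eq_msub_def set_of_ideal_mod[OF ideal])
  show "?R \<le> ideal_mod (ideal_span B)"
    using assms by (simp add: sum_le_msub_iff cyc_le_iff const_poly_in_ideal_mod[OF ideal] ring_mod.span_base)
qed

text \<open>The union of a strictly ascending chain is an ideal whose finitely many generators
  already lie in one member, which is absurd. Hence induction may proceed from larger ideals to
  smaller ones.\<close>

lemma noetherian_induct [consumes 2]:
  fixes J :: "'a::comm_ring_1 set"
  assumes "noetherian TYPE('a)" "is_ideal J"
    and step: "\<And>J. is_ideal J \<Longrightarrow> (\<And>K. is_ideal K \<Longrightarrow> J \<subset> K \<Longrightarrow> P K) \<Longrightarrow> P J"
  shows "P J"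
proof -
  have "wf {(K, J :: 'a set). is_ideal J \<and> is_ideal K \<and> J \<subset> K}"
    unfolding wf_iff_no_infinite_down_chain
  proof
    assume "\<exists>f. \<forall>i. (f (Suc i), f i) \<in> {(K, J :: 'a set). is_ideal J \<and> is_ideal K \<and> J \<subset> K}"
    then obtain f :: "nat \<Rightarrow> 'a set" where f: "\<And>i. is_ideal (f i)" "\<And>i. f i \<subset> f (Suc i)" by blast
    have "incseq f" using f(2) by (intro incseq_SucI) blast
    then have mono: "f i \<subseteq> f j" if "i \<le> j" for i j using that by (simp add: incseqD)
    have "is_ideal (\<Union>i. f i)"
    proof (rule is_idealI)
      fix x y assume "x \<in> (\<Union>i. f i)" "y \<in> (\<Union>i. f i)"
      then obtain i j where "x \<in> f i" "y \<in> f j" by blast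
      then have "x \<in> f (max i j)" "y \<in> f (max i j)" using mono[of i "max i j"] mono[of j "max i j"] by auto
      then show "x + y \<in> (\<Union>i. f i)" using ring_mod.subspace_add[OF f(1)] by blast
    next
      show "0 \<in> (\<Union>i. f i)" using ring_mod.subspace_0[OF f(1)] by blast
    next
      fix c x assume "x \<in> (\<Union>i. f i)"
      then obtain i where "x \<in> f i" by blast
      then have "c * x \<in> f i" by (rule ring_mod.subspace_scale[OF f(1)])
      then show "c * x \<in> (\<Union>i. f i)" by blast
    qed
    with assms(1) have "\<exists>B. finite B \<and> (\<Union>i. f i) = ideal_span B"
      by (simp add: noetherian_def)
    then obtain B where B: "finite B" "(\<Union>i. f i) = ideal_span B" by (elim exE conjE)
    have "\<exists>i. b \<in> f i" if "b \<in> B" for b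
      using ring_mod.span_base[OF that] B(2) by auto
    then obtain n where n: "\<And>b. b \<in> B \<Longrightarrow> b \<in> f (n b)" by metis
    define N where "N = Max (insert 0 (n ` B))"
    have "n b \<le> N" if "b \<in> B" for b unfolding N_def using B(1) that by (intro Max_ge) auto
    then have "B \<subseteq> f N" using n mono by blast
    then have "ideal_span B \<subseteq> f N" using f(1) by (intro ring_mod.span_minimal)
    then have "f (Suc N) \<subseteq> f N" using B(2) by blast
    then show False using f(2)[of N] by blast
  qed
  then show ?thesis using assms(2)
  proof (induction J rule: wf_induct_rule)
    case (less J)
    from less.prems show ?case
    proof (rule step)
      fix K assume "is_ideal K" "J \<subset> K"
      then show "P K" using less.prems by (intro less.IH) auto
    qed
  qed
qed

lemma fin_gen_ideal_mod:
  fixes J :: "'a::comm_ring_1 set"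
  assumes "noetherian TYPE('a)" "is_ideal J"
  shows "fin_gen (ideal_mod J)"
proof -
  obtain B where B: "finite B" "J = ideal_span B" using assms unfolding noetherian_def by blast
  obtain bs where bs: "set bs = B" "distinct bs" using finite_distinct_list[OF B(1)] by blast
  have "ideal_mod J = sum_list (map cyc (map const_poly bs))"
    using B bs by (simp add: ideal_mod_span sum_list_distinct_conv_sum_set comp_def)
  then show ?thesis unfolding fin_gen_def by blast
qed

lemma fin_gen_0 [simp]: "fin_gen 0"
  unfolding fin_gen_def by (rule exI[of _ "[]"]) simp

lemma fin_gen_plus: "fin_gen A \<Longrightarrow> fin_gen B \<Longrightarrow> fin_gen (A + B)"
  unfolding fin_gen_def by (metis map_append sum_list_append)

lemma fin_gen_sum: "(\<And>x. x \<in> X \<Longrightarrow> fin_gen (A x)) \<Longrightarrow> fin_gen (\<Sum>x\<in>X. A x)"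
  by (induction X rule: infinite_finite_induct) (simp_all add: fin_gen_plus)

lemma fin_gen_cyc_times:
  assumes "fin_gen A"
  shows "fin_gen (cyc f * A)"
proof -
  obtain gs where "A = sum_list (map cyc gs)" using assms by (auto simp: fin_gen_def)
  then have "cyc f * A = sum_list (map cyc (map ((*) f) gs))"
    by (simp add: comp_def cyc_mult flip: sum_list_const_mult)
  then show ?thesis unfolding fin_gen_def by blast
qed

lemma ideal_adjoin:
  assumes "is_ideal J"
  shows "is_ideal (ideal_span (insert a J))" "J \<subseteq> ideal_span (insert a J)" "a \<in> ideal_span (insert a J)"
    and ideal_adjoinE: "x \<in> ideal_span (insert a J) \<Longrightarrow> \<exists>j c. x = j + c * a \<and> j \<in> J"
proof -
  show "is_ideal (ideal_span (insert a J))" by (rule ring_mod.subspace_span)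
  show "J \<subseteq> ideal_span (insert a J)" "a \<in> ideal_span (insert a J)"
    using ring_mod.span_superset[of "insert a J"] by auto
  assume "x \<in> ideal_span (insert a J)"
  moreover have "ideal_span J = J" using assms by (simp add: ring_mod.span_eq_iff)
  ultimately obtain c where "x - c * a \<in> J" by (auto simp: ring_mod.span_insert)
  then show "\<exists>j c. x = j + c * a \<and> j \<in> J" by (intro exI[of _ "x - c * a"] exI[of _ c]) simp
qed

section \<open>Prime ideals and heights\<close>

lemma prime_ideal_ideal: "prime_ideal P \<Longrightarrow> is_ideal P"
  by (simp add: prime_ideal_def)

lemma prime_idealD: "prime_ideal P \<Longrightarrow> a * b \<in> P \<Longrightarrow> a \<in> P \<or> b \<in> P"
  by (simp add: prime_ideal_def)

lemma prime_ideal_one: "prime_ideal P \<Longrightarrow> 1 \<notin> P"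
  using is_ideal_eq_UNIV by (auto simp: prime_ideal_def)

lemma prime_ideal_power: "prime_ideal P \<Longrightarrow> x ^ n \<in> P \<Longrightarrow> x \<in> P"
  by (induction n) (auto dest: prime_idealD simp: prime_ideal_one)

lemma maximal_ideal_prime:
  assumes "maximal_ideal m"
  shows "prime_ideal m"
  unfolding prime_ideal_def
proof (intro conjI allI impI)
  show m: "is_ideal m" "m \<noteq> UNIV" using assms by (auto simp: maximal_ideal_def)
  fix a b assume ab: "a * b \<in> m"
  show "a \<in> m \<or> b \<in> m"
  proof (cases "a \<in> m")
    case False
    then have "ideal_span (insert a m) = UNIV"
      using assms ideal_adjoin(1-3)[OF m(1), of a] unfolding maximal_ideal_def by blast
    then obtain j c where jc: "1 = j + c * a" "j \<in> m" using ideal_adjoinE[OF m(1), of 1 a] by auto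
    have "b = (j + c * a) * b" using jc(1) by simp
    also have "\<dots> = b * j + c * (a * b)" by (simp add: algebra_simps del: ring_mod.scale_scale)
    finally have "b = b * j + c * (a * b)" .
    moreover have "b * j + c * (a * b) \<in> m"
      using ring_mod.subspace_add[OF m(1)] ring_mod.subspace_scale[OF m(1)] jc(2) ab by blast
    ultimately show ?thesis by simp
  qed simp
qed

lemma prod_list_ideal_mod_le_one: "(\<And>P. P \<in> set Ps \<Longrightarrow> is_ideal P) \<Longrightarrow> prod_list (map ideal_mod Ps) \<le> 1"
proof (induction Ps)
  case (Cons P Ps)
  then have "ideal_mod P * prod_list (map ideal_mod Ps) \<le> 1 * 1"
    by (intro msub_mult_mono ideal_mod_le_one) auto
  then show ?case by simp
qed simp

text \<open>A substitute for primary decomposition. If J is proper and not prime, there are a and b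
  outside J with ab in J; then (J + Ra)(J + Rb) lies in J, and the two lists for the larger ideals
  are concatenated. The unit ideal gets the empty list.\<close>

lemma prime_product:
  fixes J :: "'a::comm_ring_1 set"
  assumes "noetherian TYPE('a)" "is_ideal J"
  shows "\<exists>Ps. (\<forall>P\<in>set Ps. prime_ideal P \<and> J \<subseteq> P) \<and> prod_list (map ideal_mod Ps) \<le> ideal_mod J"
  using assms
proof (induction J rule: noetherian_induct)
  case (1 J)
  consider "J = UNIV" | "prime_ideal J" | a b where "a * b \<in> J" "a \<notin> J" "b \<notin> J"
    using 1(1) unfolding prime_ideal_def by blast
  then show ?case
  proof cases
    case 1
    then show ?thesis by (intro exI[of _ "[]"]) (simp add: ideal_mod_UNIV)
  next
    case 2
    then show ?thesis by (intro exI[of _ "[J]"]) simp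
  next
    case (3 a b)
    define K where "K = (\<lambda>a. ideal_span (insert a J))"
    have K: "is_ideal (K x)" "J \<subseteq> K x" "x \<in> K x" for x
      unfolding K_def by (rule ideal_adjoin[OF 1(1)])+
    have "J \<subset> K a" "J \<subset> K b" using K(2)[of a] K(3)[of a] K(2)[of b] K(3)[of b] 3 by blast+
    then obtain Ps Qs where PQ: "\<forall>P\<in>set Ps. prime_ideal P \<and> K a \<subseteq> P" "prod_list (map ideal_mod Ps) \<le> ideal_mod (K a)"
      "\<forall>P\<in>set Qs. prime_ideal P \<and> K b \<subseteq> P" "prod_list (map ideal_mod Qs) \<le> ideal_mod (K b)"
      using 1(2)[OF K(1)] by metis
    have "x * y \<in> J" if xy: "x \<in> K a" "y \<in> K b" for x y
    proof -
      obtain j c where x: "x = j + c * a" "j \<in> J"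
        using ideal_adjoinE[OF 1(1), of x a] xy(1) by (auto simp: K_def)
      obtain j' c' where y: "y = j' + c' * b" "j' \<in> J"
        using ideal_adjoinE[OF 1(1), of y b] xy(2) by (auto simp: K_def)
      have "x * y = y * j + ((c * a) * j' + (c * c') * (a * b))" by (simp add: x(1) y(1) algebra_simps del: ring_mod.scale_scale)
      also have "\<dots> \<in> J"
        using ring_mod.subspace_add[OF 1(1)] ring_mod.subspace_scale[OF 1(1)] x(2) y(2) 3(1) by blast
      finally show ?thesis .
    qed
    then have "ideal_mod (K a) * ideal_mod (K b) \<le> ideal_mod J"
      unfolding times_le_iff
      by (auto simp: set_of_ideal_mod K(1) 1(1) simp flip: const_poly_mult)
    moreover have "prod_list (map ideal_mod (Ps @ Qs)) \<le> ideal_mod (K a) * ideal_mod (K b)"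
      using msub_mult_mono[OF PQ(2,4)] by simp
    ultimately have "prod_list (map ideal_mod (Ps @ Qs)) \<le> ideal_mod J" by (rule order_trans[rotated])
    moreover have "prime_ideal P \<and> J \<subseteq> P" if "P \<in> set Ps \<or> P \<in> set Qs" for P
      using that PQ(1,3) K(2)[of a] K(2)[of b] by blast
    ultimately show ?thesis by (intro exI[of _ "Ps @ Qs"]) simp
  qed
qed

text \<open>Consequently the list from \<open>prime_product\<close> contains every minimal prime
  over the ideal.\<close>

lemma prime_contains_factor:
  assumes "prime_ideal P" "prod_list (map ideal_mod Ps) \<le> ideal_mod P" "\<And>Q. Q \<in> set Ps \<Longrightarrow> is_ideal Q"
  shows "\<exists>Q\<in>set Ps. Q \<subseteq> P"
  using assms(2,3)
proof (induction Ps)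
  case Nil
  have "const_poly 1 \<in> set_of (ideal_mod P)"
    using Nil by (auto simp: less_eq_msub_def set_of_1 simp del: const_poly_1)
  then show ?case
    using prime_ideal_one[OF assms(1)] const_poly_in_ideal_mod[OF prime_ideal_ideal[OF assms(1)]] by blast
next
  case (Cons Q Ps)
  note P = prime_ideal_ideal[OF assms(1)]
  show ?case
  proof (cases "Q \<subseteq> P")
    case False
    then obtain x where x: "x \<in> Q" "x \<notin> P" by blast
    have "prod_list (map ideal_mod Ps) \<le> ideal_mod P"
      unfolding less_eq_msub_def
    proof
      fix f assume f: "f \<in> set_of (prod_list (map ideal_mod Ps))"
      have "prod_list (map ideal_mod Ps) \<le> 1"
        using Cons.prems(2) by (intro prod_list_ideal_mod_le_one) auto
      then obtain y where y: "f = const_poly y" using le_one_const f by blast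
      have "const_poly x \<in> set_of (ideal_mod Q)"
        using x(1) Cons.prems(2)[of Q] by (simp add: const_poly_in_ideal_mod)
      then have "const_poly x * f \<in> set_of (ideal_mod P)"
        using times_in_set_of[OF _ f] Cons.prems(1) by (auto simp: less_eq_msub_def)
      then have "x * y \<in> P" by (simp add: y const_poly_in_ideal_mod[OF P] flip: const_poly_mult)
      then have "y \<in> P" using prime_idealD[OF assms(1)] x(2) by blast
      then show "f \<in> set_of (ideal_mod P)" by (simp add: y const_poly_in_ideal_mod[OF P])
    qed
    then show ?thesis using Cons by auto
  qed simp
qed

text \<open>A minimal member \<open>P\<close> is removed, and \<open>x\<close> avoids the others. If
  \<open>x\<close> falls into \<open>P\<close>, it is corrected by an element of \<open>A\<close>
  that lies in all other members but not in \<open>P\<close>.\<close>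

lemma prime_avoidance:
  assumes "finite \<P>" "\<And>P. P \<in> \<P> \<Longrightarrow> prime_ideal P \<and> \<not> A \<subseteq> P" "is_ideal A"
  shows "\<exists>x\<in>A. \<forall>P\<in>\<P>. x \<notin> P"
  using assms(1,2)
proof (induction "card \<P>" arbitrary: \<P>)
  case 0
  then show ?case using ring_mod.subspace_0[OF assms(3)] by auto
next
  case (Suc n)
  then have "\<P> \<noteq> {}" by auto
  then obtain P where P: "P \<in> \<P>" "\<forall>P'\<in>\<P>. P' \<subseteq> P \<longrightarrow> P = P'"
    using finite_has_minimal[OF Suc.prems(1)] by blast
  have prime: "prime_ideal P" using Suc.prems(2) P(1) by blast
  define \<Q> where "\<Q> = \<P> - {P}"
  have "card \<Q> = n" using Suc.hyps(2) Suc.prems(1) P(1) by (simp add: \<Q>_def)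
  then obtain x where x: "x \<in> A" "\<forall>Q\<in>\<Q>. x \<notin> Q"
    using Suc.hyps(1)[of \<Q>] Suc.prems by (auto simp: \<Q>_def)
  show ?case
  proof (cases "x \<in> P")
    case False
    then show ?thesis using x by (intro bexI[of _ x]) (auto simp: \<Q>_def)
  next
    case True
    \<comment> \<open>Minimality of \<open>P\<close> is used here: no other member is contained in
      \<open>P\<close>.\<close>
    have "\<forall>Q\<in>\<Q>. \<exists>z. z \<in> Q \<and> z \<notin> P" using P by (auto simp: \<Q>_def)
    then obtain z where z: "\<And>Q. Q \<in> \<Q> \<Longrightarrow> z Q \<in> Q \<and> z Q \<notin> P" by metis
    obtain a where a: "a \<in> A" "a \<notin> P" using Suc.prems(2)[OF P(1)] by blast
    define y where "y = (\<Prod>Q\<in>\<Q>. z Q) * a"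
    have fin: "finite \<Q>" using Suc.prems(1) by (simp add: \<Q>_def)
    have "y \<in> A" unfolding y_def by (rule ring_mod.subspace_scale[OF assms(3) a(1)])
    have "(\<Prod>Q\<in>X. z Q) \<notin> P" if "X \<subseteq> \<Q>" "finite X" for X
      using that(2,1)
    proof (induction X rule: finite_induct)
      case (insert Q X)
      then show ?case using prime_idealD[OF prime, of "z Q" "\<Prod>Q\<in>X. z Q"] z[of Q] by auto
    qed (simp add: prime_ideal_one[OF prime])
    then have y: "y \<notin> P" unfolding y_def using prime_idealD[OF prime] a(2) fin by blast
    have yQ: "y \<in> Q" if Q: "Q \<in> \<Q>" for Q
    proof -
      have "is_ideal Q" using Suc.prems(2) Q by (auto simp: \<Q>_def intro: prime_ideal_ideal)
      moreover have "y = ((\<Prod>Q\<in>\<Q> - {Q}. z Q) * a) * z Q"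
        using fin Q by (simp add: y_def prod.remove[of _ Q] mult_ac del: ring_mod.scale_scale)
      ultimately show ?thesis using ring_mod.subspace_scale z[OF Q] by metis
    qed
    have "x + y \<in> A" using ring_mod.subspace_add[OF assms(3) x(1) \<open>y \<in> A\<close>] .
    moreover have "x + y \<notin> P"
      using ring_mod.subspace_diff[OF prime_ideal_ideal[OF prime], of "x + y" x] True y by auto
    moreover have "x + y \<notin> Q" if Q: "Q \<in> \<Q>" for Q
    proof -
      have "is_ideal Q" using Suc.prems(2) Q by (auto simp: \<Q>_def intro: prime_ideal_ideal)
      then show ?thesis
        using ring_mod.subspace_diff[of Q "x + y" y] yQ[OF Q] x(2) Q by auto
    qed
    ultimately show ?thesis by (intro bexI[of _ "x + y"]) (auto simp: \<Q>_def)
  qed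
qed

text \<open>The height as a lower bound by an explicit chain of primes ending in \<open>P\<close>,
  which avoids a supremum that might be infinite.\<close>

definition height_ge :: "'a::comm_ring_1 set \<Rightarrow> nat \<Rightarrow> bool" where
  "height_ge P n \<longleftrightarrow> (\<exists>C. (\<forall>i\<le>n. prime_ideal (C i)) \<and> (\<forall>i<n. C i \<subset> C (Suc i)) \<and> C n = P)"

lemma height_ge_Suc:
  assumes "height_ge P n" "P \<subset> P'" "prime_ideal P'"
  shows "height_ge P' (Suc n)"
proof -
  obtain C where "\<forall>i\<le>n. prime_ideal (C i)" "\<forall>i<n. C i \<subset> C (Suc i)" "C n = P"
    using assms(1) by (auto simp: height_ge_def)
  then show ?thesis
    unfolding height_ge_def using assms(2,3)
    by (intro exI[of _ "\<lambda>i. if i \<le> n then C i else P'"]) (auto simp: le_Suc_eq less_Suc_eq)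
qed

lemma height_ge_krull_dim:
  "height_ge (P :: 'a::comm_ring_1 set) n \<Longrightarrow> enat n \<le> krull_dim TYPE('a)"
  unfolding height_ge_def krull_dim_def by (intro Sup_upper) blast

section \<open>Noetherian local rings\<close>

locale noetherian_local =
  fixes m :: "'a::comm_ring_1 set"
  assumes noeth: "noetherian TYPE('a)" and local: "local_ring m"
begin

abbreviation "\<mm> \<equiv> ideal_mod m"

lemma maximal: "maximal_ideal m"
  using local by (simp add: local_ring_def)

lemma ideal_m: "is_ideal m"
  using maximal by (simp add: maximal_ideal_def)

text \<open>Noetherian induction takes the place of Zorn's lemma: a proper ideal that is not maximal
  lies strictly inside another proper one.\<close>

lemma proper_ideal_le:
  assumes "is_ideal J" "J \<noteq> UNIV"
  shows "J \<subseteq> m"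
  using noeth assms
proof (induction J rule: noetherian_induct)
  case (1 J)
  show ?case
  proof (cases "maximal_ideal J")
    case True
    then show ?thesis using local by (auto simp: local_ring_def)
  next
    case False
    then obtain K where "is_ideal K" "J \<subset> K" "K \<noteq> UNIV" using 1 by (auto simp: maximal_ideal_def)
    then show ?thesis using 1(2)[of K] by blast
  qed
qed

lemma ideal_eq_m: "is_ideal J \<Longrightarrow> J \<noteq> UNIV \<Longrightarrow> m \<subseteq> J \<Longrightarrow> J = m"
  using proper_ideal_le by blast

lemma prod_list_all_m: "(\<And>P. P \<in> set Ps \<Longrightarrow> P = m) \<Longrightarrow> prod_list (map ideal_mod Ps) = \<mm> ^ length Ps"
  by (induction Ps) auto

text \<open>A prime over J contains the radical of J, which is \<open>m\<close>, so all primes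
  supplied by \<open>prime_product\<close> equal \<open>m\<close>.\<close>

lemma primary_contains_power:
  assumes "primary_to m J"
  shows "\<exists>k. \<mm> ^ k \<le> ideal_mod J"
proof -
  have J: "is_ideal J" using assms by (auto simp: primary_to_def primary_ideal_def)
  obtain Ps where Ps: "\<forall>P\<in>set Ps. prime_ideal P \<and> J \<subseteq> P" "prod_list (map ideal_mod Ps) \<le> ideal_mod J"
    using prime_product[OF noeth J] by blast
  have "P = m" if "P \<in> set Ps" for P
  proof (rule ideal_eq_m)
    have P: "prime_ideal P" "J \<subseteq> P" using Ps that by auto
    then show "is_ideal P" "P \<noteq> UNIV" by (auto simp: prime_ideal_def)
    show "m \<subseteq> P"
    proof
      fix x assume "x \<in> m"
      then obtain n where "x ^ n \<in> J" using assms by (auto simp: primary_to_def radical_def)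
      then show "x \<in> P" using P prime_ideal_power by blast
    qed
  qed
  then show ?thesis using Ps(2) prod_list_all_m by metis
qed

lemma qlen_one_m: "qlen 1 \<mm> \<le> 1"
proof (rule qlen_le)
  fix n K
  assume K: "\<And>i. i \<le> n \<Longrightarrow> \<mm> \<le> K i \<and> K i \<le> 1" "\<And>i. i < n \<Longrightarrow> K i < K (Suc i)"
  have top: "A = 1" if A: "\<mm> < A" "A \<le> 1" for A
  proof -
    obtain f where f: "f \<in> set_of A" "f \<notin> set_of \<mm>" using A(1) by (auto simp: less_msub_def)
    then obtain c where c: "f = const_poly c" using le_one_const[OF A(2)] by blast
    then have "c \<notin> m" using f(2) by (simp add: const_poly_in_ideal_mod[OF ideal_m])
    then have "ideal_span (insert c m) = UNIV"
      using ideal_adjoin(1-3)[OF ideal_m, of c] maximal unfolding maximal_ideal_def by blast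
    then obtain j b where jb: "1 = j + b * c" "j \<in> m" using ideal_adjoinE[OF ideal_m, of 1 c] by auto
    have "\<mm> \<le> A" using A(1) by simp
    then have "const_poly j \<in> set_of A"
      using jb(2) const_poly_in_ideal_mod[OF ideal_m] by (auto simp: less_eq_msub_def)
    moreover have "const_poly b * f \<in> set_of A" using f(1) by (rule set_of_scale)
    ultimately have "const_poly j + const_poly b * f \<in> set_of A" by (rule set_of_add)
    then have "const_poly (j + b * c) \<in> set_of A" by (simp only: c const_poly_add const_poly_mult)
    then have "1 \<in> set_of A" using jb(1) by (metis const_poly_1)
    then have "cyc 1 \<le> A" by (simp only: cyc_le_iff)
    then show "A = 1" using A(2) by simp
  qed
  have "n \<le> 1"
  proof (rule ccontr)
    assume "\<not> n \<le> 1"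
    then have *: "\<mm> \<le> K 0" "K 0 < K 1" "K 1 \<le> 1" "K 1 < K 2" "K 2 \<le> 1"
      using K(1)[of 0] K(1)[of 1] K(1)[of 2] K(2)[of 0] K(2)[of 1] by (auto simp: numeral_2_eq_2)
    then have "K 1 = 1" by (intro top) auto
    then show False using * by simp
  qed
  then show "enat n \<le> 1" by (simp add: one_enat_def)
qed

end

section \<open>The growth of the length of powers\<close>

lemma cyc_prod: "(\<Prod>x\<in>X. cyc (f x)) = cyc (\<Prod>x\<in>X. f x)"
  by (induction X rule: infinite_finite_induct) (simp_all add: cyc_mult)

text \<open>A^n/A^(n+1) is spanned by the monomials of degree n in the generators, and each of these
  is killed by A.\<close>

lemma qlen_power_le:
  assumes A: "A = (\<Sum>l<s. cyc (g l))" "A \<le> 1"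
  shows "qlen 1 (A ^ n) \<le> of_nat (\<Sum>i<n. card (exps {..<s} i)) * qlen 1 A"
proof (induction n)
  case (Suc n)
  let ?E = "exps {..<s} n" and ?f = "\<lambda>e. \<Prod>i<s. g i ^ lookup e i"
  have Suc_le: "A ^ Suc n \<le> A ^ n" using msub_mult_mono[OF A(2) order_refl, of "A ^ n"] by simp
  have le1: "A ^ n \<le> 1" using msub_power_mono[OF A(2), of n] by simp
  have An: "A ^ n = (\<Sum>e\<in>?E. cyc (?f e))"
    unfolding A(1) msub_multinomial[OF finite_lessThan] by (simp add: expow_def cyc_power cyc_prod)
  have "qlen (A ^ n) (A ^ Suc n) = qlen (A ^ Suc n + (\<Sum>e\<in>?E. cyc (?f e))) (A ^ Suc n)"
    using msub_add_absorb[OF Suc_le] An by simp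
  also have "\<dots> \<le> of_nat (card ?E) * qlen 1 A"
  proof (rule qlen_span_le[OF _ A(2)])
    fix e assume "e \<in> ?E"
    then have "cyc (?f e) \<le> A ^ n" unfolding An by (intro le_sum_msub) auto
    then have "cyc (?f e) * A \<le> A ^ n * A" by (intro msub_mult_mono order_refl)
    then show "cyc (?f e) * A \<le> A ^ Suc n" by (simp add: mult.commute)
  qed simp
  finally have "qlen 1 (A ^ Suc n) \<le> of_nat (\<Sum>i<n. card (exps {..<s} i)) * qlen 1 A + of_nat (card ?E) * qlen 1 A"
    using Suc.IH by (subst qlen_add[OF Suc_le le1]) (rule add_mono)
  then show ?case by (simp add: distrib_right)
qed simp

text \<open>With at most \<open>d\<close> generators there are at most n^(d-1) monomials in each
  degree below n. This is where the exponent \<open>d\<close> of the growth bound comes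
  from.\<close>

lemma sum_card_exps_le:
  assumes "s \<le> d" "d > 0"
  shows "(\<Sum>i<n. card (exps {..<s} i)) \<le> n ^ d"
proof -
  have "card (exps {..<s} i) \<le> n ^ (d - 1)" if "i < n" for i
  proof (cases "s = 0")
    case True
    then show ?thesis using that by (simp add: exps_empty)
  next
    case False
    then have "card (exps {..<s} i) \<le> Suc i ^ (s - 1)" using card_exps_le[of "{..<s}" i] by auto
    also have "\<dots> \<le> n ^ (s - 1)" using that by (intro power_mono) auto
    also have "\<dots> \<le> n ^ (d - 1)" using that assms by (intro power_increasing) auto
    finally show ?thesis .
  qed
  then have "(\<Sum>i<n. card (exps {..<s} i)) \<le> (\<Sum>i<n. n ^ (d - 1))" by (intro sum_mono) auto
  also have "\<dots> = n ^ d" using assms(2) by (cases d) auto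
  finally show ?thesis .
qed

lemma sum_list_cyc: "sum_list (map cyc gs) = (\<Sum>l<length gs. cyc (gs ! l))"
  by (simp add: sum_list_sum_nth atLeast0LessThan)

context noetherian_local
begin

lemma m_le_one: "\<mm> \<le> 1"
  using ideal_mod_le_one[OF ideal_m] .

lemma qlen_m_power_finite: "qlen 1 (\<mm> ^ k) \<noteq> \<infinity>"
proof -
  obtain gs where "\<mm> = sum_list (map cyc gs)"
    using fin_gen_ideal_mod[OF noeth ideal_m] by (auto simp: fin_gen_def)
  then have gs: "\<mm> = (\<Sum>l<length gs. cyc (gs ! l))" by (simp only: sum_list_cyc)
  have "qlen 1 (\<mm> ^ k) \<le> of_nat (\<Sum>i<k. card (exps {..<length gs} i)) * qlen 1 \<mm>"
    by (rule qlen_power_le[OF gs m_le_one])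
  also have "\<dots> \<le> of_nat (\<Sum>i<k. card (exps {..<length gs} i)) * 1"
    using qlen_one_m by (intro mult_left_mono) auto
  also have "\<dots> = enat (\<Sum>i<k. card (exps {..<length gs} i))"
    by (simp only: mult_1_right of_nat_eq_enat)
  finally show ?thesis by (auto dest: enat_ile)
qed

text \<open>The primes \<open>Ps\<close> from \<open>prime_product\<close> include the minimal ones
  over (xs). Without a power of \<open>m\<close> in (xs) one of them differs from \<open>m\<close>,
  so \<open>m\<close> has height above i. Prime avoidance gives x in \<open>m\<close> outside all of
  them except \<open>m\<close>; a prime over x and xs contains some listed Q, and either Q is
  \<open>m\<close> or x makes the inclusion strict.\<close>

lemma parameter_step:
  assumes xs: "set xs \<subseteq> m" "\<And>P. prime_ideal P \<Longrightarrow> set xs \<subseteq> P \<Longrightarrow> height_ge P i"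
    and no: "\<nexists>k. \<mm> ^ k \<le> ideal_mod (ideal_span (set xs))"
  shows "height_ge m (Suc i) \<and> (\<exists>x\<in>m. \<forall>P. prime_ideal P \<longrightarrow> set (x # xs) \<subseteq> P \<longrightarrow> height_ge P (Suc i))"
proof -
  let ?J = "ideal_span (set xs)"
  have J: "is_ideal ?J" by (rule ring_mod.subspace_span)
  have xs_J: "set xs \<subseteq> ?J" by (rule ring_mod.span_superset)
  obtain Ps where Ps: "\<And>P. P \<in> set Ps \<Longrightarrow> prime_ideal P \<and> ?J \<subseteq> P" "prod_list (map ideal_mod Ps) \<le> ideal_mod ?J"
    using prime_product[OF noeth J] by blast
  have height: "height_ge P i" if "P \<in> set Ps" for P
    using xs(2)[of P] Ps(1)[OF that] xs_J by blast
  have below: "P \<subset> m" if "P \<in> set Ps" "P \<noteq> m" for P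
    using that Ps(1)[of P] proper_ideal_le[of P] by (auto simp: prime_ideal_def)
  note m_prime = maximal_ideal_prime[OF maximal]
  obtain P0 where P0: "P0 \<in> set Ps" "P0 \<noteq> m"
    using no Ps(2) prod_list_all_m by metis
  have m_height: "height_ge m (Suc i)"
    using height_ge_Suc[OF height[OF P0(1)] below[OF P0] m_prime] .
  have "\<exists>x\<in>m. \<forall>P\<in>{P \<in> set Ps. P \<noteq> m}. x \<notin> P"
    by (rule prime_avoidance) (use Ps(1) below ideal_m in \<open>auto simp: psubset_eq\<close>)
  then obtain x where x: "x \<in> m" "\<And>P. P \<in> set Ps \<Longrightarrow> P \<noteq> m \<Longrightarrow> x \<notin> P" by blast
  have "height_ge P (Suc i)" if P: "prime_ideal P" "set (x # xs) \<subseteq> P" for P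
  proof -
    have "?J \<subseteq> P" using P by (intro ring_mod.span_minimal prime_ideal_ideal) auto
    then have "prod_list (map ideal_mod Ps) \<le> ideal_mod P"
      using Ps(2) ideal_mod_le_iff[OF J prime_ideal_ideal[OF P(1)]] by auto
    then obtain Q where Q: "Q \<in> set Ps" "Q \<subseteq> P"
      using prime_contains_factor[OF P(1)] Ps(1) prime_ideal_ideal by blast
    show ?thesis
    proof (cases "Q = m")
      case True
      then have "P = m" using P Q ideal_eq_m[of P] by (auto simp: prime_ideal_def)
      then show ?thesis using m_height by simp
    next
      case False
      then have "Q \<subset> P" using Q x(2)[OF Q(1)] P(2) by auto
      then show ?thesis using height_ge_Suc[OF height[OF Q(1)] _ P(1)] by blast
    qed
  qed
  then show ?thesis using m_height x(1) by blast
qed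

text \<open>Half of the theory of systems of parameters. Elements are adjoined until their ideal
  contains a power of \<open>m\<close>; each failure raises the heights by one, and a failure with
  \<open>d\<close> elements would give \<open>m\<close> height at least d + 1.\<close>

lemma parameters:
  assumes "krull_dim TYPE('a) = enat d"
  obtains xs k where "length xs \<le> d" "set xs \<subseteq> m" "\<mm> ^ k \<le> ideal_mod (ideal_span (set xs))"
proof -
  define good where "good = (\<lambda>xs. \<exists>k. \<mm> ^ k \<le> ideal_mod (ideal_span (set xs)))"
  have step: "(\<exists>xs. length xs \<le> i \<and> set xs \<subseteq> m \<and> good xs) \<or>
    (\<exists>xs. length xs = i \<and> set xs \<subseteq> m \<and> (\<forall>P. prime_ideal P \<longrightarrow> set xs \<subseteq> P \<longrightarrow> height_ge P i))" for i
  proof (induction i)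
    case 0
    have "height_ge P 0" if "prime_ideal P" for P :: "'a set"
      unfolding height_ge_def using that by (intro exI[of _ "\<lambda>_. P"]) simp
    then show ?case by (intro disjI2 exI[of _ "[]"]) simp
  next
    case (Suc i)
    show ?case
    proof (cases "\<exists>xs. length xs \<le> i \<and> set xs \<subseteq> m \<and> good xs")
      case True
      then show ?thesis using le_SucI by blast
    next
      case False
      then obtain xs where xs: "length xs = i" "set xs \<subseteq> m"
        "\<And>P. prime_ideal P \<Longrightarrow> set xs \<subseteq> P \<Longrightarrow> height_ge P i"
        using Suc by blast
      have "\<not> good xs" using False xs by auto
      then obtain x where "x \<in> m" "\<forall>P. prime_ideal P \<longrightarrow> set (x # xs) \<subseteq> P \<longrightarrow> height_ge P (Suc i)"
        using parameter_step[OF xs(2,3)] unfolding good_def by blast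
      then show ?thesis using xs by (intro disjI2 exI[of _ "x # xs"]) auto
    qed
  qed
  show thesis
  proof (cases "\<exists>xs. length xs \<le> d \<and> set xs \<subseteq> m \<and> good xs")
    case True
    then show ?thesis using that by (auto simp: good_def)
  next
    case False
    then obtain xs where xs: "length xs = d" "set xs \<subseteq> m"
      "\<And>P. prime_ideal P \<Longrightarrow> set xs \<subseteq> P \<Longrightarrow> height_ge P d"
      using step[of d] by blast
    have "\<not> good xs" using False xs by auto
    then have "height_ge m (Suc d)"
      using parameter_step[OF xs(2,3)] unfolding good_def by blast
    then have "enat (Suc d) \<le> enat d" using height_ge_krull_dim assms by metis
    then show ?thesis by simp
  qed
qed

text \<open>Let Q be generated by at most d parameters. Then A^n contains m^(kn), hence Q^(kn),
  whose colength is at most (kn)^d times that of Q. The constant depends on \<open>k\<close> but not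
  on \<open>A\<close>.\<close>

lemma qlen_power_growth:
  assumes "krull_dim TYPE('a) = enat d" "d > 0"
  shows "\<exists>C. \<forall>A n. \<mm> ^ k \<le> A \<longrightarrow> qlen 1 (A ^ n) \<le> enat (C * n ^ d)"
proof -
  obtain xs l where xs: "length xs \<le> d" "set xs \<subseteq> m" "\<mm> ^ l \<le> ideal_mod (ideal_span (set xs))"
    using parameters[OF assms(1)] by blast
  define Q where "Q = ideal_mod (ideal_span (set xs))"
  define ys where "ys = remdups xs"
  have ys: "length ys \<le> d" "set ys = set xs" "distinct ys"
    using order_trans[OF length_remdups_leq xs(1)] by (auto simp: ys_def)
  have "Q = (\<Sum>b\<in>set ys. cyc (const_poly b))"
    by (simp add: Q_def ideal_mod_span ys)
  also have "\<dots> = (\<Sum>l<length ys. cyc (const_poly (ys ! l)))"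
    using sum_list_distinct_conv_sum_set[OF ys(3), of "\<lambda>b. cyc (const_poly b)"]
    by (simp add: sum_list_sum_nth atLeast0LessThan)
  finally have Q: "Q = (\<Sum>l<length ys. cyc (const_poly (ys ! l)))" .
  have span_le: "ideal_span (set xs) \<subseteq> m" using xs(2) ideal_m by (rule ring_mod.span_minimal)
  have Qm: "Q \<le> \<mm>" unfolding Q_def
    using span_le by (simp add: ideal_mod_le_iff ring_mod.subspace_span ideal_m)
  have Q1: "Q \<le> 1" using Qm m_le_one by (rule order_trans)
  have "qlen 1 Q \<le> qlen 1 (\<mm> ^ l)" using xs(3) by (intro qlen_mono) (auto simp: Q_def)
  then obtain c where c: "qlen 1 Q = enat c"
    using qlen_m_power_finite[of l] by (cases "qlen 1 (\<mm> ^ l)") (auto dest: enat_ile)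
  have "qlen 1 (A ^ n) \<le> enat (k ^ d * c * n ^ d)" if A: "\<mm> ^ k \<le> A" for A n
  proof -
    have "Q ^ (k * n) \<le> \<mm> ^ (k * n)" by (rule msub_power_mono[OF Qm])
    also have "\<dots> = (\<mm> ^ k) ^ n" by (rule power_mult)
    also have "\<dots> \<le> A ^ n" by (rule msub_power_mono[OF A])
    finally have "qlen 1 (A ^ n) \<le> qlen 1 (Q ^ (k * n))" by (intro qlen_mono order_refl)
    also have "\<dots> \<le> of_nat (\<Sum>i<k * n. card (exps {..<length ys} i)) * qlen 1 Q"
      by (rule qlen_power_le[OF Q Q1])
    also have "\<dots> = enat ((\<Sum>i<k * n. card (exps {..<length ys} i)) * c)"
      by (simp only: c of_nat_eq_enat times_enat_simps)
    also have "\<dots> \<le> enat ((k * n) ^ d * c)"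
      unfolding enat_ord_simps by (intro mult_le_mono1 sum_card_exps_le ys(1) assms(2))
    finally show ?thesis by (simp add: power_mult_distrib mult_ac)
  qed
  then show ?thesis by blast
qed

end

section \<open>Buchsbaum-Rim polynomials\<close>

lemma poly_eq_if_eventually_eq:
  fixes P Q :: "'b::{idom, ring_char_0} poly"
  assumes "\<And>n. n \<ge> N \<Longrightarrow> poly P (of_nat n) = poly Q (of_nat n)"
  shows "P = Q"
proof (rule ccontr)
  assume "P \<noteq> Q"
  then have "finite {x. poly (P - Q) x = 0}" by (intro poly_roots_finite) simp
  moreover have "of_nat ` {N..} \<subseteq> {x. poly (P - Q) x = 0}" using assms by auto
  ultimately have "finite (of_nat ` {N..} :: 'b set)" by (rule rev_finite_subset)
  then have "finite {N..}" by (rule finite_imageD) (simp add: inj_on_def)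
  then obtain M where "\<And>n. n \<ge> N \<Longrightarrow> n \<le> M" by (auto simp: finite_nat_set_iff_bounded_le)
  from this[of "Suc (M + N)"] show False by simp
qed

lemma br_poly_eq:
  assumes "\<And>p. br_fun r M p = enat (L p)" "\<And>p. p \<ge> N \<Longrightarrow> of_nat (L p) = poly P (of_nat p)"
  shows "br_poly r M = P"
  unfolding br_poly_def
proof (rule the_equality)
  show "\<exists>N. \<forall>p\<ge>N. \<exists>k. br_fun r M p = enat k \<and> of_nat k = poly P (of_nat p)"
    using assms by blast
next
  fix P' :: "rat poly" assume "\<exists>N. \<forall>p\<ge>N. \<exists>k. br_fun r M p = enat k \<and> of_nat k = poly P' (of_nat p)"
  then obtain N' where "\<And>p. p \<ge> N' \<Longrightarrow> of_nat (L p) = poly P' (of_nat p)"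
    using assms(1) by auto
  then show "P' = P"
    using assms(2) by (intro poly_eq_if_eventually_eq[of "max N N'"]) (metis max.bounded_iff)
qed

text \<open>Uniqueness is obtained in two stages: for each large p the polynomials in q coincide,
  and then so do the polynomials in p, which have these as values.\<close>

lemma br_poly2_eq:
  assumes "\<And>p q. br_fun2 r M p q = enat (L p q)"
    "\<And>p q. p \<ge> N \<Longrightarrow> q \<ge> N \<Longrightarrow> of_nat (L p q) = poly (poly P [:of_nat p:]) (of_nat q)"
  shows "br_poly2 r M = P"
  unfolding br_poly2_def
proof (rule the_equality)
  show "\<exists>N. \<forall>p\<ge>N. \<forall>q\<ge>N. \<exists>k. br_fun2 r M p q = enat k \<and> of_nat k = poly (poly P [:of_nat p:]) (of_nat q)"
    using assms by blast
next
  fix P' :: "rat poly poly" assume "\<exists>N. \<forall>p\<ge>N. \<forall>q\<ge>N. \<exists>k. br_fun2 r M p q = enat k \<and> of_nat k = poly (poly P' [:of_nat p:]) (of_nat q)"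
  then obtain N' where N': "\<And>p q. p \<ge> N' \<Longrightarrow> q \<ge> N' \<Longrightarrow> of_nat (L p q) = poly (poly P' [:of_nat p:]) (of_nat q)"
    using assms(1) by (metis enat.inject)
  have "poly P' [:of_nat p:] = poly P [:of_nat p:]" if "p \<ge> max N N'" for p
    by (rule poly_eq_if_eventually_eq[of "max N N'"]) (use that assms(2) N' in \<open>simp flip: assms(2) N'\<close>)
  then show "P' = P"
    by (intro poly_eq_if_eventually_eq[of "max N N'"]) (simp add: of_nat_poly)
qed

lemma exps_singleton: "exps {i} n = {single i n}"
proof -
  have "e = single i (lookup e i)" if "keys e \<subseteq> {i}" for e :: "nat \<Rightarrow>\<^sub>0 nat"
    using that by (intro poly_mapping_eqI) (auto simp: lookup_single when_def in_keys_iff)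
  then show ?thesis by (auto simp: exps_def lookup_single split: if_splits)
qed

text \<open>Ensures that the sum defining \<open>trunc_sum\<close> is nonempty for the vectors that
  occur.\<close>

lemma exps_below:
  assumes "finite X" "e \<in> exps X (p + q)"
  shows "\<exists>a\<in>exps X p. \<forall>i. lookup a i \<le> lookup e i"
  using assms(2)
proof (induction p arbitrary: q)
  case 0
  show ?case by (intro bexI[of _ 0]) (simp_all add: exps_def)
next
  case (Suc p)
  then obtain a where a: "a \<in> exps X p" "\<forall>i. lookup a i \<le> lookup e i" using Suc.IH[of "Suc q"] by auto
  have "\<exists>i\<in>X. lookup a i < lookup e i"
  proof (rule ccontr)
    assume "\<not> (\<exists>i\<in>X. lookup a i < lookup e i)"
    then have "(\<Sum>i\<in>X. lookup e i) \<le> (\<Sum>i\<in>X. lookup a i)" by (intro sum_mono) auto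
    then show False using a(1) Suc.prems by (simp add: exps_def)
  qed
  then obtain i where i: "i \<in> X" "lookup a i < lookup e i" by blast
  have "single i 1 \<in> exps X 1"
    using i(1) assms(1) by (auto simp: exps_def lookup_single when_def split: if_splits)
  then have "a + single i 1 \<in> exps X (p + 1)" by (rule exps_add[OF a(1)])
  moreover have "lookup (a + single i 1) l \<le> lookup e l" for l
    using a(2) i(2) by (cases "i = l") (auto simp: lookup_add lookup_single)
  ultimately show ?case by auto
qed

context noetherian_local
begin

text \<open>One function \<open>L\<close> serves both because the ordinary Buchsbaum-Rim function is
  \<Lambda>(p, 0).\<close>

lemma br_fun_polynomial:
  assumes Js: "\<And>i. i < length Js \<Longrightarrow> is_ideal (Js ! i) \<and> \<mm> ^ k \<le> ideal_mod (Js ! i)"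
  shows "\<exists>L. (\<forall>p q. br_fun2 (length Js) (cyclic_sum_ker Js) p q = enat (L p q)) \<and>
    (\<forall>p. br_fun (length Js) (cyclic_sum_ker Js) p = enat (L p 0)) \<and>
    evbipoly (\<lambda>p q. of_nat (L p q)) \<and> evpoly (\<lambda>p. of_nat (L p 0))"
proof -
  define r where "r = length Js"
  define A where "A = (\<lambda>i. ideal_mod (Js ! i))"
  have A: "A i \<le> 1" "\<mm> ^ k \<le> A i" "fin_gen (A i)" if "i < r" for i
    using Js[of i] that by (auto simp: A_def r_def ideal_mod_le_one fin_gen_ideal_mod[OF noeth])
  interpret filtration "ker_mod r A" "free_mod r" "\<mm> ^ k" "\<lambda>l. single (single l 1) 1" r
  proof
    show "fin_gen (ker_mod r A)"
      unfolding ker_mod_def Tm_def by (intro fin_gen_sum fin_gen_cyc_times A) simp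
    show "free_mod r = (\<Sum>l<r. cyc (single (single l 1) 1))"
      by (simp add: free_mod_def Tm_def)
    show "ker_mod r A \<le> free_mod r" by (rule ker_mod_le_free_mod) (rule A)
    show "\<mm> ^ k \<le> 1" using msub_power_mono[OF m_le_one, of k] by simp
    show "qlen 1 (\<mm> ^ k) \<noteq> \<infinity>" by (rule qlen_m_power_finite)
    have "free_mod r * \<mm> ^ k \<le> ker_mod r A"
      unfolding free_mod_def ker_mod_def sum_distrib_right
      by (intro sum_mono msub_mult_mono order_refl A) simp
    then show "\<mm> ^ k * free_mod r \<le> ker_mod r A" by (simp add: mult.commute)
  qed
  obtain L where L: "\<And>p q. qlen (free_mod r ^ (p + q)) (ker_mod r A ^ p * free_mod r ^ q) = enat (L p q)"
    "evbipoly (\<lambda>p q. of_nat (L p q))" "evpoly (\<lambda>p. of_nat (L p 0))"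
    using qlen_power_polynomial by blast
  have "br_fun2 (length Js) (cyclic_sum_ker Js) p q = enat (L p q)" for p q
    using br_fun2_eq[of Js p q] Js L(1)[of p q] by (simp add: r_def A_def)
  moreover have "br_fun (length Js) (cyclic_sum_ker Js) p = enat (L p 0)" for p
    using br_fun_eq[of Js p] Js L(1)[of p 0] by (simp add: r_def A_def)
  ultimately show ?thesis using L(2,3) by blast
qed

lemma br_fun_single:
  assumes "is_ideal J"
  shows "br_fun 1 (cyclic_sum_ker [J]) p = qlen 1 (ideal_mod J ^ p)"
proof -
  have one: "{..<Suc 0} = {0}" by auto
  have "br_fun (length [J]) (cyclic_sum_ker [J]) p =
    qlen (free_mod 1 ^ p) (ker_mod 1 (\<lambda>i. ideal_mod ([J] ! i)) ^ p)"
    using assms by (subst br_fun_eq) auto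
  also have "\<dots> = (\<Sum>e\<in>exps {..<1} p. qlen 1 (expow {..<1} (\<lambda>i. ideal_mod ([J] ! i)) e))"
    by (rule qlen_ker_mod_power) (use assms in \<open>auto simp: ideal_mod_le_one\<close>)
  also have "\<dots> = qlen 1 (ideal_mod J ^ p)"
    by (simp add: one exps_singleton expow_def)
  finally show ?thesis by simp
qed

lemma br_fun_pair:
  assumes "is_ideal J" "is_ideal K"
  shows "br_fun 2 (cyclic_sum_ker [J, K]) p =
    (\<Sum>c\<le>p. qlen 1 (ideal_mod J ^ (p - c) * ideal_mod K ^ c))"
proof -
  let ?A = "\<lambda>i. ideal_mod ([J, K] ! i)"
  have two: "{..<2} = insert 0 {1 :: nat}" by auto
  have ideal: "is_ideal ([J, K] ! i)" if "i < 2" for i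
    using that assms by (cases i) auto
  have "br_fun (length [J, K]) (cyclic_sum_ker [J, K]) p = qlen (free_mod 2 ^ p) (ker_mod 2 ?A ^ p)"
    using ideal by (subst br_fun_eq) (auto simp: numeral_2_eq_2)
  also have "\<dots> = (\<Sum>e\<in>exps {..<2} p. qlen 1 (expow {..<2} ?A e))"
    by (rule qlen_ker_mod_power) (intro ideal_mod_le_one ideal)
  also have "\<dots> = (\<Sum>k\<le>p. qlen 1 (expow {..<2} ?A (single 0 k + single 1 (p - k))))"
    unfolding two by (subst sum_exps_insert) (simp_all add: exps_singleton)
  also have "\<dots> = (\<Sum>k\<le>p. qlen 1 (ideal_mod J ^ k * ideal_mod K ^ (p - k)))"
    unfolding two by (simp add: expow_def lookup_add lookup_single)
  also have "\<dots> = (\<Sum>c\<le>p. qlen 1 (ideal_mod J ^ (p - c) * ideal_mod K ^ c))"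
    by (rule sum.reindex_bij_witness[of _ "\<lambda>k. p - k" "\<lambda>k. p - k"]) auto
  finally show ?thesis by (simp add: numeral_2_eq_2)
qed

text \<open>With \<open>B\<close> a power of the maximal ideal this bounds the lengths of R/J(p, e)
  uniformly in q and \<open>e\<close>, including the vectors for which J(p, e) is not
  computed.\<close>

lemma trunc_sum_ge:
  assumes "\<And>i. i < r \<Longrightarrow> B \<le> A i" "e \<in> exps {..<r} (p + q)"
  shows "B ^ p \<le> trunc_sum r A p e"
proof -
  obtain a where a: "a \<in> exps {..<r} p" "\<forall>i. lookup a i \<le> lookup e i"
    using exps_below[OF finite_lessThan assms(2)] by blast
  have "B ^ p = (\<Prod>i<r. B ^ lookup a i)"
    using a(1) by (simp add: exps_def flip: power_sum)
  also have "\<dots> \<le> expow {..<r} A a"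
  proof -
    have "(\<Prod>i\<in>X. B ^ lookup a i) \<le> expow X A a" if "X \<subseteq> {..<r}" "finite X" for X
      using that(2,1)
    proof (induction X rule: finite_induct)
      case (insert i X)
      then show ?case
        by (auto simp: expow_def intro!: msub_mult_mono msub_power_mono assms(1))
    qed (simp add: expow_def)
    then show ?thesis by simp
  qed
  also have "\<dots> \<le> trunc_sum r A p e"
    unfolding trunc_sum_def using a by (intro le_sum_msub) auto
  finally show ?thesis .
qed

lemma common_power:
  fixes I :: "nat \<Rightarrow> 'a set"
  assumes "\<And>i. i < r \<Longrightarrow> primary_to m (I i)"
  shows "\<exists>k. \<forall>i<r. \<mm> ^ k \<le> ideal_mod (I i)"
proof -
  have "\<forall>i. \<exists>k. i < r \<longrightarrow> \<mm> ^ k \<le> ideal_mod (I i)" using primary_contains_power assms by blast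
  then obtain f where f: "\<And>i. i < r \<Longrightarrow> \<mm> ^ f i \<le> ideal_mod (I i)" by metis
  have "\<mm> ^ (\<Sum>i<r. f i) \<le> ideal_mod (I i)" if "i < r" for i
  proof -
    have "f i \<le> (\<Sum>i<r. f i)" using that by (intro member_le_sum) auto
    then have "\<mm> ^ (\<Sum>i<r. f i) = \<mm> ^ f i * \<mm> ^ ((\<Sum>i<r. f i) - f i)" by (simp flip: power_add)
    also have "\<dots> \<le> \<mm> ^ f i * 1 ^ ((\<Sum>i<r. f i) - f i)"
      by (intro msub_mult_mono msub_power_mono order_refl m_le_one)
    finally show ?thesis using f[OF that] by simp
  qed
  then show ?thesis by blast
qed

end

text \<open>Shows that the coefficient of q^n, computed for each fixed p, is a polynomial in p whose
  coefficients are those of the bivariate polynomial.\<close>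

lemma poly_const_coeff:
  "coeff (poly P [:x:]) n = poly (map_poly (\<lambda>c. coeff c n) P) x" for x :: rat
proof (induction P)
  case (pCons c P)
  then show ?case by (simp add: map_poly_pCons)
qed simp

theorem theorem1p1:
  fixes m :: "'a::comm_ring_1 set"
    and I :: "nat \<Rightarrow> 'a set"
    and d r :: nat
  assumes "noetherian TYPE('a)"
    and "local_ring m"
    and "krull_dim TYPE('a) = enat d"
    and "d > 0"
    and "r \<ge> 2"
    and "\<And>i. i < r \<Longrightarrow> primary_to m (I i)"
  shows "assoc_br_mult d (r - 2) (map I [0..<r]) =
    E_pred d r I - of_nat ((d + 1) * (r - 1)) * br_mult d [\<Sum>i<r. I i]"
proof -
  interpret noetherian_local m by unfold_locales (fact assms)+
  define A where "A = (\<lambda>i. ideal_mod (I i))"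
  define K where "K = (\<lambda>j. \<Sum>i\<in>{..<r} - {j}. I i)"
  define S where "S = (\<Sum>i<r. I i)"
  have ideal: "is_ideal (I i)" if "i < r" for i
    using assms(6)[OF that] by (auto simp: primary_to_def primary_ideal_def)
  obtain k where k: "\<And>i. i < r \<Longrightarrow> \<mm> ^ k \<le> A i"
    using common_power[of r I] assms(6) by (auto simp: A_def)
  have A1: "A i \<le> 1" if "i < r" for i
    using ideal_mod_le_one[OF ideal[OF that]] by (simp add: A_def)
  have S: "is_ideal S" "ideal_mod S = (\<Sum>i<r. A i)"
    unfolding S_def A_def using ideal_mod_sum[of "{..<r}" I] ideal by auto
  have K: "is_ideal (K j)" "ideal_mod (K j) = (\<Sum>i\<in>{..<r} - {j}. A i)" for j
    unfolding K_def A_def using ideal_mod_sum[of "{..<r} - {j}" I] ideal by auto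
  have kS: "\<mm> ^ k \<le> ideal_mod S"
    unfolding S(2) using assms(5) by (intro order_trans[OF k[of 0]] le_sum_msub) auto
  have kK: "\<mm> ^ k \<le> ideal_mod (K j)" for j
  proof -
    \<comment> \<open>As r >= 2, some index differs from \<open>j\<close>, so \<open>K j\<close> is
      a nonempty sum and contains \<open>\<mm> ^ k\<close> as well.\<close>
    define i where "i = (if j = 0 then 1 else 0 :: nat)"
    have "i < r" "i \<noteq> j" using assms(5) by (auto simp: i_def)
    then show ?thesis unfolding K(2) by (intro order_trans[OF k[of i]] le_sum_msub) auto
  qed

  have ideals: "is_ideal (map I [0..<r] ! i) \<and> \<mm> ^ k \<le> ideal_mod (map I [0..<r] ! i)"
    if "i < length (map I [0..<r])" for i
    using that ideal k by (simp add: A_def)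
  obtain L2 where L2: "\<And>p q. br_fun2 r (cyclic_sum_ker (map I [0..<r])) p q = enat (L2 p q)"
    "evbipoly (\<lambda>p q. of_nat (L2 p q))"
    using br_fun_polynomial[of "map I [0..<r]", OF ideals] by auto
  have ideals: "is_ideal ([S] ! i) \<and> \<mm> ^ k \<le> ideal_mod ([S] ! i)" if "i < length [S]" for i
    using that S(1) kS by simp
  obtain L1 where L1: "\<And>p. br_fun 1 (cyclic_sum_ker [S]) p = enat (L1 p)" "evpoly (\<lambda>p. of_nat (L1 p))"
    using br_fun_polynomial[of "[S]", OF ideals] by auto
  have ideals: "is_ideal ([K j, S] ! i) \<and> \<mm> ^ k \<le> ideal_mod ([K j, S] ! i)"
    if "i < length [K j, S]" for i j
    using that S(1) K(1) kS kK by (cases i) auto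
  have "\<exists>L. (\<forall>p. br_fun 2 (cyclic_sum_ker [K j, S]) p = enat (L p)) \<and> evpoly (\<lambda>p. of_nat (L p))" for j
    using br_fun_polynomial[of "[K j, S]", OF ideals] by (auto simp: numeral_2_eq_2)
  then obtain LK where LK: "\<And>j p. br_fun 2 (cyclic_sum_ker [K j, S]) p = enat (LK j p)"
    "\<And>j. evpoly (\<lambda>p. of_nat (LK j p))" by metis

  obtain P2 :: "rat poly poly" and N2 where P2: "\<And>p q. p \<ge> N2 \<Longrightarrow> q \<ge> N2 \<Longrightarrow> of_nat (L2 p q) = poly (poly P2 [:of_nat p:]) (of_nat q)"
    using L2(2) unfolding evbipoly_def by blast
  obtain P1 :: "rat poly" and N1 where P1: "\<And>p. p \<ge> N1 \<Longrightarrow> of_nat (L1 p) = poly P1 (of_nat p)"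
    using L1(2) unfolding evpoly_def by blast
  have "\<forall>j. \<exists>P :: rat poly. \<exists>N. \<forall>p\<ge>N. of_nat (LK j p) = poly P (of_nat p)"
    using LK(2) unfolding evpoly_def by blast
  then obtain PK :: "nat \<Rightarrow> rat poly" and NK where PK: "\<And>j p. p \<ge> NK j \<Longrightarrow> of_nat (LK j p) = poly (PK j) (of_nat p)"
    by metis
  have br_P2: "br_poly2 r (cyclic_sum_ker (map I [0..<r])) = P2" by (rule br_poly2_eq[OF L2(1) P2])
  have br_P1: "br_poly 1 (cyclic_sum_ker [S]) = P1" by (rule br_poly_eq[OF L1(1) P1])
  have br_PK: "br_poly 2 (cyclic_sum_ker [K j, S]) = PK j" for j by (rule br_poly_eq[OF LK(1) PK])

  have len_S: "qlen 1 (ideal_mod S ^ p) = enat (L1 p)" for p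
    using br_fun_single[OF S(1)] L1(1) by simp
  have len_K: "(\<Sum>c\<le>p. qlen 1 (ideal_mod (K j) ^ (p - c) * ideal_mod S ^ c)) = enat (LK j p)" for j p
    using br_fun_pair[OF K(1) S(1)] LK(1) by simp
  \<comment> \<open>The only input from dimension theory; it keeps stray copies of \<open>P1\<close>
    away from the coefficient of p^(d+1).\<close>
  have degree_P1: "degree P1 \<le> d"
  proof -
    obtain C where C: "\<And>n. qlen 1 (ideal_mod S ^ n) \<le> enat (C * n ^ d)"
      using qlen_power_growth[OF assms(3,4), of k] kS by blast
    show ?thesis
    proof (rule degree_le_if_bounded)
      fix n assume n: "n \<ge> N1"
      have "L1 n \<le> C * n ^ d" using C[of n] by (simp add: len_S)
      then have "(of_nat (L1 n) :: rat) \<le> of_nat (C * n ^ d)" by (rule of_nat_mono)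
      then show "\<bar>poly P1 (of_nat n)\<bar> \<le> of_nat C * of_nat (n + 0) ^ d"
        using P1[OF n] by (metis abs_of_nat add_0_right of_nat_mult of_nat_power)
    qed
  qed

  \<comment> \<open>\<kappa> - c p, divided by (r - 1)!, is the coefficient of q^(r-2) in the number
    of vectors with all entries at least p.\<close>
  define \<kappa> where "\<kappa> = (\<Sum>i<r - 1. of_nat (Suc i) :: rat)"
  define c where "c = (of_nat ((r - 1) * (r - 1)) :: rat)"
  \<comment> \<open>The coefficient of q^(r-2) as a polynomial in p. \<open>P1\<close> is subtracted
    from \<open>PK j\<close> because a small entry at j takes only values c < p, while the function
    of the pair also includes c = p.\<close>
  define R where "R = smult (1 / fact (r - 1)) (P1 * [:\<kappa>, - c:])
    + smult (1 / fact (r - 2)) (\<Sum>j<r. PK j - P1)"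
  have coeff_eq: "coeff (poly P2 [:of_nat p:]) (r - 2) = poly R (of_nat p)"
    if p: "p \<ge> N2" "p \<ge> N1" "\<And>j. j < r \<Longrightarrow> p \<ge> NK j" for p
  proof -
    define g where "g = (\<lambda>e. the_enat (qlen 1 (trunc_sum r A p e)))"
    define b where "b = (\<lambda>j c. the_enat (qlen 1 (ideal_mod (K j) ^ (p - c) * ideal_mod S ^ c)))"
    \<comment> \<open>For fixed p, J(p, e) contains \<open>\<mm> ^ (k * p)\<close> for every e,
      which gives the bound needed for vectors with several small entries.\<close>
    obtain C where C: "qlen 1 (\<mm> ^ (k * p)) = enat C" using qlen_m_power_finite by blast
    have g_le: "qlen 1 (trunc_sum r A p e) \<le> enat C" if "e \<in> exps {..<r} (p + q)" for e q
    proof -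
      have "\<mm> ^ (k * p) \<le> trunc_sum r A p e"
        unfolding power_mult using k that by (rule trunc_sum_ge)
      then show ?thesis unfolding C[symmetric] by (intro qlen_mono order_refl)
    qed
    have g: "qlen 1 (trunc_sum r A p e) = enat (g e)" "g e \<le> C" if "e \<in> exps {..<r} (p + q)" for e q
      using enat_ile[OF g_le[OF that]] g_le[OF that] by (auto simp: g_def)
    have sum_g: "L2 p q = (\<Sum>e\<in>exps {..<r} (p + q). g e)" for q
    proof -
      have "enat (L2 p q) = qlen (free_mod r ^ (p + q)) (ker_mod r (\<lambda>i. ideal_mod (map I [0..<r] ! i)) ^ p * free_mod r ^ q)"
        using br_fun2_eq[of "map I [0..<r]" p q] ideal L2(1)[of p q] by simp
      also have "ker_mod r (\<lambda>i. ideal_mod (map I [0..<r] ! i)) = ker_mod r A"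
        unfolding ker_mod_def A_def by (intro sum.cong) auto
      also have "qlen (free_mod r ^ (p + q)) (ker_mod r A ^ p * free_mod r ^ q) =
        (\<Sum>e\<in>exps {..<r} (p + q). qlen 1 (trunc_sum r A p e))"
        by (rule qlen_ker_mod_free_mod) (rule A1)
      also have "\<dots> = enat (\<Sum>e\<in>exps {..<r} (p + q). g e)"
        unfolding sum_enat[symmetric] by (intro sum.cong refl g(1))
      finally show ?thesis by simp
    qed
    have "enat (LK j p) = (\<Sum>c<p. qlen 1 (ideal_mod (K j) ^ (p - c) * ideal_mod S ^ c)) + enat (L1 p)" for j
      unfolding len_K[symmetric] len_S[symmetric] lessThan_Suc_atMost[symmetric] by simp
    moreover have "qlen 1 (ideal_mod (K j) ^ (p - c) * ideal_mod S ^ c) = enat (b j c)" if "c < p" for j c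
    proof -
      have "qlen 1 (ideal_mod (K j) ^ (p - c) * ideal_mod S ^ c) \<le> enat (LK j p)"
        unfolding len_K[symmetric] using that by (intro member_le_sum) auto
      then show ?thesis using enat_ile by (fastforce simp: b_def)
    qed
    ultimately have "enat (LK j p) = enat (\<Sum>c<p. b j c) + enat (L1 p)" for j
      by (simp add: sum_enat[symmetric])
    then have sum_b: "LK j p = (\<Sum>c<p. b j c) + L1 p" for j by simp
    have "coeff (poly P2 [:of_nat p:]) (r - 2) =
      of_nat (L1 p) * (\<Sum>i<r - 1. of_nat (Suc i) - of_nat ((r - 1) * p)) / fact (r - 1)
      + of_nat (\<Sum>j<r. \<Sum>c<p. b j c) / fact (r - 2)"
    proof (rule coeff_graded_sum[OF assms(5)])
      fix q assume "q \<ge> N2"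
      then show "of_nat (\<Sum>e\<in>exps {..<r} (p + q). g e) = poly (poly P2 [:of_nat p:]) (of_nat q)"
        using P2[OF p(1)] sum_g by metis
    next
      fix e q assume "\<And>i. i < r \<Longrightarrow> p \<le> lookup e i"
      then have "trunc_sum r A p e = ideal_mod S ^ p" unfolding S(2) by (rule trunc_sum_all_large)
      then show "g e = L1 p" by (simp add: g_def len_S)
    next
      fix e q j assume "j < r" "lookup e j < p" "\<And>i. i < r \<Longrightarrow> i \<noteq> j \<Longrightarrow> p \<le> lookup e i"
      then have "trunc_sum r A p e = ideal_mod (K j) ^ (p - lookup e j) * ideal_mod S ^ lookup e j"
        unfolding S(2) K(2) by (intro trunc_sum_one_small) auto
      then show "g e = b j (lookup e j)" by (simp add: g_def b_def)
    next
      fix e q assume "e \<in> exps {..<r} (p + q)"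
      then show "g e \<le> C" by (rule g(2))
    qed
    also have "(\<Sum>i<r - 1. of_nat (Suc i) - of_nat ((r - 1) * p)) = \<kappa> - c * of_nat p"
      using assms(5) by (simp add: c_def \<kappa>_def sum_subtractf of_nat_diff)
    also have "of_nat (\<Sum>j<r. \<Sum>c<p. b j c) = (\<Sum>j<r. poly (PK j) (of_nat p) - poly P1 (of_nat p))"
    proof -
      have "of_nat (\<Sum>c<p. b j c) = poly (PK j) (of_nat p) - poly P1 (of_nat p)" if "j < r" for j
        using PK[OF p(3)[OF that]] P1[OF p(2)] sum_b[of j] by (simp flip: of_nat_sum)
      then show ?thesis unfolding of_nat_sum[of _ "{..<r}"] by (intro sum.cong refl) simp
    qed
    also have "of_nat (L1 p) = poly P1 (of_nat p)" by (rule P1[OF p(2)])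
    finally show ?thesis by (simp add: R_def poly_sum mult.commute[of c])
      (simp add: algebra_simps del: ring_mod.scale_scale)
  qed
  \<comment> \<open>The coefficient of q^(r-2) extracted from \<open>P2\<close>; it agrees with
    \<open>R\<close> at all large p.\<close>
  define Q where "Q = map_poly (\<lambda>c. coeff c (r - 2)) P2"
  define N where "N = Max (insert N1 (insert N2 (NK ` {..<r})))"
  have "Q = R"
  proof (rule poly_eq_if_eventually_eq)
    fix p assume p: "p \<ge> N"
    have "N1 \<le> N" "N2 \<le> N" "\<And>j. j < r \<Longrightarrow> NK j \<le> N"
      unfolding N_def by (intro Max_ge; simp)+
    then show "poly Q (of_nat p) = poly R (of_nat p)"
      unfolding Q_def poly_const_coeff[symmetric] using p by (intro coeff_eq) (meson order_trans)+
  qed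
  then have "coeff (coeff P2 (d + 1)) (r - 2) = coeff R (d + 1)"
    by (metis Q_def coeff_map_poly coeff_0)
  \<comment> \<open>By \<open>degree_P1\<close>, \<kappa> times \<open>P1\<close> and the subtracted
    copies of \<open>P1\<close> do not reach p^(d+1); of \<open>P1\<close> only -c p times its p^d
    term remains.\<close>
  also have "coeff R (d + 1) = - (c * coeff P1 d / fact (r - 1))
    + (\<Sum>j<r. coeff (PK j) (d + 1)) / fact (r - 2)"
    using degree_P1 by (simp add: R_def coeff_sum coeff_eq_0 mult.commute[of P1])
  finally have main: "coeff (coeff P2 (d + 1)) (r - 2) = - (c * coeff P1 d / fact (r - 1))
    + (\<Sum>j<r. coeff (PK j) (d + 1)) / fact (r - 2)" .
  obtain s where s: "r = Suc (Suc s)" using assms(5) by (metis add_2_eq_Suc le_Suc_ex)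
  have "assoc_br_mult d (r - 2) (map I [0..<r]) = coeff (coeff P2 (d + 1)) (r - 2) * fact (d + 1) * fact (r - 2)"
    using br_P2 by (simp add: assoc_br_mult_def Let_def s)
  also have "\<dots> = (\<Sum>j<r. coeff (PK j) (d + 1)) * fact (d + 1) - of_nat ((d + 1) * (r - 1)) * (coeff P1 d * fact d)"
  proof -
    have fact_r: "fact (r - 1) = of_nat (r - 1) * (fact (r - 2) :: rat)" by (simp add: s)
    have "of_nat (r - 1) \<noteq> (0 :: rat)" by (simp add: s)
    then have c: "c / fact (r - 1) * fact (r - 2) = of_nat (r - 1)"
      unfolding fact_r c_def of_nat_mult by simp
    have *: "(- (c * x / f) + y / g) * F * g = y * F - (c / f * g) * (x * F)"
      if "f \<noteq> 0" "g \<noteq> 0" for x y f g F :: rat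
      using that by (simp add: field_simps del: ring_mod.scale_scale)
    show ?thesis
      unfolding main *[OF fact_nonzero fact_nonzero] c of_nat_mult by (simp add: algebra_simps del: ring_mod.scale_scale)
  qed
  also have "coeff P1 d * fact d = br_mult d [\<Sum>i<r. I i]"
    using br_P1 by (simp add: br_mult_def Let_def S_def)
  also have "(\<Sum>j<r. coeff (PK j) (d + 1)) * fact (d + 1) = E_pred d r I"
    using br_PK by (simp add: E_pred_def br_mult_def Let_def S_def K_def numeral_2_eq_2 sum_distrib_right)
  finally show ?thesis .
qed

end
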